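(* Let $n\geqslant 2$, let $\Omega\subset\mathbb{R}^n$ be a bounded convex domain, and write $d_x=\operatorname{dist}(x,\partial\Omega)$. Let $f:\Omega\times(-\infty,0)\times\mathbb{R}^n\to\mathbb{R}$ satisfy: $(f_1)$ $f\in C(\Omega\times(-\infty,0)\times\mathbb{R}^n)$; $(f_2)$ for all $x\in\Omega$ and $q\in\mathbb{R}^n$, $f(x,z,q)$ is non-decreasing in $z\in(-\infty,0)$; $(f_3)$ there are constants $A>0$, $\alpha\in\mathbb{R}$, $\beta\geqslant n+1$ and $\gamma<\min\{n+\alpha,\beta-n+1\}$ such that $$0<f(x,z,q)\leqslant A\,d_x^{\beta-n-1}|z|^{-\alpha}(1+|q|^2)^{\frac{\gamma}{2}}\quad\text{for all }(x,z,q)\in\Omega\times(-\infty,0)\times\mathbb{R}^n;$$ $(f_1')$ there exists a constant $\delta_0\in(0,1)$ such that $f\in C^{0,\delta_0}_{\operatorname{loc}}(\Omega\times(-\infty,0)\times\mathbb{R}^n)$; $(f_2')$ for all $x\in\Omega$ and $q\in\mathbb{R}^n$, $f(x,z,q)$ is strictly increasing in $z\in(-\infty,0)$. Then the viscosity solution over $\Omega$ to the Dirichlet problem $$\det D^2u=f(x,u,\nabla u)\ \text{ in }\Omega,\qquad u=0\ \text{ on }\partial\Omega$$ is unique.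
   Context: Definitions (for the equation $\det D^2u=f(x,u,\nabla u)$ over $\Omega$). Let $u\in C(\overline{\Omega})$ be a convex function with $u<0$ in $\Omega$ (so that $f(x,u(x),\cdot)$ is defined). (i) $u$ is a viscosity subsolution over $\Omega$ if for any $x_0\in\Omega$, any open neighborhood $U(x_0)$ of $x_0$ and any convex function $\phi\in C^2(U(x_0)\cap\Omega)$ with $(\phi-u)(x)\geqslant(\phi-u)(x_0)$ for all $x\in U(x_0)\cap\Omega$, one has $\det D^2\phi(x_0)\geqslant f(x_0,u(x_0),\nabla\phi(x_0))$. (ii) $u$ is a viscosity supersolution over $\Omega$ if for any $x_0\in\Omega$, any open neighborhood $U(x_0)$ of $x_0$ and any convex function $\phi\in C^2(U(x_0)\cap\Omega)$ with $(\phi-u)(x)\leqslant(\phi-u)(x_0)$ for all $x\in U(x_0)\cap\Omega$, one has $\det D^2\phi(x_0)\leqslant f(x_0,u(x_0),\nabla\phi(x_0))$. (iii) $u$ is a viscosity solution to the Dirichlet problem over $\Omega$ if it is both a viscosity subsolution and a viscosity supersolution over $\Omega$ and $u=0$ on $\partial\Omega$. Notation: $C^{0,\delta_0}_{\operatorname{loc}}$ denotes the functions that are Hölder continuous with exponent $\delta_0$ on every compact subset of the domain. *)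

theory Defs
  imports "HOL-Analysis.Analysis"
begin

definition grad :: "(real^'n \<Rightarrow> real) \<Rightarrow> real^'n \<Rightarrow> real^'n" where
  "grad \<phi> x = (THE D. GDERIV \<phi> x :> D)"

definition hessian :: "(real^'n \<Rightarrow> real) \<Rightarrow> real^'n \<Rightarrow> real^'n^'n" where
  "hessian \<phi> x = jacobian (grad \<phi>) (at x)"

(* Only meaningful on open sets V: the derivatives are full (two-sided) derivatives in the ambient
   space, and on an open V they do not depend on the values of \<phi> outside V. *)
definition C2_on :: "(real^'n) set \<Rightarrow> (real^'n \<Rightarrow> real) \<Rightarrow> bool" where
  "C2_on V \<phi> \<longleftrightarrow>
     (\<forall>x\<in>V. \<phi> differentiable (at x)) \<and>
     (\<forall>x\<in>V. grad \<phi> differentiable (at x)) \<and>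
     continuous_on V (hessian \<phi>)"

(* The library's convex_on forces its domain to be convex, but the domain of a test function is the
   intersection of an arbitrary open neighbourhood with the convex domain, which need not be convex.
   On a general set, convexity is understood as convexity along every convex subset; for convex V
   this is convex_on V \<phi>. *)
definition convex_fun_on :: "(real^'n) set \<Rightarrow> (real^'n \<Rightarrow> real) \<Rightarrow> bool" where
  "convex_fun_on V \<phi> \<longleftrightarrow> (\<forall>C. C \<subseteq> V \<and> convex C \<longrightarrow> convex_on C \<phi>)"

lemma convex_fun_on_iff_convex_on: "convex V \<Longrightarrow> convex_fun_on V \<phi> \<longleftrightarrow> convex_on V \<phi>"
  unfolding convex_fun_on_def by (meson convex_on_subset order_refl)

definition locally_Hoelder_on ::
    "real \<Rightarrow> 'a::metric_space set \<Rightarrow> ('a \<Rightarrow> real) \<Rightarrow> bool" where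
  "locally_Hoelder_on \<delta> S F \<longleftrightarrow>
     (\<forall>K. K \<subseteq> S \<and> compact K \<longrightarrow>
       (\<exists>C\<ge>0. \<forall>p\<in>K. \<forall>q\<in>K. \<bar>F p - F q\<bar> \<le> C * dist p q powr \<delta>))"

(* The standing requirements on a candidate u; negativity makes f x (u x) q meaningful on \<Omega>. *)
definition admissible :: "(real^'n) set \<Rightarrow> (real^'n \<Rightarrow> real) \<Rightarrow> bool" where
  "admissible \<Omega> u \<longleftrightarrow>
     continuous_on (closure \<Omega>) u \<and> convex_on (closure \<Omega>) u \<and> (\<forall>x\<in>\<Omega>. u x < 0)"

definition viscosity_subsolution ::
    "(real^'n) set \<Rightarrow> (real^'n \<Rightarrow> real \<Rightarrow> real^'n \<Rightarrow> real) \<Rightarrow> (real^'n \<Rightarrow> real) \<Rightarrow> bool" where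
  "viscosity_subsolution \<Omega> f u \<longleftrightarrow> admissible \<Omega> u \<and>
     (\<forall>x0\<in>\<Omega>. \<forall>U \<phi>. open U \<and> x0 \<in> U \<and> C2_on (U \<inter> \<Omega>) \<phi> \<and> convex_fun_on (U \<inter> \<Omega>) \<phi> \<and>
        (\<forall>x\<in>U \<inter> \<Omega>. \<phi> x - u x \<ge> \<phi> x0 - u x0) \<longrightarrow>
        det (hessian \<phi> x0) \<ge> f x0 (u x0) (grad \<phi> x0))"

definition viscosity_supersolution ::
    "(real^'n) set \<Rightarrow> (real^'n \<Rightarrow> real \<Rightarrow> real^'n \<Rightarrow> real) \<Rightarrow> (real^'n \<Rightarrow> real) \<Rightarrow> bool" where
  "viscosity_supersolution \<Omega> f u \<longleftrightarrow> admissible \<Omega> u \<and>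
     (\<forall>x0\<in>\<Omega>. \<forall>U \<phi>. open U \<and> x0 \<in> U \<and> C2_on (U \<inter> \<Omega>) \<phi> \<and> convex_fun_on (U \<inter> \<Omega>) \<phi> \<and>
        (\<forall>x\<in>U \<inter> \<Omega>. \<phi> x - u x \<le> \<phi> x0 - u x0) \<longrightarrow>
        det (hessian \<phi> x0) \<le> f x0 (u x0) (grad \<phi> x0))"

definition viscosity_solution ::
    "(real^'n) set \<Rightarrow> (real^'n \<Rightarrow> real \<Rightarrow> real^'n \<Rightarrow> real) \<Rightarrow> (real^'n \<Rightarrow> real) \<Rightarrow> bool" where
  "viscosity_solution \<Omega> f u \<longleftrightarrow>
     viscosity_subsolution \<Omega> f u \<and> viscosity_supersolution \<Omega> f u \<and> (\<forall>x\<in>frontier \<Omega>. u x = 0)"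

end

theory Submission
  imports Defs
begin

text \<open>
Suppose a subsolution \<open>u\<close> exceeds a supersolution \<open>v\<close> somewhere and double the variables: at a maximum
of \<open>u x + \<eta>/2 * \<bar>x\<bar>\<^sup>2 - v z - K * \<bar>x - z\<bar>\<^sup>2\<close> the convex function \<open>u\<close> is touched from above by a
paraboloid, so it is differentiable there and its nearby subgradients are close to the gradient.
Hence \<open>u\<close> satisfies \<open>det D\<^sup>2u \<ge> c\<close> with a constant \<open>c\<close> in the viscosity sense nearby. Since \<open>det\<^sup>1\<^sup>/\<^sup>n\<close> is an
infimum of the linear functionals \<open>D\<^sup>2u \<mapsto> 1/n * \<Sum>\<^sub>i t\<^sub>i \<cdot> D\<^sup>2u t\<^sub>i\<close> over frames \<open>t\<close> of determinant one, this property survives mollification,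
provided that viscosity inequalities for these linear operators do. The latter follows from a
comparison with the discrete heat flow generated by averaging over \<open>x \<plusminus> h * t\<^sub>i\<close>: started from a smooth
function just above \<open>u\<close>, the flow stays smooth and convex, is itself a test function for \<open>u\<close>, and
therefore grows at the rate prescribed by the inequality. The mollification of \<open>u\<close>, suitably
translated, is then a test function for \<open>v\<close>, which gives the structural inequality of the
theorem on sums without the theorems of Jensen and Alexandrov. Letting \<open>K \<rightarrow> \<infinity>\<close> and \<open>\<eta> \<rightarrow> 0\<close>
contradicts the strict monotonicity of \<open>f\<close> in its second argument.
\<close>

section \<open>Symmetric matrices\<close>


text \<open>The obstacle is that a viscosity inequality speaks only about contact points, whereas
  mollification needs an inequality between functions that can be integrated. The estimate
  \<open>U z + b * t \<le> (walk h T ^^ k) U z + \<epsilon>\<close> is of that kind: it holds at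
  every nearby point, survives convolution, and for a smooth function gives back the differential
  inequality as \<open>t\<close> tends to 0. Averaging over translates is the right evolution
  because it preserves convexity, which test functions must have, does not enlarge the Lipschitz
  constant of the Hessian, and commutes with convolution. Since \<open>f\<close> depends on the
  point, the value and the gradient, it must be replaced by a constant before mollifying; this is
  why nearby subgradients have to be controlled. The quadratic term with \<open>\<eta>\<close>
  leaves room for the approximation: replaced by its linear part at \<open>x0\<close>, it makes the
  maximum strict in \<open>x\<close>, so that the maximum survives a small change of
  \<open>u\<close>, and it adds nothing to the Hessian of the test function.\<close>

lemma symmetric_matrix_inner:
  fixes A :: "real^'n^'n"
  assumes "transpose A = A"
  shows "(A *v x) \<bullet> y = x \<bullet> (A *v y)"
  by (metis assms dot_lmul_matrix vector_transpose_matrix)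

text \<open>AM-GM from \<open>t \<le> exp (t - 1)\<close>: with \<open>t = a i / \<mu>\<close> and
  \<open>\<mu>\<close> the mean, the exponents add up to 0.\<close>

lemma prod_le_mean_power:
  fixes a :: "'n::finite \<Rightarrow> real"
  assumes a: "\<And>i. a i \<ge> 0"
  shows "(\<Prod>i\<in>UNIV. a i) \<le> ((\<Sum>i\<in>UNIV. a i) / real CARD('n)) ^ CARD('n)"
proof -
  define \<mu> where "\<mu> = (\<Sum>i\<in>UNIV. a i) / real CARD('n)"
  have \<mu>0: "\<mu> \<ge> 0" unfolding \<mu>_def by (simp add: sum_nonneg a)
  show ?thesis
  proof (cases "\<mu> = 0")
    case True
    then have "(\<Sum>i\<in>UNIV. a i) = 0" by (simp add: \<mu>_def)
    then have "\<And>i. a i = 0" by (subst (asm) sum_nonneg_eq_0_iff) (auto simp: a)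
    then show ?thesis by simp
  next
    case False
    with \<mu>0 have \<mu>: "\<mu> > 0" by simp
    have "(\<Prod>i\<in>UNIV. a i / \<mu>) \<le> (\<Prod>i\<in>UNIV. exp (a i / \<mu> - 1))"
    proof (rule prod_mono)
      fix i show "0 \<le> a i / \<mu> \<and> a i / \<mu> \<le> exp (a i / \<mu> - 1)"
        using a[of i] \<mu> exp_ge_add_one_self[of "a i / \<mu> - 1"] by simp
    qed
    also have "\<dots> = exp ((\<Sum>i\<in>UNIV. a i) / \<mu> - real CARD('n))"
      by (simp add: exp_sum[symmetric] sum_subtractf sum_divide_distrib)
    also have "\<dots> = 1"
    proof -
      have "(\<Sum>i\<in>UNIV. a i) = \<mu> * real CARD('n)" by (simp add: \<mu>_def)
      then show ?thesis using \<mu> by simp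
    qed
    finally have "(\<Prod>i\<in>UNIV. a i) / \<mu> ^ CARD('n) \<le> 1" by (simp add: prod_dividef)
    then show ?thesis using \<mu> by (simp add: \<mu>_def[symmetric] divide_le_eq)
  qed
qed

text \<open>The quadratic form attains its maximum \<open>c\<close> on the unit sphere of
  \<open>S\<close>, and the maximiser is an eigenvector. Invariance keeps the residual
  \<open>r\<close> in \<open>S\<close>, so \<open>e\<close> may be perturbed in its
  direction.\<close>

lemma symmetric_eigenvector_in_subspace:
  fixes A :: "real^'n^'n"
  assumes sym: "transpose A = A" and S: "subspace S" "S \<noteq> {0}"
    and inv: "\<And>x. x \<in> S \<Longrightarrow> A *v x \<in> S"
  obtains e c where "e \<in> S" "norm e = 1" "A *v e = c *\<^sub>R e"
proof -
  have "compact (S \<inter> sphere 0 1)"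
    using S by (intro closed_Int_compact closed_subspace compact_sphere)
  moreover have "S \<inter> sphere 0 1 \<noteq> {}"
  proof -
    obtain x where "x \<in> S" "x \<noteq> 0" using S subspace_0 by blast
    then have "x /\<^sub>R norm x \<in> S \<inter> sphere 0 1" using S by (simp add: subspace_scale)
    then show ?thesis by blast
  qed
  moreover have "continuous_on (S \<inter> sphere 0 1) (\<lambda>x. x \<bullet> (A *v x))"
    by (intro continuous_intros linear_continuous_on matrix_vector_mul_bounded_linear)
  ultimately obtain e where e: "e \<in> S \<inter> sphere 0 1"
      and max: "\<And>x. x \<in> S \<inter> sphere 0 1 \<Longrightarrow> x \<bullet> (A *v x) \<le> e \<bullet> (A *v e)"
    using continuous_attains_sup[of "S \<inter> sphere 0 1" "\<lambda>x. x \<bullet> (A *v x)"] by blast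
  define c where "c = e \<bullet> (A *v e)"
  have ne: "norm e = 1" "e \<bullet> e = 1" using e by (auto simp: norm_eq_1)
  have q: "x \<bullet> (A *v x) \<le> c * (x \<bullet> x)" if "x \<in> S" for x
  proof (cases "x = 0")
    case False
    have "(x /\<^sub>R norm x) \<bullet> (A *v (x /\<^sub>R norm x)) \<le> c"
      unfolding c_def by (rule max) (use that S False in \<open>simp add: subspace_scale\<close>)
    then show ?thesis using False
      by (simp add: matrix_vector_mult_scaleR field_simps dot_square_norm power2_eq_square)
  qed simp
  define r where "r = A *v e - c *\<^sub>R e"
  have rS: "r \<in> S" unfolding r_def using e inv S by (simp add: subspace_diff subspace_scale)
  text \<open>The quadratic form \<open>c \<bar>x\<bar>\<^sup>2 - x \<cdot> A x\<close> is nonnegative on \<open>S\<close> and vanishes at \<open>e\<close>, so its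
    derivative at \<open>e\<close> in the direction \<open>r\<close> vanishes.\<close>
  have key: "2 * t * (r \<bullet> r) \<le> t\<^sup>2 * (c * (r \<bullet> r) - r \<bullet> (A *v r))" for t
  proof -
    have "(e + t *\<^sub>R r) \<bullet> (A *v (e + t *\<^sub>R r)) \<le> c * ((e + t *\<^sub>R r) \<bullet> (e + t *\<^sub>R r))"
      by (rule q) (use e rS S in \<open>simp add: subspace_add subspace_scale\<close>)
    then have "c + 2 * t * (r \<bullet> (A *v e)) + t\<^sup>2 * (r \<bullet> (A *v r)) \<le> c * (1 + 2 * t * (r \<bullet> e) + t\<^sup>2 * (r \<bullet> r))"
      using symmetric_matrix_inner[OF sym, of e r] ne
      by (simp add: matrix_vector_right_distrib matrix_vector_mult_scaleR inner_left_distrib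
          inner_right_distrib c_def power2_eq_square inner_commute algebra_simps)
    moreover have "r \<bullet> (A *v e) = r \<bullet> r + c * (r \<bullet> e)"
      by (simp add: r_def algebra_simps inner_commute)
    ultimately show ?thesis by (simp add: algebra_simps)
  qed
  have "r \<bullet> r = 0"
  proof (rule ccontr)
    assume "r \<bullet> r \<noteq> 0"
    then have rr: "r \<bullet> r > 0" by simp
    \<comment> \<open>\<open>K\<close> exceeds the coefficient of \<open>t\<^sup>2\<close> in
      \<open>key\<close>; with \<open>t = (r \<bullet> r) / K\<close> the right-hand side there is
      at most half of the left-hand side.\<close>
    define K where "K = \<bar>c * (r \<bullet> r) - r \<bullet> (A *v r)\<bar> + 1"
    have K: "K > 0" by (simp add: K_def)
    let ?t = "(r \<bullet> r) / K"
    have "2 * ?t * (r \<bullet> r) \<le> ?t\<^sup>2 * K"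
      using key[of ?t] by (rule order_trans) (intro mult_left_mono, auto simp: K_def)
    also have "\<dots> = ?t * (r \<bullet> r)" using K by (simp add: power2_eq_square)
    finally have "(r \<bullet> r) * (r \<bullet> r) \<le> 0" using K by (simp add: field_simps)
    then show False using rr by (simp add: mult_le_0_iff)
  qed
  then show ?thesis using that[of e c] e ne by (simp add: r_def)
qed

text \<open>Induction on the dimension: one unit eigenvector is split off, and symmetry makes its
  orthogonal complement in \<open>S\<close> invariant again.\<close>

lemma symmetric_orthonormal_eigenbasis_subspace:
  fixes A :: "real^'n^'n"
  assumes sym: "transpose A = A" and S: "subspace S"
    and inv: "\<And>x. x \<in> S \<Longrightarrow> A *v x \<in> S"
  shows "\<exists>B. finite B \<and> card B = dim S \<and> B \<subseteq> S \<and> pairwise orthogonal B \<and>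
    (\<forall>b\<in>B. norm b = 1 \<and> (\<exists>c. A *v b = c *\<^sub>R b))"
  using S inv
proof (induction "dim S" arbitrary: S)
  case 0
  then show ?case by (intro exI[of _ "{}"]) auto
next
  case (Suc k)
  have "S \<noteq> {0}" using Suc.hyps(2) by auto
  then obtain e c where e: "e \<in> S" "norm e = 1" "A *v e = c *\<^sub>R e"
    using symmetric_eigenvector_in_subspace[OF sym Suc.prems(1) _ Suc.prems(2)] by blast
  define S' where "S' = S \<inter> {x. e \<bullet> x = 0}"
  have S': "subspace S'" unfolding S'_def
    by (intro subspace_inter Suc.prems subspace_hyperplane)
  have dimS': "dim S' = k"
  proof -
    have "dim {y \<in> S. \<forall>x\<in>span {e}. orthogonal x y} + dim (span {e}) = dim S"
      by (rule dim_subspace_orthogonal_to_vectors)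
         (use e Suc.prems in \<open>auto simp: span_minimal\<close>)
    moreover have "{y \<in> S. \<forall>x\<in>span {e}. orthogonal x y} = S'"
      by (auto simp: S'_def span_singleton orthogonal_def)
    moreover have "dim (span {e}) = 1" using e by (auto simp: dim_singleton)
    ultimately show ?thesis using Suc.hyps(2) by simp
  qed
  have inv': "A *v x \<in> S'" if "x \<in> S'" for x
  proof -
    have "e \<bullet> (A *v x) = (A *v e) \<bullet> x" using symmetric_matrix_inner[OF sym] by simp
    also have "\<dots> = 0" using that e by (simp add: S'_def)
    finally show ?thesis using that Suc.prems by (simp add: S'_def)
  qed
  obtain B where B: "finite B" "card B = k" "B \<subseteq> S'" "pairwise orthogonal B"
    "\<forall>b\<in>B. norm b = 1 \<and> (\<exists>c. A *v b = c *\<^sub>R b)"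
    using Suc.hyps(1)[OF dimS'[symmetric] S' inv'] dimS' by auto
  have "e \<notin> B" using B(3) e(2) by (auto simp: S'_def norm_eq_1)
  moreover have "pairwise orthogonal (insert e B)"
    using B(3,4) by (auto simp: pairwise_insert S'_def orthogonal_def inner_commute)
  ultimately show ?case using B e Suc.hyps(2)
    by (intro exI[of _ "insert e B"]) (auto simp: S'_def)
qed

lemma symmetric_orthonormal_eigenbasis:
  fixes A :: "real^'n^'n"
  assumes sym: "transpose A = A"
  obtains e :: "'n \<Rightarrow> real^'n" and l where "\<And>i j. e i \<bullet> e j = (if i = j then 1 else 0)"
    "\<And>i. A *v e i = l i *\<^sub>R e i"
proof -
  obtain B where B: "finite B" "card B = dim (UNIV :: (real^'n) set)" "pairwise orthogonal B"
    "\<forall>b\<in>B. norm b = 1 \<and> (\<exists>c. A *v b = c *\<^sub>R b)"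
    using symmetric_orthonormal_eigenbasis_subspace[OF sym subspace_UNIV] by auto
  have "card B = card (UNIV :: 'n set)" using B(2) by simp
  then obtain e where e: "bij_betw e (UNIV :: 'n set) B"
    using B(1) finite_same_card_bij[of "UNIV :: 'n set" B] by auto
  have eB: "e i \<in> B" for i using e by (auto simp: bij_betw_def)
  have "\<forall>i. \<exists>c. A *v e i = c *\<^sub>R e i" using B(4) eB by blast
  then obtain l where "\<forall>i. A *v e i = l i *\<^sub>R e i" by (rule choice[THEN exE])
  moreover have "e i \<bullet> e j = (if i = j then 1 else 0)" for i j
  proof (cases "i = j")
    case True
    have "norm (e i) = 1" using B(4) eB by blast
    then show ?thesis using True by (simp add: norm_eq_1)
  next
    case False
    then have "e i \<noteq> e j" using e by (auto simp: bij_betw_def inj_on_def)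
    then have "orthogonal (e i) (e j)" using B(3) eB by (meson pairwiseD)
    then show ?thesis using False by (simp add: orthogonal_def)
  qed
  ultimately show ?thesis using that by blast
qed

section \<open>Congruence by a frame and the variational formula for the determinant\<close>

definition cols :: "('n \<Rightarrow> real^'n) \<Rightarrow> real^'n^'n" where
  "cols T = (\<chi> i j. T j $ i)"

lemma cols_conjugate:
  fixes A :: "real^'n^'n"
  shows "transpose (cols T) ** A ** cols T = (\<chi> i j. T i \<bullet> (A *v T j))"
proof -
  have "(transpose (cols T) ** (A ** cols T)) $ i $ j = T i \<bullet> (A *v T j)" for i j
    by (simp add: matrix_matrix_mult_def transpose_def cols_def inner_vec_def matrix_vector_mult_def)
  then show ?thesis by (simp add: vec_eq_iff matrix_mul_assoc)
qed

lemma cols_gram: "transpose (cols T) ** cols T = (\<chi> i j. T i \<bullet> T j)"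
  by (simp add: matrix_matrix_mult_def transpose_def cols_def inner_vec_def vec_eq_iff)

lemma det_gram: "det (\<chi> i j. T i \<bullet> T j) = (det (cols T))\<^sup>2"
  by (simp add: cols_gram[symmetric] det_mul power2_eq_square)

lemma det_conjugate: "det (transpose P ** A ** P) = det A * (det P)\<^sup>2" for A :: "real^'n^'n"
  by (simp add: det_mul power2_eq_square)

lemma det_sq_eigenbasis:
  fixes e :: "'n \<Rightarrow> real^'n"
  assumes "\<And>i j. e i \<bullet> e j = (if i = j then 1 else 0)"
  shows "(det (cols e))\<^sup>2 = 1"
proof -
  have "(\<chi> i j. e i \<bullet> e j) = (mat 1 :: real^'n^'n)"
    by (simp add: assms mat_def vec_eq_iff)
  then show ?thesis by (metis det_gram det_I)
qed

lemma det_eigenbasis: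
  fixes A :: "real^'n^'n" and e :: "'n \<Rightarrow> real^'n"
  assumes e: "\<And>i j. e i \<bullet> e j = (if i = j then 1 else 0)" and l: "\<And>i. A *v e i = l i *\<^sub>R e i"
  shows "det A = (\<Prod>i\<in>UNIV. l i)"
proof -
  have "transpose (cols e) ** A ** cols e = (\<chi> i j. if i = j then l i else 0)"
    by (simp add: cols_conjugate e l vec_eq_iff)
  then have "det A * (det (cols e))\<^sup>2 = det (\<chi> i j. if i = j then l i else 0)"
    by (metis det_conjugate)
  also have "\<dots> = (\<Prod>i\<in>UNIV. l i)" by (subst det_diagonal) auto
  finally show ?thesis using det_sq_eigenbasis[OF e] by simp
qed

text \<open>AM-GM for the eigenvalues, whose product is the determinant and whose sum is the
  trace.\<close>

lemma det_le_trace_power: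
  fixes A :: "real^'n^'n"
  assumes sym: "transpose A = A" and psd: "\<And>x. x \<bullet> (A *v x) \<ge> 0"
  shows "det A \<le> (trace A / real CARD('n)) ^ CARD('n)"
proof -
  obtain e :: "'n \<Rightarrow> real^'n" and l where e: "\<And>i j. e i \<bullet> e j = (if i = j then 1 else 0)" and l: "\<And>i. A *v e i = l i *\<^sub>R e i"
    using symmetric_orthonormal_eigenbasis[OF sym] by blast
  have l0: "l i \<ge> 0" for i using psd[of "e i"] by (simp add: l e)
  have P: "cols e ** transpose (cols e) = mat 1"
  proof -
    have "transpose (cols e) ** cols e = mat 1"
      by (simp add: cols_gram e mat_def vec_eq_iff)
    then show ?thesis by (simp add: matrix_left_right_inverse)
  qed
  have "trace A = trace (A ** (cols e ** transpose (cols e)))" by (simp add: P)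
  also have "\<dots> = trace (transpose (cols e) ** A ** cols e)"
    by (subst matrix_mul_assoc, subst trace_mul_sym) (simp add: matrix_mul_assoc)
  also have "\<dots> = (\<Sum>i\<in>UNIV. l i)" by (simp add: cols_conjugate l e trace_def)
  finally show ?thesis using prod_le_mean_power[of l, OF l0] det_eigenbasis[OF e l] by simp
qed

text \<open>The trace bound is applied to the matrix congruent to \<open>A\<close> by
  \<open>cols T\<close>. Frames are not normalised, hence the factor
  \<open>(det (cols T))\<^sup>2\<close>.\<close>

lemma det_le_quadratic_sum_power:
  fixes A :: "real^'n^'n" and T :: "'n \<Rightarrow> real^'n"
  assumes sym: "transpose A = A" and psd: "\<And>x. x \<bullet> (A *v x) \<ge> 0"
  shows "det A * (det (cols T))\<^sup>2 \<le> ((\<Sum>i\<in>UNIV. T i \<bullet> (A *v T i)) / real CARD('n)) ^ CARD('n)"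
proof -
  let ?N = "transpose (cols T) ** A ** cols T"
  have "transpose ?N = ?N" by (simp add: matrix_transpose_mul sym matrix_mul_assoc)
  moreover have "x \<bullet> (?N *v x) \<ge> 0" for x
  proof -
    have "x \<bullet> (?N *v x) = (cols T *v x) \<bullet> (A *v (cols T *v x))"
      by (metis dot_lmul_matrix inner_commute matrix_vector_mul_assoc vector_transpose_matrix)
    then show ?thesis using psd by simp
  qed
  ultimately have "det ?N \<le> (trace ?N / real CARD('n)) ^ CARD('n)" by (rule det_le_trace_power)
  moreover have "trace ?N = (\<Sum>i\<in>UNIV. T i \<bullet> (A *v T i))" by (simp add: cols_conjugate trace_def)
  ultimately show ?thesis by (simp add: det_conjugate)
qed

text \<open>The extremal frame is the rescaled eigenbasis \<open>e i / sqrt (l i + \<eta>)\<close>.\<close>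
lemma det_ge_if_quadratic_sums_ge:
  fixes A :: "real^'n^'n"
  assumes sym: "transpose A = A" and psd: "\<And>x. x \<bullet> (A *v x) \<ge> 0"
    and ge: "\<And>T :: 'n \<Rightarrow> real^'n. c * (det (cols T))\<^sup>2
      \<le> ((\<Sum>i\<in>UNIV. T i \<bullet> (A *v T i)) / real CARD('n)) ^ CARD('n)"
  shows "c \<le> det A"
proof -
  obtain e :: "'n \<Rightarrow> real^'n" and l where e: "\<And>i j. e i \<bullet> e j = (if i = j then 1 else 0)" and l: "\<And>i. A *v e i = l i *\<^sub>R e i"
    using symmetric_orthonormal_eigenbasis[OF sym] by blast
  have l0: "l i \<ge> 0" for i using psd[of "e i"] by (simp add: l e)
  \<comment> \<open>The shift \<open>\<eta>\<close> keeps the extremal frame defined when an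
    eigenvalue vanishes; at the end it tends to 0.\<close>
  have main: "c \<le> (\<Prod>i\<in>UNIV. (l i + \<eta>))" if \<eta>: "\<eta> > 0" for \<eta>
  proof -
    have lp: "l i + \<eta> > 0" for i using l0[of i] \<eta> by simp
    define T where "T i = (1 / sqrt (l i + \<eta>)) *\<^sub>R e i" for i
    have TT: "T i \<bullet> (A *v T i) = l i / (l i + \<eta>)" for i
      using lp[of i] by (simp add: T_def matrix_vector_mult_scaleR l e)
    have "(\<Sum>i\<in>UNIV. T i \<bullet> (A *v T i)) \<le> (\<Sum>i\<in>(UNIV::'n set). 1)"
      unfolding TT using lp \<eta> by (intro sum_mono) (simp add: divide_le_eq_1)
    moreover have "(\<Sum>i\<in>UNIV. T i \<bullet> (A *v T i)) \<ge> 0" by (intro sum_nonneg psd)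
    ultimately have "((\<Sum>i\<in>UNIV. T i \<bullet> (A *v T i)) / real CARD('n)) ^ CARD('n) \<le> 1"
      by (intro power_le_one) (auto simp: divide_le_eq_1)
    with ge[of T] have 1: "c * (det (cols T))\<^sup>2 \<le> 1" by linarith
    have "T i \<bullet> T j = (if i = j then 1 / (l i + \<eta>) else 0)" for i j
      using lp[of j] by (simp add: T_def e)
    then have G: "(\<chi> i j. T i \<bullet> T j) = (\<chi> i j. if i = j then 1 / (l i + \<eta>) else 0)"
      by simp
    have "(det (cols T))\<^sup>2 = det (\<chi> i j. if i = j then 1 / (l i + \<eta>) else 0 :: real^'n^'n)"
      unfolding det_gram[symmetric] G ..
    also have "\<dots> = (\<Prod>i\<in>UNIV. 1 / (l i + \<eta>))" by (subst det_diagonal) auto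
    finally have "(det (cols T))\<^sup>2 = 1 / (\<Prod>i\<in>UNIV. (l i + \<eta>))" by (simp add: prod_dividef)
    moreover have "(\<Prod>i\<in>UNIV. (l i + \<eta>)) > 0" using lp by (simp add: prod_pos)
    ultimately show ?thesis using 1 by (simp add: field_simps del: prod_zero_iff)
  qed
  have "((\<lambda>\<eta>. \<Prod>i\<in>UNIV. (l i + \<eta>)) \<longlongrightarrow> (\<Prod>i\<in>UNIV. (l i + 0))) (at_right 0)"
    by (intro tendsto_intros)
  moreover have "eventually (\<lambda>\<eta>. c \<le> (\<Prod>i\<in>UNIV. (l i + \<eta>))) (at_right 0)"
    using eventually_at_right_less[of "0::real"] by eventually_elim (rule main)
  ultimately have "c \<le> (\<Prod>i\<in>UNIV. (l i + 0))"
    by (intro tendsto_lowerbound) auto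
  then show ?thesis by (simp add: det_eigenbasis[OF e l])
qed

section \<open>Convex functions with Lipschitz Hessian and the random-walk operator\<close>


text \<open>Gradient \<open>G\<close> and Hessian \<open>D\<close> are carried along explicitly, so
  that averaging acts on all three by the same formula. The Lipschitz bound on \<open>D\<close>
  makes every Taylor error explicit in \<open>C\<close>.\<close>

definition C21 :: "real \<Rightarrow> (real^'n \<Rightarrow> real) \<Rightarrow> (real^'n \<Rightarrow> real^'n) \<Rightarrow> (real^'n \<Rightarrow> (real^'n) \<Rightarrow>\<^sub>L (real^'n)) \<Rightarrow> bool"
where "C21 C \<phi> G D \<longleftrightarrow> convex_on UNIV \<phi> \<and>
   (\<forall>x. (\<phi> has_derivative (\<lambda>h. h \<bullet> G x)) (at x)) \<and>
   (\<forall>x. (G has_derivative blinfun_apply (D x)) (at x)) \<and>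
   (\<forall>x y. norm (D x - D y) \<le> C * norm (x - y)) \<and>
   (\<forall>x h k. D x h \<bullet> k = h \<bullet> D x k)"

lemma C21D:
  assumes "C21 C \<phi> G D"
  shows "convex_on UNIV \<phi>" "(\<phi> has_derivative (\<lambda>h. h \<bullet> G x)) (at x)"
    "(G has_derivative blinfun_apply (D x)) (at x)"
    "norm (D x - D y) \<le> C * norm (x - y)" "D x h \<bullet> k = h \<bullet> D x k"
  using assms by (auto simp: C21_def)

lemma C21_nonneg:
  assumes "C21 C (\<phi> :: real^'n \<Rightarrow> real) G D" shows "C \<ge> 0"
proof -
  have "norm (D (axis undefined 1) - D 0) \<le> C * norm (axis undefined (1::real) - 0 :: real^'n)"
    by (rule C21D(4)[OF assms])
  then have "C * norm (axis undefined (1::real) :: real^'n) \<ge> 0"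
    using norm_ge_zero order_trans by (metis diff_zero)
  then show ?thesis by simp
qed

text \<open>The trace of \<open>D\<close> against the matrix formed by summing the outer squares of
  the vectors \<open>T i\<close>: a second-order operator with constant coefficients when
  \<open>D\<close> is a Hessian.\<close>

definition quad :: "('n::finite \<Rightarrow> real^'n) \<Rightarrow> ((real^'n) \<Rightarrow>\<^sub>L (real^'n)) \<Rightarrow> real" where
  "quad T D = (\<Sum>i\<in>UNIV. T i \<bullet> D (T i))"

lemma quad_diff_le: "\<bar>quad T D - quad T E\<bar> \<le> norm (D - E) * (\<Sum>i\<in>UNIV. (norm (T i))\<^sup>2)"
proof -
  have "\<bar>quad T D - quad T E\<bar> = \<bar>\<Sum>i\<in>UNIV. T i \<bullet> (D - E) (T i)\<bar>"
    by (simp add: quad_def sum_subtractf[symmetric] inner_diff_right blinfun.diff_left)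
  also have "\<dots> \<le> (\<Sum>i\<in>UNIV. norm (D - E) * (norm (T i))\<^sup>2)"
  proof (rule order_trans[OF sum_abs], rule sum_mono)
    fix i
    have "\<bar>T i \<bullet> (D - E) (T i)\<bar> \<le> norm (T i) * norm ((D - E) (T i))" by (rule Cauchy_Schwarz_ineq2)
    also have "\<dots> \<le> norm (T i) * (norm (D - E) * norm (T i))"
      by (intro mult_left_mono norm_blinfun) auto
    finally show "\<bar>T i \<bullet> (D - E) (T i)\<bar> \<le> norm (D - E) * (norm (T i))\<^sup>2"
      by (simp add: power2_eq_square mult_ac)
  qed
  finally show ?thesis by (simp add: sum_distrib_left)
qed

text \<open>Mean value estimates at two levels: for \<open>\<psi>\<close> in the parameter
  \<open>t\<close>, and for \<open>G\<close> minus its linearisation at \<open>x\<close>. The factor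
  2 is not sharp, as \<open>t\<^sup>2\<close> is simply bounded by 1.\<close>

lemma C21_second_difference:
  assumes "C21 C \<phi> G D"
  shows "\<bar>\<phi> (x + z) + \<phi> (x - z) - 2 * \<phi> x - z \<bullet> D x z\<bar> \<le> 2 * C * norm z ^ 3"
proof -
  note C = C21D[OF assms]
  define \<psi> where "\<psi> t = \<phi> (x + t *\<^sub>R z) + \<phi> (x - t *\<^sub>R z) - t\<^sup>2 * (z \<bullet> D x z)" for t :: real
  define \<psi>' where "\<psi>' t = z \<bullet> (G (x + t *\<^sub>R z) - G (x - t *\<^sub>R z)) - 2 * t * (z \<bullet> D x z)" for t :: real
  have der: "(\<psi> has_real_derivative \<psi>' t) (at t)" for t
  proof -
    have p: "((\<lambda>t. \<phi> (x + t *\<^sub>R z)) has_derivative (\<lambda>s. (s *\<^sub>R z) \<bullet> G (x + t *\<^sub>R z))) (at t)"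
      by (rule has_derivative_compose[where g = \<phi>, OF _ C(2)]) (auto intro!: derivative_eq_intros)
    have m: "((\<lambda>t. \<phi> (x - t *\<^sub>R z)) has_derivative (\<lambda>s. (- (s *\<^sub>R z)) \<bullet> G (x - t *\<^sub>R z))) (at t)"
      by (rule has_derivative_compose[where g = \<phi>, OF _ C(2)]) (auto intro!: derivative_eq_intros)
    show ?thesis unfolding \<psi>_def has_field_derivative_def
      by (rule derivative_eq_intros p m refl)+
         (auto simp: \<psi>'_def fun_eq_iff inner_diff_right algebra_simps)
  qed
  have bd: "\<bar>\<psi>' t\<bar> \<le> 2 * C * norm z ^ 3" if t: "0 \<le> t" "t \<le> 1" for t
  proof -
    have seg: "norm (y - x) \<le> t * norm z" if "y \<in> closed_segment (x - t *\<^sub>R z) (x + t *\<^sub>R z)" for y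
    proof -
      have "closed_segment (x - t *\<^sub>R z) (x + t *\<^sub>R z) \<subseteq> cball x (t * norm z)"
        using t by (intro closed_segment_subset) (auto simp: dist_norm)
      then show ?thesis using that by (auto simp: dist_norm norm_minus_commute)
    qed
    \<comment> \<open>The derivative of \<open>G\<close> minus \<open>D x\<close> at
      \<open>y\<close> is \<open>D y - D x\<close>, of norm at most \<open>C * (t * norm z)\<close>
      on this segment.\<close>
    have "norm ((G (x + t *\<^sub>R z) - D x (x + t *\<^sub>R z)) - (G (x - t *\<^sub>R z) - D x (x - t *\<^sub>R z)))
        \<le> (C * (t * norm z)) * norm ((x + t *\<^sub>R z) - (x - t *\<^sub>R z))"
    proof (rule differentiable_bound[where f = "\<lambda>y. G y - D x y"
          and f' = "\<lambda>y. blinfun_apply (D y - D x)" and S = "closed_segment (x - t *\<^sub>R z) (x + t *\<^sub>R z)"])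
      show "((\<lambda>y. G y - D x y) has_derivative blinfun_apply (D y - D x))
          (at y within closed_segment (x - t *\<^sub>R z) (x + t *\<^sub>R z))" for y
        using has_derivative_at_withinI[OF C(3)[of y]]
        by (auto intro!: derivative_eq_intros simp: blinfun.diff_left)
      show "onorm (blinfun_apply (D y - D x)) \<le> C * (t * norm z)"
        if "y \<in> closed_segment (x - t *\<^sub>R z) (x + t *\<^sub>R z)" for y
        using C(4)[of y x] mult_left_mono[OF seg[OF that] C21_nonneg[OF assms]]
        by (simp add: norm_blinfun.rep_eq)
    qed auto
    moreover have "(G (x + t *\<^sub>R z) - D x (x + t *\<^sub>R z)) - (G (x - t *\<^sub>R z) - D x (x - t *\<^sub>R z))
        = (G (x + t *\<^sub>R z) - G (x - t *\<^sub>R z)) - (2 * t) *\<^sub>R D x z"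
    proof -
      have "D x (x + t *\<^sub>R z) - D x (x - t *\<^sub>R z) = (2 * t) *\<^sub>R D x z"
        by (simp add: blinfun.add_right blinfun.diff_right blinfun.scaleR_right scaleR_add_left[symmetric])
      then show ?thesis by (simp add: algebra_simps)
    qed
    moreover have "norm ((x + t *\<^sub>R z) - (x - t *\<^sub>R z)) = 2 * t * norm z"
    proof -
      have "(x + t *\<^sub>R z) - (x - t *\<^sub>R z) = (2 * t) *\<^sub>R z"
        by (simp add: scaleR_add_left[symmetric])
      then show ?thesis using t by simp
    qed
    ultimately have *: "norm ((G (x + t *\<^sub>R z) - G (x - t *\<^sub>R z)) - (2 * t) *\<^sub>R D x z)
        \<le> (C * (t * norm z)) * (2 * t * norm z)" by simp
    have "\<psi>' t = z \<bullet> ((G (x + t *\<^sub>R z) - G (x - t *\<^sub>R z)) - (2 * t) *\<^sub>R D x z)"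
      by (simp add: \<psi>'_def inner_diff_right)
    then have "\<bar>\<psi>' t\<bar> \<le> norm z * norm ((G (x + t *\<^sub>R z) - G (x - t *\<^sub>R z)) - (2 * t) *\<^sub>R D x z)"
      by (metis Cauchy_Schwarz_ineq2)
    also have "\<dots> \<le> norm z * ((C * (t * norm z)) * (2 * t * norm z))"
      by (intro mult_left_mono *) auto
    also have "\<dots> = (2 * C * norm z ^ 3) * t\<^sup>2" by (simp add: power3_eq_cube power2_eq_square)
    also have "\<dots> \<le> (2 * C * norm z ^ 3) * 1"
      using t C21_nonneg[OF assms] by (intro mult_left_mono power_le_one) auto
    finally show ?thesis by simp
  qed
  have "norm (\<psi> 1 - \<psi> 0) \<le> (2 * C * norm z ^ 3) * norm (1 - 0 :: real)"
    by (rule field_differentiable_bound[where S = "{0..1}" and f' = \<psi>'])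
       (use der bd in \<open>auto intro: has_field_derivative_at_within\<close>)
  then show ?thesis by (simp add: \<psi>_def algebra_simps)
qed

text \<open>Midpoint convexity makes second differences nonnegative; for increments
  \<open>t *\<^sub>R z\<close> the cubic error is negligible against \<open>t\<^sup>2\<close> as
  \<open>t\<close> tends to 0.\<close>

lemma C21_psd:
  assumes "C21 C \<phi> G D" shows "z \<bullet> D x z \<ge> 0"
proof -
  have ev: "\<forall>\<^sub>F t in at_right 0. - (2 * C * norm z ^ 3) * t \<le> z \<bullet> D x z"
    using eventually_at_right_less[of 0]
  proof eventually_elim
    case (elim t)
    have "\<phi> x \<le> (1/2) * \<phi> (x + t *\<^sub>R z) + (1/2) * \<phi> (x - t *\<^sub>R z)"
      using convex_onD[OF C21D(1)[OF assms], of "1/2" "x + t *\<^sub>R z" "x - t *\<^sub>R z"]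
      by (simp add: scaleR_add_right[symmetric] algebra_simps scaleR_2[symmetric])
    then have "- (2 * C * norm (t *\<^sub>R z) ^ 3) \<le> (t *\<^sub>R z) \<bullet> D x (t *\<^sub>R z)"
      using C21_second_difference[OF assms, of x "t *\<^sub>R z"] by linarith
    then have "t\<^sup>2 * (- (2 * C * norm z ^ 3) * t) \<le> t\<^sup>2 * (z \<bullet> D x z)"
      using elim by (simp add: blinfun.scaleR_right power_mult_distrib power2_eq_square power3_eq_cube mult_ac)
    then show ?case using elim mult_le_cancel_left_pos[of "t\<^sup>2"] by (metis zero_less_power)
  qed
  have "((\<lambda>t. - (2 * C * norm z ^ 3) * t) \<longlongrightarrow> - (2 * C * norm z ^ 3) * 0) (at_right 0)"
    by (intro tendsto_intros)
  then have "- (2 * C * norm z ^ 3) * 0 \<le> z \<bullet> D x z"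
    by (rule tendsto_upperbound[OF _ ev]) simp
  then show ?thesis by simp
qed

section \<open>Stability of the class under translations, sums and nonnegative multiples\<close>

lemma has_derivative_shift:
  fixes \<phi> :: "'a::real_normed_vector \<Rightarrow> 'b::real_normed_vector"
  assumes "(\<phi> has_derivative \<phi>') (at (x + v))"
  shows "((\<lambda>x. \<phi> (x + v)) has_derivative \<phi>') (at x)"
proof -
  have "((\<lambda>x. x + v) has_derivative (\<lambda>h. h)) (at x)" by (auto intro!: derivative_eq_intros)
  from has_derivative_compose[OF this assms] show ?thesis .
qed

lemma convex_on_shift:
  assumes "convex_on UNIV \<phi>" shows "convex_on UNIV (\<lambda>x. \<phi> (x + v))"
proof (rule convex_onI)
  fix t :: real and x y assume t: "0 < t" "t < 1"
  have "(1 - t) *\<^sub>R x + t *\<^sub>R y + v = (1 - t) *\<^sub>R (x + v) + t *\<^sub>R (y + v)"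
    by (simp add: algebra_simps)
  then show "\<phi> ((1 - t) *\<^sub>R x + t *\<^sub>R y + v) \<le> (1 - t) * \<phi> (x + v) + t * \<phi> (y + v)"
    using convex_onD[OF assms, of t "x + v" "y + v"] t by simp
qed simp

lemma C21_shift:
  assumes "C21 C \<phi> G D"
  shows "C21 C (\<lambda>x. \<phi> (x + v)) (\<lambda>x. G (x + v)) (\<lambda>x. D (x + v))"
  unfolding C21_def
proof (intro conjI allI)
  fix x y
  show "norm (D (x + v) - D (y + v)) \<le> C * norm (x - y)"
    using C21D(4)[OF assms, of "x + v" "y + v"] by simp
qed (use C21D[OF assms] in \<open>auto intro!: has_derivative_shift convex_on_shift\<close>)

lemma C21_add:
  assumes "C21 C \<phi> G D" "C21 C' \<phi>' G' D'"
  shows "C21 (C + C') (\<lambda>x. \<phi> x + \<phi>' x) (\<lambda>x. G x + G' x) (\<lambda>x. D x + D' x)"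
  unfolding C21_def
proof (intro conjI allI)
  note 1 = C21D[OF assms(1)] and 2 = C21D[OF assms(2)]
  show "convex_on UNIV (\<lambda>x. \<phi> x + \<phi>' x)" by (intro convex_on_add 1 2)
  fix x y h k
  show "((\<lambda>x. \<phi> x + \<phi>' x) has_derivative (\<lambda>h. h \<bullet> (G x + G' x))) (at x)"
    unfolding inner_add_right by (intro has_derivative_add 1 2)
  show "((\<lambda>x. G x + G' x) has_derivative blinfun_apply (D x + D' x)) (at x)"
    using has_derivative_add[OF 1(3)[of x] 2(3)[of x]] by (simp add: blinfun.add_left[abs_def])
  have "norm (D x + D' x - (D y + D' y)) \<le> norm (D x - D y) + norm (D' x - D' y)"
    by (metis add_diff_add norm_triangle_ineq)
  then show "norm (D x + D' x - (D y + D' y)) \<le> (C + C') * norm (x - y)"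
    using 1(4)[of x y] 2(4)[of x y] by (simp add: algebra_simps)
  show "(D x + D' x) h \<bullet> k = h \<bullet> (D x + D' x) k"
    by (simp add: blinfun.add_left inner_add_left inner_add_right 1(5)[of x h] 2(5)[of x h])
qed

lemma C21_cmult:
  assumes "C21 C \<phi> G D" "c \<ge> 0"
  shows "C21 (c * C) (\<lambda>x. c * \<phi> x) (\<lambda>x. c *\<^sub>R G x) (\<lambda>x. c *\<^sub>R D x)"
  unfolding C21_def
proof (intro conjI allI)
  note 1 = C21D[OF assms(1)]
  show "convex_on UNIV (\<lambda>x. c * \<phi> x)" by (intro convex_on_cmul 1 assms)
  fix x y h k
  show "((\<lambda>x. c * \<phi> x) has_derivative (\<lambda>h. h \<bullet> (c *\<^sub>R G x))) (at x)"
    using has_derivative_mult_right[OF 1(2), of c x] by simp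
  show "((\<lambda>x. c *\<^sub>R G x) has_derivative blinfun_apply (c *\<^sub>R D x)) (at x)"
    using has_derivative_scaleR_right[OF 1(3), of c x] by (simp add: blinfun.scaleR_left[abs_def])
  have "norm (c *\<^sub>R D x - c *\<^sub>R D y) = c * norm (D x - D y)"
    using assms(2) by (simp add: scaleR_diff_right[symmetric])
  then show "norm (c *\<^sub>R D x - c *\<^sub>R D y) \<le> c * C * norm (x - y)"
    using mult_left_mono[OF 1(4)[of x y] assms(2)] by (simp add: mult_ac)
  show "(c *\<^sub>R D x) h \<bullet> k = h \<bullet> (c *\<^sub>R D x) k"
    by (simp add: blinfun.scaleR_left 1(5)[of x h])
qed

lemma C21_affine: "C21 0 (\<lambda>x. p \<bullet> x + c) (\<lambda>x. p) (\<lambda>x. 0)"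
  unfolding C21_def
  by (auto intro!: derivative_eq_intros convex_onI
      simp: inner_commute algebra_simps inner_add_left)

lemma C21_norm_sq:
  fixes a :: "real^'n"
  shows "C21 0 (\<lambda>x. (norm (x - a))\<^sup>2) (\<lambda>x. 2 *\<^sub>R (x - a)) (\<lambda>x. 2 *\<^sub>R id_blinfun)"
  unfolding C21_def
proof (intro conjI allI)
  show "convex_on UNIV (\<lambda>x. (norm (x - a))\<^sup>2)"
  proof (rule convex_onI)
    fix t :: real and x y :: "real^'n" assume t: "0 < t" "t < 1"
    have "(1 - t) * (norm (x - a))\<^sup>2 + t * (norm (y - a))\<^sup>2 - (norm ((1 - t) *\<^sub>R x + t *\<^sub>R y - a))\<^sup>2
       = t * (1 - t) * (norm (x - y))\<^sup>2"
      unfolding power2_norm_eq_inner by (simp add: algebra_simps inner_commute power2_eq_square)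
    moreover have "\<dots> \<ge> 0" using t by simp
    ultimately show "(norm ((1 - t) *\<^sub>R x + t *\<^sub>R y - a))\<^sup>2 \<le> (1 - t) * (norm (x - a))\<^sup>2 + t * (norm (y - a))\<^sup>2"
      by linarith
  qed simp
  fix x :: "real^'n"
  show "((\<lambda>x. (norm (x - a))\<^sup>2) has_derivative (\<lambda>h. h \<bullet> (2 *\<^sub>R (x - a)))) (at x)"
    unfolding power2_norm_eq_inner
    by (auto intro!: derivative_eq_intros simp: fun_eq_iff inner_commute algebra_simps)
  show "((\<lambda>x. 2 *\<^sub>R (x - a)) has_derivative blinfun_apply (2 *\<^sub>R id_blinfun)) (at x)"
    by (auto intro!: derivative_eq_intros simp: fun_eq_iff blinfun.scaleR_left)
qed (auto simp: blinfun.scaleR_left)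

lemma C21_sum:
  assumes "finite I" "\<And>i. i \<in> I \<Longrightarrow> C21 (C i) (\<phi> i) (G i) (D i)"
  shows "C21 (\<Sum>i\<in>I. C i) (\<lambda>x. \<Sum>i\<in>I. \<phi> i x) (\<lambda>x. \<Sum>i\<in>I. G i x) (\<lambda>x. \<Sum>i\<in>I. D i x)"
  using assms
proof (induction I rule: finite_induct)
  case empty
  then show ?case using C21_affine[of 0 0] by simp
next
  case (insert i I)
  then have "C21 (C i) (\<phi> i) (G i) (D i)" "C21 (sum C I) (\<lambda>x. \<Sum>i\<in>I. \<phi> i x) (\<lambda>x. \<Sum>i\<in>I. G i x) (\<lambda>x. \<Sum>i\<in>I. D i x)"
    by auto
  from C21_add[OF this] show ?case using insert.hyps by simp
qed

text \<open>The expectation after one step of the random walk that jumps by plus or minus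
  \<open>h *\<^sub>R T i\<close> with equal probabilities. The codomain is any real vector space, so
  a function, its gradient and its Hessian can all be averaged.\<close>

definition walk :: "real \<Rightarrow> ('n::finite \<Rightarrow> 'a) \<Rightarrow> ('a::real_vector \<Rightarrow> 'b::real_vector) \<Rightarrow> 'a \<Rightarrow> 'b" where
  "walk h T \<phi> x = (1 / (2 * real CARD('n))) *\<^sub>R (\<Sum>i\<in>UNIV. \<phi> (x + h *\<^sub>R T i) + \<phi> (x - h *\<^sub>R T i))"

lemma walk_mono: "(\<And>y. \<phi> y \<le> \<psi> y) \<Longrightarrow> walk h T \<phi> x \<le> (walk h T \<psi> x :: real)"
  unfolding walk_def by (intro scaleR_left_mono sum_mono add_mono) auto

lemma walk_add: "walk h T (\<lambda>x. \<phi> x + \<psi> x) x = walk h T \<phi> x + walk h T \<psi> x"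
proof -
  have "(\<Sum>i\<in>UNIV. \<phi> (x + h *\<^sub>R T i) + \<psi> (x + h *\<^sub>R T i) + (\<phi> (x - h *\<^sub>R T i) + \<psi> (x - h *\<^sub>R T i)))
    = (\<Sum>i\<in>UNIV. (\<phi> (x + h *\<^sub>R T i) + \<phi> (x - h *\<^sub>R T i)) + (\<psi> (x + h *\<^sub>R T i) + \<psi> (x - h *\<^sub>R T i)))"
    by (intro sum.cong) (auto simp: add_ac)
  then show ?thesis by (simp add: walk_def sum.distrib scaleR_add_right)
qed

lemma walk_const: "walk h T (\<lambda>x. c) x = (c :: real)"
  by (simp add: walk_def)

lemma walk_cmult: "walk h T (\<lambda>x. c * \<phi> x) x = c * (walk h T \<phi> x :: real)"
  by (simp add: walk_def sum_distrib_left algebra_simps)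

text \<open>The mixed terms cancel, leaving the variance of one step. Quadratic error terms can
  therefore be followed exactly along the iteration.\<close>

lemma walk_norm_sq:
  fixes T :: "'n::finite \<Rightarrow> 'a::real_inner"
  shows "walk h T (\<lambda>y. (norm (y - a))\<^sup>2) x
    = (norm (x - a))\<^sup>2 + h\<^sup>2 * (\<Sum>i\<in>UNIV. (norm (T i))\<^sup>2) / real CARD('n)"
proof -
  have "(norm (x + h *\<^sub>R T i - a))\<^sup>2 + (norm (x - h *\<^sub>R T i - a))\<^sup>2
     = 2 * (norm (x - a))\<^sup>2 + 2 * h\<^sup>2 * (norm (T i))\<^sup>2" for i
    unfolding power2_norm_eq_inner by (simp add: algebra_simps inner_commute power2_eq_square)
  then have "walk h T (\<lambda>y. (norm (y - a))\<^sup>2) x = (1 / (2 * real CARD('n))) *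
     (2 * real CARD('n) * (norm (x - a))\<^sup>2 + 2 * h\<^sup>2 * (\<Sum>i\<in>UNIV. (norm (T i))\<^sup>2))"
    by (simp add: walk_def sum.distrib sum_distrib_left)
  then show ?thesis by (simp add: field_simps)
qed

text \<open>The weights add up to 1, so \<open>C\<close> is not enlarged and one constant serves all
  iterates.\<close>

lemma C21_walk:
  assumes "C21 C \<phi> G D"
  shows "C21 C (walk h (T :: 'n \<Rightarrow> real^'n) \<phi>) (walk h T G) (walk h T D)"
proof -
  have "C21 (C + C) (\<lambda>x. \<phi> (x + h *\<^sub>R T i) + \<phi> (x + - (h *\<^sub>R T i)))
     (\<lambda>x. G (x + h *\<^sub>R T i) + G (x + - (h *\<^sub>R T i))) (\<lambda>x. D (x + h *\<^sub>R T i) + D (x + - (h *\<^sub>R T i)))" for i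
    by (intro C21_add C21_shift assms)
  then have "C21 ((1 / (2 * real CARD('n))) * (\<Sum>i\<in>(UNIV::'n set). C + C))
     (\<lambda>x. (1 / (2 * real CARD('n))) * (\<Sum>i\<in>UNIV. \<phi> (x + h *\<^sub>R T i) + \<phi> (x + - (h *\<^sub>R T i))))
     (\<lambda>x. (1 / (2 * real CARD('n))) *\<^sub>R (\<Sum>i\<in>UNIV. G (x + h *\<^sub>R T i) + G (x + - (h *\<^sub>R T i))))
     (\<lambda>x. (1 / (2 * real CARD('n))) *\<^sub>R (\<Sum>i\<in>UNIV. D (x + h *\<^sub>R T i) + D (x + - (h *\<^sub>R T i))))"
    by (intro C21_cmult C21_sum) auto
  then show ?thesis by (simp add: walk_def[abs_def])
qed

lemma C21_funpow_walk:
  assumes "C21 C \<phi> G D"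
  shows "C21 C ((walk h (T :: 'n \<Rightarrow> real^'n) ^^ k) \<phi>) ((walk h T ^^ k) G) ((walk h T ^^ k) D)"
  by (induction k) (auto intro: C21_walk assms)

lemma convex_le_walk:
  assumes "convex_on UNIV \<phi>"
  shows "\<phi> x \<le> walk h (T :: 'n::finite \<Rightarrow> _) \<phi> x"
proof -
  have "2 * \<phi> x \<le> \<phi> (x + h *\<^sub>R T i) + \<phi> (x - h *\<^sub>R T i)" for i
    using convex_onD[OF assms, of "1/2" "x + h *\<^sub>R T i" "x - h *\<^sub>R T i"]
    by (simp add: scaleR_add_right[symmetric] algebra_simps scaleR_2[symmetric])
  then have "(\<Sum>i\<in>(UNIV::'n set). 2 * \<phi> x) \<le> (\<Sum>i\<in>UNIV. \<phi> (x + h *\<^sub>R T i) + \<phi> (x - h *\<^sub>R T i))"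
    by (intro sum_mono) auto
  then show ?thesis by (simp add: walk_def field_simps)
qed

text \<open>Consistency of the scheme: one step approximates the flow of \<open>quad T\<close> over
  the time \<open>h\<^sup>2 / (2 * real CARD('n))\<close>, with an error of third order in
  \<open>h\<close>.\<close>

lemma walk_second_order:
  fixes T :: "'n::finite \<Rightarrow> real^'n"
  assumes "C21 C \<phi> G D" "h \<ge> 0"
  shows "\<bar>walk h T \<phi> x - \<phi> x - h\<^sup>2 / (2 * real CARD('n)) * quad T (D x)\<bar>
    \<le> C * h ^ 3 * (\<Sum>i\<in>UNIV. norm (T i) ^ 3) / real CARD('n)"
proof -
  let ?n = "real CARD('n)"
  let ?l = "walk h T \<phi> x - \<phi> x - h\<^sup>2 / (2 * ?n) * quad T (D x)"
  have "?l = (1 / (2 * ?n)) *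
     (\<Sum>i\<in>UNIV. \<phi> (x + h *\<^sub>R T i) + \<phi> (x - h *\<^sub>R T i) - 2 * \<phi> x - (h *\<^sub>R T i) \<bullet> D x (h *\<^sub>R T i))"
    by (simp add: walk_def quad_def sum.distrib sum_subtractf sum_distrib_left blinfun.scaleR_right
        field_simps power2_eq_square)
  then have "\<bar>?l\<bar> = (1 / (2 * ?n)) *
     \<bar>\<Sum>i\<in>UNIV. \<phi> (x + h *\<^sub>R T i) + \<phi> (x - h *\<^sub>R T i) - 2 * \<phi> x - (h *\<^sub>R T i) \<bullet> D x (h *\<^sub>R T i)\<bar>"
    by (simp add: abs_mult)
  also have "\<dots> \<le> (1 / (2 * ?n)) * (\<Sum>i\<in>UNIV. 2 * C * norm (h *\<^sub>R T i) ^ 3)"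
    by (intro mult_left_mono order_trans[OF sum_abs] sum_mono C21_second_difference[OF assms(1)]) auto
  also have "\<dots> = C * h ^ 3 * (\<Sum>i\<in>UNIV. norm (T i) ^ 3) / ?n"
    using assms(2) by (simp add: power_mult_distrib sum_distrib_left mult_ac sum_divide_distrib)
  finally show ?thesis .
qed

text \<open>The comparison argument tests with the iterate \<open>Suc k\<close>, whereas the
  increment from \<open>k\<close> to \<open>Suc k\<close> is governed by the Hessian of the iterate
  \<open>k\<close>; this bound passes from one to the other.\<close>

lemma walk_hessian_diff:
  fixes T :: "'n::finite \<Rightarrow> real^'n"
  assumes "C21 C \<phi> G D" "h \<ge> 0"
  shows "norm (walk h T D x - D x) \<le> C * h * (\<Sum>i\<in>UNIV. norm (T i)) / real CARD('n)"
proof -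
  let ?n = "real CARD('n)"
  have "D x = (1 / (2 * ?n)) *\<^sub>R (\<Sum>i\<in>(UNIV::'n set). D x + D x)"
    by (simp add: scaleR_2[symmetric] sum_constant_scaleR del: sum_constant)
  then have "walk h T D x - D x = (1 / (2 * ?n)) *\<^sub>R
     (\<Sum>i\<in>UNIV. (D (x + h *\<^sub>R T i) + D (x - h *\<^sub>R T i)) - (D x + D x))"
    unfolding walk_def sum_subtractf scaleR_diff_right by simp
  then have "norm (walk h T D x - D x) = (1 / (2 * ?n)) *
     norm (\<Sum>i\<in>UNIV. (D (x + h *\<^sub>R T i) + D (x - h *\<^sub>R T i)) - (D x + D x))"
    by simp
  also have "\<dots> \<le> (1 / (2 * ?n)) * (\<Sum>i\<in>UNIV. C * h * norm (T i) + C * h * norm (T i))"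
  proof (intro mult_left_mono order_trans[OF norm_sum] sum_mono)
    fix i
    have "norm (D (x + h *\<^sub>R T i) + D (x - h *\<^sub>R T i) - (D x + D x))
       \<le> norm (D (x + h *\<^sub>R T i) - D x) + norm (D (x - h *\<^sub>R T i) - D x)"
      by (metis add_diff_add norm_triangle_ineq)
    also have "\<dots> \<le> C * h * norm (T i) + C * h * norm (T i)"
      using C21D(4)[OF assms(1), of "x + h *\<^sub>R T i" x] C21D(4)[OF assms(1), of "x - h *\<^sub>R T i" x] assms(2)
      by (simp add: mult_ac)
    finally show "norm (D (x + h *\<^sub>R T i) + D (x - h *\<^sub>R T i) - (D x + D x)) \<le> \<dots>" .
  qed auto
  also have "\<dots> = C * h * (\<Sum>i\<in>UNIV. norm (T i)) / ?n"
    by (simp add: sum.distrib sum_distrib_left[symmetric] field_simps)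
  finally show ?thesis .
qed

text \<open>A discrete parabolic comparison principle: \<open>(walk h T ^^ k) g\<close> is a discrete heat flow with smooth
  initial datum, and \<open>U\<close> lies below it with a gap growing linearly in the time \<open>k * h\<^sup>2\<close>. At an interior
  maximum of the difference, the flow itself is an admissible test function for \<open>U\<close>; on the
  sphere the flow dominates \<open>U\<close> because \<open>g\<close> is convex.\<close>
lemma walk_comparison:
  fixes T :: "'n::finite \<Rightarrow> real^'n" and U :: "real^'n \<Rightarrow> real"
  assumes g: "C21 C g G D" and Ug: "\<And>x. U x \<le> g x"
    and U: "continuous_on (cball a r) U" and r: "r > 0"
    and visc: "\<And>C' \<phi> G' D' y. C21 C' \<phi> G' D' \<Longrightarrow> y \<in> ball a r \<Longrightarrow>
      (\<And>x. x \<in> ball a r \<Longrightarrow> \<phi> y - U y \<le> \<phi> x - U x) \<Longrightarrow> m \<le> quad T (D' y)"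
    and \<kappa>: "\<kappa> > 0" and h: "h > 0" and b: "b \<ge> 0"
    and m: "2 * real CARD('n) * b + 2 * \<kappa> * (\<Sum>i\<in>UNIV. (norm (T i))\<^sup>2)
      + C * h * ((\<Sum>i\<in>UNIV. norm (T i)) / real CARD('n) * (\<Sum>i\<in>UNIV. (norm (T i))\<^sup>2)
          + 2 * (\<Sum>i\<in>UNIV. norm (T i) ^ 3)) \<le> m"
    and k: "b * real k * h\<^sup>2 \<le> \<kappa> * r\<^sup>2" and x: "x \<in> cball a r"
  shows "U x + b * real k * h\<^sup>2 - \<kappa> * (norm (x - a))\<^sup>2 \<le> (walk h T ^^ k) g x"
  using k x
proof (induction k arbitrary: x)
  case 0
  have "\<kappa> * (norm (x - a))\<^sup>2 \<ge> 0" using \<kappa> by simp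
  then show ?case using Ug[of x] by simp
next
  case (Suc k)
  let ?n = "real CARD('n)"
  define \<sigma> where "\<sigma> = (\<Sum>i\<in>UNIV. (norm (T i))\<^sup>2)"
  define \<tau>1 where "\<tau>1 = (\<Sum>i\<in>UNIV. norm (T i))"
  define \<tau>3 where "\<tau>3 = (\<Sum>i\<in>UNIV. norm (T i) ^ 3)"
  define H where "H j = (walk h T ^^ j) g" for j
  define DH where "DH j = (walk h T ^^ j) D" for j
  have H: "C21 C (H j) ((walk h T ^^ j) G) (DH j)" for j
    unfolding H_def DH_def by (rule C21_funpow_walk[OF g])
  have gH: "g x \<le> H j x" for j x
  proof (induction j)
    case (Suc j)
    then show ?case using convex_le_walk[OF C21D(1)[OF H[of j]], of x h T] by (simp add: H_def)
  qed (simp add: H_def)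
  have kle: "b * real k * h\<^sup>2 \<le> \<kappa> * r\<^sup>2"
  proof -
    have "b * real k * h\<^sup>2 \<le> b * real (Suc k) * h\<^sup>2" using b by (intro mult_right_mono mult_left_mono) auto
    then show ?thesis using Suc.prems(1) by linarith
  qed
  define F where "F y = U y + b * real (Suc k) * h\<^sup>2 - \<kappa> * (norm (y - a))\<^sup>2 - H (Suc k) y" for y
  have "continuous_on (cball a r) (H (Suc k))"
    using C21D(2)[OF H[of "Suc k"]] by (meson continuous_at_imp_continuous_on has_derivative_continuous)
  then have "continuous_on (cball a r) F" unfolding F_def by (intro continuous_intros U)
  moreover have "cball a r \<noteq> {}" using r by simp
  ultimately obtain y where y: "y \<in> cball a r" and max: "\<And>z. z \<in> cball a r \<Longrightarrow> F z \<le> F y"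
    using continuous_attains_sup[of "cball a r" F] by auto
  have "F y \<le> 0"
  proof (cases "y \<in> ball a r")
    \<comment> \<open>On the sphere the penalty equals \<open>\<kappa> * r\<^sup>2\<close>, which by
      the bound on \<open>k\<close> is at least the whole growth term.\<close>
    case False
    then have "norm (y - a) = r" using y by (auto simp: dist_norm norm_minus_commute)
    then show ?thesis using Ug[of y] gH[of y "Suc k"] Suc.prems(1) by (simp add: F_def)
  next
    case True
    \<comment> \<open>Adding the penalty back gives a test function at the maximum point of
      \<open>F\<close>. Its Hessian gains \<open>2 * \<kappa>\<close> times the identity, whence the
      term with \<open>\<kappa>\<close> in the bound on \<open>m\<close>.\<close>
    define \<phi> where "\<phi> z = H (Suc k) z + \<kappa> * (norm (z - a))\<^sup>2" for z
    have "C21 (C + \<kappa> * 0) \<phi> (\<lambda>z. (walk h T ^^ Suc k) G z + \<kappa> *\<^sub>R (2 *\<^sub>R (z - a)))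
       (\<lambda>z. DH (Suc k) z + \<kappa> *\<^sub>R (2 *\<^sub>R id_blinfun))"
      unfolding \<phi>_def by (intro C21_add H C21_cmult C21_norm_sq) (use \<kappa> in simp)
    moreover have "\<phi> y - U y \<le> \<phi> z - U z" if "z \<in> ball a r" for z
      using max[of z] that by (simp add: F_def \<phi>_def)
    ultimately have "m \<le> quad T (DH (Suc k) y + \<kappa> *\<^sub>R (2 *\<^sub>R id_blinfun))"
      using True visc by blast
    also have "\<dots> = quad T (DH (Suc k) y) + 2 * \<kappa> * \<sigma>"
      by (simp add: quad_def blinfun.add_left blinfun.scaleR_left inner_add_right sum.distrib
          sum_distrib_left \<sigma>_def power2_norm_eq_inner mult_ac)
    finally have 1: "m \<le> quad T (DH (Suc k) y) + 2 * \<kappa> * \<sigma>" .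
    have "\<bar>quad T (DH (Suc k) y) - quad T (DH k y)\<bar> \<le> norm (DH (Suc k) y - DH k y) * \<sigma>"
      unfolding \<sigma>_def by (rule quad_diff_le)
    also have "\<dots> \<le> (C * h * \<tau>1 / ?n) * \<sigma>"
      using walk_hessian_diff[OF H[of k], of h T y] h
      by (intro mult_right_mono) (auto simp: DH_def \<tau>1_def \<sigma>_def sum_nonneg)
    finally have 2: "quad T (DH (Suc k) y) \<le> quad T (DH k y) + C * h * \<tau>1 / ?n * \<sigma>" by linarith
    have 3: "2 * ?n * b \<le> quad T (DH k y) - 2 * C * h * \<tau>3"
      using 1 2 m by (simp add: \<sigma>_def[symmetric] \<tau>1_def[symmetric] \<tau>3_def[symmetric] algebra_simps)
    \<comment> \<open>The flow gains at least \<open>b * h\<^sup>2\<close> at \<open>y\<close> in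
      this step, which reduces the claim to the induction hypothesis at the same point.\<close>
    have "b * h\<^sup>2 = h\<^sup>2 / (2 * ?n) * (2 * ?n * b)" by simp
    also have "\<dots> \<le> h\<^sup>2 / (2 * ?n) * (quad T (DH k y) - 2 * C * h * \<tau>3)"
      by (intro mult_left_mono 3) auto
    also have "\<dots> = h\<^sup>2 / (2 * ?n) * quad T (DH k y) - C * h ^ 3 * \<tau>3 / ?n"
      by (simp add: field_simps power2_eq_square power3_eq_cube)
    also have "\<dots> \<le> H (Suc k) y - H k y"
      using walk_second_order[OF H[of k], of h T y] h by (simp add: H_def \<tau>3_def abs_le_iff)
    finally have "F y \<le> U y + b * real k * h\<^sup>2 - \<kappa> * (norm (y - a))\<^sup>2 - H k y"
      by (simp add: F_def algebra_simps)
    also have "\<dots> \<le> 0" using Suc.IH[OF kle y] by (simp add: H_def)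
    finally show ?thesis .
  qed
  then show ?case using max[OF Suc.prems(2)] by (simp add: F_def H_def)
qed

text \<open>A smooth function cannot grow much faster under the flow than
  \<open>quad T (D x)\<close> dictates. The variation of the Hessian is linear in the distance from
  \<open>x\<close>; splitting the distance as \<open>\<beta>\<close> plus its square over
  \<open>\<beta>\<close> makes the error quadratic, and averages of quadratics are known
  exactly.\<close>

lemma funpow_walk_upper_bound:
  fixes T :: "'n::finite \<Rightarrow> real^'n"
  assumes W: "C21 C W G D" and h: "h > 0" and \<beta>: "\<beta> > 0"
  defines "\<sigma> \<equiv> \<Sum>i\<in>UNIV. (norm (T i))\<^sup>2" and "\<tau>3 \<equiv> \<Sum>i\<in>UNIV. norm (T i) ^ 3"
  shows "(walk h T ^^ k) W x \<le> W x + real k * h\<^sup>2 / (2 * real CARD('n)) *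
    (quad T (D x) + C * \<sigma> * \<beta> + 2 * C * h * \<tau>3 + C * \<sigma>\<^sup>2 * (real k * h\<^sup>2) / (real CARD('n) * \<beta>))"
proof -
  let ?n = "real CARD('n)"
  have C0: "C \<ge> 0" and \<sigma>0: "\<sigma> \<ge> 0" using C21_nonneg[OF W] by (auto simp: \<sigma>_def sum_nonneg)
  define E where "E = h\<^sup>2 / (2 * ?n) * (quad T (D x) + C * \<sigma> * \<beta> + 2 * C * h * \<tau>3)"
  define F where "F = h\<^sup>2 / (2 * ?n) * (C * \<sigma> / \<beta>)"
  define \<omega> where "\<omega> = h\<^sup>2 * \<sigma> / ?n"
  have F0: "F \<ge> 0" using C0 \<sigma>0 \<beta> by (simp add: F_def)
  have \<omega>0: "\<omega> \<ge> 0" using \<sigma>0 by (simp add: \<omega>_def)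
  have one: "walk h T W y \<le> W y + E + F * (norm (y - x))\<^sup>2" for y
  proof -
    have "norm (y - x) \<le> \<beta> + (norm (y - x))\<^sup>2 / \<beta>"
    proof (cases "norm (y - x) \<le> \<beta>")
      case True
      then show ?thesis using \<beta> by (simp add: add_increasing2)
    next
      case False
      then have "norm (y - x) * \<beta> \<le> norm (y - x) * norm (y - x)" by (intro mult_left_mono) auto
      then have "norm (y - x) \<le> (norm (y - x))\<^sup>2 / \<beta>" using \<beta> by (simp add: power2_eq_square field_simps)
      then show ?thesis using \<beta> by linarith
    qed
    then have "norm (D y - D x) \<le> C * (\<beta> + (norm (y - x))\<^sup>2 / \<beta>)"
      using C21D(4)[OF W, of y x] mult_left_mono[OF _ C0] by (meson order_trans)
    then have "norm (D y - D x) * \<sigma> \<le> C * (\<beta> + (norm (y - x))\<^sup>2 / \<beta>) * \<sigma>"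
      using \<sigma>0 by (rule mult_right_mono)
    then have 1: "quad T (D y) \<le> quad T (D x) + C * (\<beta> + (norm (y - x))\<^sup>2 / \<beta>) * \<sigma>"
      using quad_diff_le[of T "D y" "D x"] by (simp add: \<sigma>_def[symmetric])
    have "walk h T W y \<le> W y + h\<^sup>2 / (2 * ?n) * quad T (D y) + C * h ^ 3 * \<tau>3 / ?n"
      using walk_second_order[OF W, of h T y] h by (simp add: \<tau>3_def abs_le_iff)
    also have "\<dots> \<le> W y + h\<^sup>2 / (2 * ?n) * (quad T (D x) + C * (\<beta> + (norm (y - x))\<^sup>2 / \<beta>) * \<sigma>)
        + C * h ^ 3 * \<tau>3 / ?n"
      by (intro add_mono mult_left_mono 1) auto
    also have "\<dots> = W y + E + F * (norm (y - x))\<^sup>2"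
      by (simp add: E_def F_def field_simps power2_eq_square power3_eq_cube)
    finally show ?thesis .
  qed
  have "(walk h T ^^ k) W y \<le> W y + real k * E + F * (real k * (norm (y - x))\<^sup>2 + \<omega> * (real k)\<^sup>2)" for y
  proof (induction k arbitrary: y)
    case (Suc k)
    have "(walk h T ^^ Suc k) W y = walk h T ((walk h T ^^ k) W) y" by simp
    also have "\<dots> \<le> walk h T (\<lambda>y. W y + (real k * E + F * \<omega> * (real k)\<^sup>2 + (F * real k) * (norm (y - x))\<^sup>2)) y"
      by (rule walk_mono, rule order_trans[OF Suc.IH]) (simp add: algebra_simps)
    also have "\<dots> = walk h T W y + (real k * E + F * \<omega> * (real k)\<^sup>2 + (F * real k) * ((norm (y - x))\<^sup>2 + \<omega>))"
      unfolding walk_add walk_const walk_cmult walk_norm_sq by (simp add: \<omega>_def \<sigma>_def)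
    also have "\<dots> \<le> (W y + E + F * (norm (y - x))\<^sup>2)
        + (real k * E + F * \<omega> * (real k)\<^sup>2 + (F * real k) * ((norm (y - x))\<^sup>2 + \<omega>))"
      by (intro add_right_mono one)
    \<comment> \<open>The added term completes the square, turning \<open>k\<^sup>2 + k\<close> into
      \<open>(k + 1)\<^sup>2\<close>; this crude bound has a form closed under the
      induction.\<close>
    also have "\<dots> \<le> (W y + E + F * (norm (y - x))\<^sup>2)
        + (real k * E + F * \<omega> * (real k)\<^sup>2 + (F * real k) * ((norm (y - x))\<^sup>2 + \<omega>)) + F * \<omega> * (real k + 1)"
      using F0 \<omega>0 by simp
    also have "\<dots> = W y + real (Suc k) * E + F * (real (Suc k) * (norm (y - x))\<^sup>2 + \<omega> * (real (Suc k))\<^sup>2)"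
      by (simp add: algebra_simps power2_eq_square)
    finally show ?case .
  qed simp
  from this[of x] have "(walk h T ^^ k) W x \<le> W x + real k * E + F * (\<omega> * (real k)\<^sup>2)" by simp
  also have "\<dots> = W x + real k * h\<^sup>2 / (2 * ?n) *
    (quad T (D x) + C * \<sigma> * \<beta> + 2 * C * h * \<tau>3 + C * \<sigma>\<^sup>2 * (real k * h\<^sup>2) / (?n * \<beta>))"
    using \<beta> by (simp add: E_def F_def \<omega>_def field_simps power2_eq_square)
  finally show ?thesis .
qed

text \<open>The growth is bounded below by hypothesis and above by
  \<open>funpow_walk_upper_bound\<close>. At fixed \<open>t\<close> the step length tends to 0 with
  growing \<open>k\<close>; then \<open>\<epsilon>\<close> is removed, and only afterwards does
  \<open>t\<close> tend to 0.\<close>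

lemma quad_ge_of_walk_growth:
  fixes T :: "'n::finite \<Rightarrow> real^'n"
  assumes W: "C21 C W G D" and t0: "t0 > 0"
    and growth: "\<And>t \<epsilon>. 0 < t \<Longrightarrow> t \<le> t0 \<Longrightarrow> \<epsilon> > 0 \<Longrightarrow>
      \<forall>\<^sub>F k in sequentially. W x + b * t \<le> (walk (sqrt (t / real k)) T ^^ k) W x + \<epsilon>"
  shows "2 * real CARD('n) * b \<le> quad T (D x)"
proof -
  let ?n = "real CARD('n)"
  define \<sigma> where "\<sigma> = (\<Sum>i\<in>UNIV. (norm (T i))\<^sup>2)"
  define \<tau>3 where "\<tau>3 = (\<Sum>i\<in>UNIV. norm (T i) ^ 3)"
  define R where "R \<beta> t h = C * \<sigma> * \<beta> + 2 * C * h * \<tau>3 + C * \<sigma>\<^sup>2 * t / (?n * \<beta>)" for \<beta> t h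
  have 1: "b * t \<le> t / (2 * ?n) * (quad T (D x) + R \<beta> t 0)" if t: "0 < t" "t \<le> t0" and \<beta>: "\<beta> > 0" for t \<beta>
  proof (rule field_le_epsilon)
    fix \<epsilon> :: real assume \<epsilon>: "\<epsilon> > 0"
    have "\<forall>\<^sub>F k in sequentially. b * t \<le> t / (2 * ?n) * (quad T (D x) + R \<beta> t (sqrt (t / real k))) + \<epsilon>"
      using growth[OF t \<epsilon>] eventually_gt_at_top[of 0]
    proof eventually_elim
      case (elim k)
      have h: "sqrt (t / real k) > 0" using elim t by simp
      have "real k * (sqrt (t / real k))\<^sup>2 = t" using elim t by simp
      then show ?case
        using elim(1) funpow_walk_upper_bound[OF W h \<beta>, where T = T and k = k and x = x]
        by (simp add: R_def \<sigma>_def[symmetric] \<tau>3_def[symmetric] add_ac)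
    qed
    moreover have "(\<lambda>k. t / (2 * ?n) * (quad T (D x) + R \<beta> t (sqrt (t / real k))) + \<epsilon>)
        \<longlonglongrightarrow> t / (2 * ?n) * (quad T (D x) + R \<beta> t (sqrt 0)) + \<epsilon>"
      unfolding R_def by (intro tendsto_intros lim_const_over_n) (use \<beta> in auto)
    ultimately show "b * t \<le> t / (2 * ?n) * (quad T (D x) + R \<beta> t 0) + \<epsilon>"
      using tendsto_lowerbound[OF _ _ sequentially_bot] by (metis real_sqrt_zero)
  qed
  \<comment> \<open>The choice \<open>t = \<beta>\<^sup>2\<close> makes both remaining errors
    proportional to \<open>\<beta>\<close>.\<close>
  have 2: "2 * ?n * b \<le> quad T (D x) + (C * \<sigma> + C * \<sigma>\<^sup>2 / ?n) * \<beta>" if \<beta>: "0 < \<beta>" "\<beta>\<^sup>2 \<le> t0" for \<beta>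
  proof -
    have "\<beta>\<^sup>2 * b \<le> \<beta>\<^sup>2 * ((quad T (D x) + R \<beta> (\<beta>\<^sup>2) 0) / (2 * ?n))"
      using 1[of "\<beta>\<^sup>2" \<beta>] \<beta> by (simp add: mult_ac)
    then have "b \<le> (quad T (D x) + R \<beta> (\<beta>\<^sup>2) 0) / (2 * ?n)"
      by (rule mult_left_le_imp_le) (use \<beta> in simp)
    then have "2 * ?n * b \<le> quad T (D x) + R \<beta> (\<beta>\<^sup>2) 0" by (simp add: field_simps)
    also have "R \<beta> (\<beta>\<^sup>2) 0 = (C * \<sigma> + C * \<sigma>\<^sup>2 / ?n) * \<beta>"
      using \<beta> by (simp add: R_def field_simps power2_eq_square)
    finally show ?thesis .
  qed
  have "((\<lambda>\<beta>. \<beta>\<^sup>2) \<longlongrightarrow> (0::real)\<^sup>2) (at_right 0)" by (intro tendsto_intros)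
  then have "\<forall>\<^sub>F \<beta> in at_right (0::real). \<beta>\<^sup>2 < t0" using t0 by (intro order_tendstoD) auto
  then have ev: "\<forall>\<^sub>F \<beta> in at_right 0. 2 * ?n * b \<le> quad T (D x) + (C * \<sigma> + C * \<sigma>\<^sup>2 / ?n) * \<beta>"
    using eventually_at_right_less[of 0] by eventually_elim (simp add: 2)
  have "((\<lambda>\<beta>. quad T (D x) + (C * \<sigma> + C * \<sigma>\<^sup>2 / ?n) * \<beta>)
      \<longlongrightarrow> quad T (D x) + (C * \<sigma> + C * \<sigma>\<^sup>2 / ?n) * 0) (at_right 0)"
    by (intro tendsto_intros)
  from tendsto_lowerbound[OF this ev] show ?thesis by simp
qed

section \<open>Mollification\<close>


text \<open>A box containing the ball of radius \<open>s\<close> that supports the kernels;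
  continuous integrands are integrable on it.\<close>

abbreviation cube :: "real \<Rightarrow> 'a::euclidean_space set" where
  "cube s \<equiv> cbox (- (s *\<^sub>R One)) (s *\<^sub>R One)"

lemma norm_le_in_cube: "norm z \<le> s \<Longrightarrow> z \<in> cube s"
  using Basis_le_norm order_trans by (fastforce simp: mem_box abs_le_iff)

text \<open>The kernel is vector-valued, so that inserting a kernel, its gradient or its Hessian for
  \<open>k\<close> gives a mollification and its derivatives by one operator.\<close>

definition conv :: "real \<Rightarrow> ('a::euclidean_space \<Rightarrow> 'b::banach) \<Rightarrow> ('a \<Rightarrow> real) \<Rightarrow> 'a \<Rightarrow> 'b" where
  "conv s k U x = integral (cube s) (\<lambda>z. U (x - z) *\<^sub>R k z)"

lemma conv_integrand_continuous:
  fixes k :: "'a::euclidean_space \<Rightarrow> 'b::banach" and U :: "'a \<Rightarrow> real"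
  assumes "continuous_on UNIV k" "continuous_on UNIV U"
  shows "continuous_on A (\<lambda>z. U (x - z) *\<^sub>R k z)"
  by (intro continuous_intros continuous_on_compose2[OF assms(2)] continuous_on_subset[OF assms(1)]) auto

lemma conv_has_integral:
  fixes k :: "'a::euclidean_space \<Rightarrow> 'b::banach" and U :: "'a \<Rightarrow> real"
  assumes "continuous_on UNIV k" "continuous_on UNIV U"
  shows "((\<lambda>z. U (x - z) *\<^sub>R k z) has_integral conv s k U x) (cube s)"
  unfolding conv_def
  by (intro integrable_integral integrable_continuous conv_integrand_continuous assms)

text \<open>The substitution \<open>y = x - z\<close> moves \<open>x\<close> from \<open>U\<close>,
  which is only continuous, to the kernel; the support of the kernel permits a domain
  \<open>J\<close> that does not change with \<open>x\<close>.\<close>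

lemma conv_eq_kernel_integral:
  fixes k :: "'a::euclidean_space \<Rightarrow> 'b::banach" and U :: "'a \<Rightarrow> real"
  assumes k: "continuous_on UNIV k" and U: "continuous_on UNIV U"
    and z: "\<And>z. z \<notin> cube s \<Longrightarrow> k z = 0" and sub: "cbox (- (s *\<^sub>R One) + x) (s *\<^sub>R One + x) \<subseteq> J"
  shows "((\<lambda>y. U y *\<^sub>R k (x - y)) has_integral conv s k U x) J"
proof -
  have "((\<lambda>z. U (x + z) *\<^sub>R k (- z)) has_integral conv s k U x) (cube s)"
    using has_integral_reflect_lemma[OF conv_has_integral[OF k U, of x s]] by simp
  then have "((\<lambda>y. U y *\<^sub>R k (x - y)) has_integral conv s k U x) (cbox (- (s *\<^sub>R One) + x) (s *\<^sub>R One + x))"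
    unfolding has_integral_shift_cbox_iff[symmetric] by (simp add: o_def)
  moreover have "U y *\<^sub>R k (x - y) = 0" if "y \<notin> cbox (- (s *\<^sub>R One) + x) (s *\<^sub>R One + x)" for y
  proof -
    have "x - y \<notin> cube s"
      using that by (auto simp: mem_box inner_diff_left inner_add_left) force+
    then show ?thesis using z by simp
  qed
  ultimately show ?thesis by (rule has_integral_on_superset[OF _ _ sub])
qed

lemma conv_has_derivative:
  fixes k :: "'a::euclidean_space \<Rightarrow> 'b::banach" and U :: "'a \<Rightarrow> real"
  assumes k: "\<And>z. (k has_derivative blinfun_apply (k' z)) (at z)"
    and k': "continuous_on UNIV k'" and U: "continuous_on UNIV U"
    and z: "\<And>z. z \<notin> cube s \<Longrightarrow> k z = 0" "\<And>z. z \<notin> cube s \<Longrightarrow> k' z = 0"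
  shows "(conv s k U has_derivative blinfun_apply (conv s k' U x0)) (at x0)"
proof -
  have kc: "continuous_on UNIV k"
    using k by (meson continuous_at_imp_continuous_on has_derivative_continuous)
  \<comment> \<open>The box is large enough for every \<open>x\<close> in the unit ball around
    \<open>x0\<close>, so differentiation under the integral takes place over a fixed
    domain.\<close>
  define a b where "a = x0 - (s + 1) *\<^sub>R One" and "b = x0 + (s + 1) *\<^sub>R (One::'a)"
  have sub: "cbox (- (s *\<^sub>R One) + x) (s *\<^sub>R One + x) \<subseteq> cbox a b" if "x \<in> ball x0 1" for x
  proof -
    have "\<bar>(x - x0) \<bullet> i\<bar> \<le> 1" if "i \<in> Basis" for i
      using Basis_le_norm[OF that, of "x - x0"] \<open>x \<in> ball x0 1\<close>
      by (simp add: dist_norm norm_minus_commute)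
    then show ?thesis
      by (intro subset_box_imp)
         (auto simp: a_def b_def inner_diff_left inner_add_left algebra_simps abs_le_iff)
  qed
  have centre: "x0 \<in> ball x0 1" by (rule centre_in_ball[THEN iffD2]) (rule zero_less_one)
  have *: "((\<lambda>y. U y *\<^sub>R k (x - y)) has_integral conv s k U x) (cbox a b)" if "x \<in> ball x0 1" for x
    by (rule conv_eq_kernel_integral[OF kc U z(1) sub[OF that]])
  have **: "((\<lambda>y. U y *\<^sub>R k' (x0 - y)) has_integral conv s k' U x0) (cbox a b)"
    by (rule conv_eq_kernel_integral[OF k' U z(2) sub[OF centre]])
  have "((\<lambda>x. integral (cbox a b) (\<lambda>y. U y *\<^sub>R k (x - y))) has_derivative
      blinfun_apply (integral (cbox a b) (\<lambda>y. U y *\<^sub>R k' (x0 - y)))) (at x0 within ball x0 1)"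
  proof (rule leibniz_rule)
    show "((\<lambda>x. U y *\<^sub>R k (x - y)) has_derivative blinfun_apply (U y *\<^sub>R k' (x - y)))
        (at x within ball x0 1)" for x y
    proof -
      have "((\<lambda>x. k (x + - y)) has_derivative blinfun_apply (k' (x + - y))) (at x)"
        by (rule has_derivative_shift[OF k])
      from has_derivative_scaleR_right[OF has_derivative_at_withinI[OF this, of "ball x0 1"], of "U y"]
      show ?thesis by (simp add: blinfun.scaleR_left[abs_def])
    qed
    show "(\<lambda>y. U y *\<^sub>R k (x - y)) integrable_on cbox a b" if "x \<in> ball x0 1" for x
      using *[OF that] by blast
    show "continuous_on (ball x0 1 \<times> cbox a b) (\<lambda>(x, y). U y *\<^sub>R k' (x - y))"
      unfolding case_prod_unfold
      by (intro continuous_intros continuous_on_compose2[OF U] continuous_on_compose2[OF k']) auto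
  qed auto
  then have d: "((\<lambda>x. integral (cbox a b) (\<lambda>y. U y *\<^sub>R k (x - y))) has_derivative
      blinfun_apply (conv s k' U x0)) (at x0)"
    unfolding integral_unique[OF **] at_within_open[OF centre open_ball] .
  show ?thesis
    by (rule has_derivative_transform_within_open[OF d open_ball centre]) (rule integral_unique[OF *])
qed

text \<open>The difference is put on \<open>U\<close> and not on the kernel; thus a kernel with
  merely continuous second derivatives already yields a Lipschitz Hessian.\<close>

lemma conv_lipschitz:
  fixes k :: "'a::euclidean_space \<Rightarrow> 'b::banach" and U :: "'a \<Rightarrow> real"
  assumes k: "continuous_on UNIV k" and U: "\<And>x y. \<bar>U x - U y\<bar> \<le> L * norm (x - y)"
    and Uc: "continuous_on UNIV U"
  shows "norm (conv s k U x - conv s k U y) \<le> L * integral (cube s) (\<lambda>z. norm (k z)) * norm (x - y)"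
proof -
  have i: "(\<lambda>z. norm (k z)) integrable_on cube s"
    by (intro integrable_continuous continuous_intros continuous_on_subset[OF k]) auto
  have d: "((\<lambda>z. U (x - z) *\<^sub>R k z - U (y - z) *\<^sub>R k z) has_integral (conv s k U x - conv s k U y)) (cube s)"
    by (intro has_integral_diff conv_has_integral k Uc)
  have "norm (integral (cube s) (\<lambda>z. U (x - z) *\<^sub>R k z - U (y - z) *\<^sub>R k z))
      \<le> integral (cube s) (\<lambda>z. (L * norm (x - y)) * norm (k z))"
  proof (rule integral_norm_bound_integral)
    show "(\<lambda>z. U (x - z) *\<^sub>R k z - U (y - z) *\<^sub>R k z) integrable_on cube s" using d by blast
    show "(\<lambda>z. (L * norm (x - y)) * norm (k z)) integrable_on cube s"
      by (intro integrable_on_mult_right i)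
    show "norm (U (x - z) *\<^sub>R k z - U (y - z) *\<^sub>R k z) \<le> (L * norm (x - y)) * norm (k z)" for z
      using U[of "x - z" "y - z"] by (simp add: scaleR_diff_left[symmetric] mult_right_mono)
  qed
  then show ?thesis using integral_unique[OF d] by (simp add: mult_ac)
qed

section \<open>A polynomial bump kernel and its derivatives\<close>

lemma has_real_derivative_max_power:
  "((\<lambda>t. max 0 t ^ (m + 2)) has_real_derivative real (m + 2) * max 0 t ^ (m + 1)) (at t)"
proof (cases "t = 0")
  case True
  have "((\<lambda>h. max 0 h ^ (m + 1)) \<longlongrightarrow> max 0 (0::real) ^ (m + 1)) (at 0)"
    by (intro tendsto_intros)
  then have "((\<lambda>h. max 0 h ^ (m + 1)) \<longlongrightarrow> (0::real)) (at 0)" by simp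
  then have "((\<lambda>h. (max 0 (0 + h) ^ (m + 2) - max 0 0 ^ (m + 2)) / h) \<longlongrightarrow> (0::real)) (at 0)"
    by (rule Lim_transform_eventually)
       (auto simp: eventually_at_filter max_def)
  then show ?thesis using True by (simp add: DERIV_def)
next
  case False
  show ?thesis
  proof (cases "t > 0")
    case True
    have "((\<lambda>t. t ^ (m + 2)) has_real_derivative real (m + 2) * t ^ (m + 1)) (at t)"
      using DERIV_pow[of "m + 2" t UNIV] by simp
    then have "((\<lambda>t. max 0 t ^ (m + 2)) has_real_derivative real (m + 2) * t ^ (m + 1)) (at t)"
      by (rule has_field_derivative_transform_within_open[where S = "{0<..}"]) (use True in auto)
    then show ?thesis using True by simp
  next
    case nt: False
    have "((\<lambda>t. 0) has_real_derivative 0) (at t)" by simp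
    then have "((\<lambda>t. max 0 t ^ (m + 2)) has_real_derivative 0) (at t)"
      by (rule has_field_derivative_transform_within_open[where S = "{..<0}"]) (use nt False in auto)
    then show ?thesis using nt by simp
  qed
qed

text \<open>The third power is the lowest integer power of the positive part that is twice
  continuously differentiable. The kernel is normalised only in \<open>moll\<close>.\<close>

definition bump :: "real \<Rightarrow> 'a::euclidean_space \<Rightarrow> real" where
  "bump s z = max 0 (s\<^sup>2 - z \<bullet> z) ^ 3"

definition bump_grad :: "real \<Rightarrow> 'a::euclidean_space \<Rightarrow> 'a" where
  "bump_grad s z = (- 6 * max 0 (s\<^sup>2 - z \<bullet> z) ^ 2) *\<^sub>R z"

definition bump_hess :: "real \<Rightarrow> 'a::euclidean_space \<Rightarrow> 'a \<Rightarrow>\<^sub>L 'a" where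
  "bump_hess s z = (- 6 * max 0 (s\<^sup>2 - z \<bullet> z) ^ 2) *\<^sub>R id_blinfun
     + (24 * max 0 (s\<^sup>2 - z \<bullet> z)) *\<^sub>R (blinfun_scaleR_left z o\<^sub>L blinfun_inner_right z)"

lemma bump_hess_apply:
  "bump_hess s z h = (- 6 * max 0 (s\<^sup>2 - z \<bullet> z) ^ 2) *\<^sub>R h + (24 * max 0 (s\<^sup>2 - z \<bullet> z) * (z \<bullet> h)) *\<^sub>R z"
  unfolding bump_hess_def blinfun.add_left blinfun.scaleR_left by simp

lemma bump_has_derivative:
  "(bump s has_derivative blinfun_apply (blinfun_inner_right (bump_grad s z))) (at z)"
proof -
  have "((\<lambda>z. s\<^sup>2 - z \<bullet> z) has_derivative (\<lambda>h. - (2 * (z \<bullet> h)))) (at z)"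
    by (auto intro!: derivative_eq_intros simp: inner_commute)
  note d = DERIV_compose_FDERIV[OF has_real_derivative_max_power[of 1 "s\<^sup>2 - z \<bullet> z"] this]
  have b: "bump s = (\<lambda>z. max 0 (s\<^sup>2 - z \<bullet> z) ^ (1 + 2))"
    by (simp add: bump_def fun_eq_iff eval_nat_numeral)
  show ?thesis
    unfolding b by (rule has_derivative_eq_rhs[OF d]) (simp add: bump_grad_def fun_eq_iff power2_eq_square)
qed

lemma bump_grad_has_derivative: "(bump_grad s has_derivative blinfun_apply (bump_hess s z)) (at z)"
proof -
  have "((\<lambda>z. s\<^sup>2 - z \<bullet> z) has_derivative (\<lambda>h. - (2 * (z \<bullet> h)))) (at z)"
    by (auto intro!: derivative_eq_intros simp: inner_commute)
  note d = DERIV_compose_FDERIV[OF has_real_derivative_max_power[of 0 "s\<^sup>2 - z \<bullet> z"] this]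
  have "((\<lambda>z. (- 6 * max 0 (s\<^sup>2 - z \<bullet> z) ^ 2) *\<^sub>R z) has_derivative
      (\<lambda>h. (- 6 * max 0 (s\<^sup>2 - z \<bullet> z) ^ 2) *\<^sub>R h + (24 * max 0 (s\<^sup>2 - z \<bullet> z) * (z \<bullet> h)) *\<^sub>R z)) (at z)"
    using has_derivative_scaleR[OF has_derivative_mult_right[OF d, of "- 6"] has_derivative_ident]
    by (simp add: mult_ac power2_eq_square)
  then show ?thesis
    unfolding bump_grad_def[abs_def] bump_hess_apply[abs_def] .
qed

lemma continuous_on_bump: "continuous_on A (bump s)"
  unfolding bump_def[abs_def] by (intro continuous_intros)

lemma continuous_on_bump_grad: "continuous_on A (bump_grad s)"
  unfolding bump_grad_def[abs_def] by (intro continuous_intros)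

lemma continuous_on_bump_hess: "continuous_on A (bump_hess s)"
proof -
  have 1: "continuous_on A (\<lambda>z::'a. blinfun_scaleR_left z :: real \<Rightarrow>\<^sub>L 'a)"
    by (rule bounded_linear.continuous_on[OF bounded_linear_blinfun_scaleR_left]) (rule continuous_on_id)
  have 2: "continuous_on A (\<lambda>z::'a. blinfun_inner_right z)"
    by (rule bounded_linear.continuous_on[OF bounded_linear_blinfun_inner_right]) (rule continuous_on_id)
  show ?thesis
    unfolding bump_hess_def[abs_def] by (intro continuous_intros 1 2)
qed

lemma max_bump_eq_0: "s \<ge> 0 \<Longrightarrow> norm z \<ge> s \<Longrightarrow> max 0 (s\<^sup>2 - z \<bullet> z) = 0"
  by (simp add: power2_norm_eq_inner[symmetric] power_mono)

lemma bump_support: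
  assumes "s \<ge> 0" "norm z \<ge> s"
  shows "bump s z = 0" "bump_grad s z = 0" "bump_hess s z = 0"
  unfolding bump_def bump_grad_def bump_hess_def max_bump_eq_0[OF assms] by simp_all

lemma bump_nonneg: "bump s z \<ge> 0"
  by (simp add: bump_def)

lemma integral_bump_pos:
  assumes "s > 0" shows "integral (cube s) (bump s :: 'a::euclidean_space \<Rightarrow> real) > 0"
proof -
  have i: "((bump s :: 'a \<Rightarrow> real) has_integral integral (cube s) (bump s :: 'a \<Rightarrow> real)) (cube s)"
    by (intro integrable_integral integrable_continuous continuous_on_bump)
  have "integral (cube s) (bump s :: 'a \<Rightarrow> real) \<ge> 0"
    by (rule has_integral_nonneg[OF i]) (rule bump_nonneg)
  moreover have "integral (cube s) (bump s :: 'a \<Rightarrow> real) \<noteq> 0"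
  proof
    assume "integral (cube s) (bump s :: 'a \<Rightarrow> real) = 0"
    then have i0: "((bump s :: 'a \<Rightarrow> real) has_integral 0) (cube s)" using i by simp
    have ne: "box (- (s *\<^sub>R One)) (s *\<^sub>R One :: 'a) \<noteq> {}" using assms by (simp add: box_ne_empty)
    have "bump s (0::'a) = 0"
      by (rule has_integral_0_cbox_imp_0[OF continuous_on_bump bump_nonneg i0 ne])
         (rule norm_le_in_cube, use assms in simp)
    then show False using assms by (simp add: bump_def)
  qed
  ultimately show ?thesis by simp
qed

section \<open>The normalised mollification\<close>

definition moll :: "real \<Rightarrow> ('a::euclidean_space \<Rightarrow> real) \<Rightarrow> 'a \<Rightarrow> real" where
  "moll s U x = (1 / integral (cube s) (bump s :: 'a \<Rightarrow> real)) * conv s (bump s) U x"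

text \<open>Only values within distance \<open>s\<close> of \<open>x\<close> enter, so an inequality
  known just near \<open>x\<close> can be mollified there.\<close>

lemma moll_mono:
  assumes s: "s > 0" and c: "continuous_on UNIV U" "continuous_on UNIV V"
    and le: "\<And>z. norm z \<le> s \<Longrightarrow> U (x - z) \<le> V (x - z)"
  shows "moll s U x \<le> moll s V x"
proof -
  have "conv s (bump s) U x \<le> conv s (bump s) V x"
  proof (rule has_integral_le[OF conv_has_integral conv_has_integral])
    fix z :: 'a
    show "U (x - z) *\<^sub>R bump s z \<le> V (x - z) *\<^sub>R bump s z"
      using le[of z] bump_support(1)[of s z] bump_nonneg[of s z] s
      by (cases "norm z \<le> s") (auto intro: mult_right_mono)
  qed (auto intro: c continuous_on_bump)
  then show ?thesis unfolding moll_def using integral_bump_pos[OF s, where 'a = 'a]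
    by (intro mult_left_mono) auto
qed

lemma moll_add:
  assumes "continuous_on UNIV U" "continuous_on UNIV V"
  shows "moll s (\<lambda>x. U x + V x) x = moll s U x + moll s V x"
proof -
  have "conv s (bump s) (\<lambda>x. U x + V x) x = conv s (bump s) U x + conv s (bump s) V x"
    using integral_unique[OF has_integral_add[OF
        conv_has_integral[OF continuous_on_bump assms(1), where x = x and s = s]
        conv_has_integral[OF continuous_on_bump assms(2), where x = x and s = s]]]
    by (simp add: conv_def distrib_right)
  then show ?thesis by (simp add: moll_def distrib_left)
qed

lemma moll_cmult: "moll s (\<lambda>x. c * U x) x = c * moll s U x"
  by (simp add: moll_def conv_def mult.assoc)

lemma moll_const: "s > 0 \<Longrightarrow> moll s (\<lambda>x::'a::euclidean_space. c) x = c"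
  using integral_bump_pos[of s, where 'a = 'a] by (simp add: moll_def conv_def)

lemma moll_shift: "moll s (\<lambda>x. U (x + v)) x = moll s U (x + v)"
  by (simp add: moll_def conv_def diff_add_eq)

lemma moll_sum:
  assumes "finite I" "\<And>i. i \<in> I \<Longrightarrow> continuous_on UNIV (U i)" "s > 0"
  shows "moll s (\<lambda>x. \<Sum>i\<in>I. U i x) x = (\<Sum>i\<in>I. moll s (U i) x)"
  using assms(1,2)
proof (induction I rule: finite_induct)
  case empty
  then show ?case using moll_const[OF \<open>s > 0\<close>, of 0] by simp
next
  case (insert i I)
  then show ?case by (simp add: moll_add continuous_on_sum)
qed

lemma continuous_on_walk:
  fixes U :: "'a::euclidean_space \<Rightarrow> real"
  assumes "continuous_on UNIV U" shows "continuous_on UNIV (walk h T U)"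
  unfolding walk_def[abs_def] by (intro continuous_intros continuous_on_compose2[OF assms]) auto

lemma continuous_on_funpow_walk:
  fixes U :: "'a::euclidean_space \<Rightarrow> real"
  assumes "continuous_on UNIV U" shows "continuous_on UNIV ((walk h T ^^ k) U)"
  by (induction k) (auto intro: continuous_on_walk assms)

text \<open>Convolution commutes with translations. A growth estimate for the flow of
  \<open>U\<close> thereby becomes one for the flow of its mollification.\<close>

lemma moll_walk:
  fixes U :: "'a::euclidean_space \<Rightarrow> real"
  assumes "continuous_on UNIV U" "s > 0"
  shows "moll s (walk h T U) = walk h T (moll s U)"
proof
  fix x
  have c: "continuous_on UNIV (\<lambda>x. U (x + v))" for v
    by (intro continuous_intros continuous_on_compose2[OF assms(1)]) auto
  have *: "moll s (\<lambda>x. U (x + h *\<^sub>R T i) + U (x - h *\<^sub>R T i)) x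
     = moll s U (x + h *\<^sub>R T i) + moll s U (x - h *\<^sub>R T i)" for i
    using moll_add[OF c[of "h *\<^sub>R T i"] c[of "- (h *\<^sub>R T i)"], of s x]
      moll_shift[of s U "h *\<^sub>R T i" x] moll_shift[of s U "- (h *\<^sub>R T i)" x] by simp
  have "continuous_on UNIV (\<lambda>x. U (x + h *\<^sub>R T i) + U (x - h *\<^sub>R T i))" for i
    using continuous_on_add[OF c[of "h *\<^sub>R T i"] c[of "- (h *\<^sub>R T i)"]] by simp
  then have "moll s (\<lambda>x. \<Sum>i\<in>UNIV. U (x + h *\<^sub>R T i) + U (x - h *\<^sub>R T i)) x
    = (\<Sum>i\<in>UNIV. moll s (\<lambda>x. U (x + h *\<^sub>R T i) + U (x - h *\<^sub>R T i)) x)"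
    by (intro moll_sum assms(2)) auto
  then show "moll s (walk h T U) x = walk h T (moll s U) x"
    unfolding walk_def[abs_def] real_scaleR_def moll_cmult by (simp add: *)
qed

lemma moll_funpow_walk:
  fixes U :: "'a::euclidean_space \<Rightarrow> real"
  assumes "continuous_on UNIV U" "s > 0"
  shows "moll s ((walk h T ^^ k) U) = (walk h T ^^ k) (moll s U)"
  by (induction k) (simp_all add: moll_walk[OF continuous_on_funpow_walk[OF assms(1)] assms(2)])

lemma moll_close:
  assumes s: "s > 0" and U: "\<And>x y. \<bar>U x - U y\<bar> \<le> L * norm (x - y)" and L: "L \<ge> 0"
    and c: "continuous_on UNIV U"
  shows "\<bar>moll s U x - U x\<bar> \<le> L * s"
proof -
  have *: "\<bar>U (x - z) - U x\<bar> \<le> L * s" if "norm z \<le> s" for z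
    using U[of "x - z" x] mult_left_mono[OF that L] by simp
  have "moll s U x \<le> moll s (\<lambda>y. U x + L * s) x"
    by (rule moll_mono[OF s c continuous_on_const]) (use * in \<open>smt (verit)\<close>)
  moreover have "moll s (\<lambda>y. U x - L * s) x \<le> moll s U x"
    by (rule moll_mono[OF s continuous_on_const c]) (use * in \<open>smt (verit)\<close>)
  ultimately show ?thesis by (simp add: moll_const[OF s] abs_le_iff)
qed

lemma moll_convex:
  fixes U :: "'a::euclidean_space \<Rightarrow> real"
  assumes s: "s > 0" and U: "convex_on UNIV U" and c: "continuous_on UNIV U"
  shows "convex_on UNIV (moll s U)"
proof (rule convex_onI)
  fix t :: real and x y :: 'a assume t: "0 < t" "t < 1"
  define p where "p = (1 - t) *\<^sub>R x + t *\<^sub>R y"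
  have c': "continuous_on UNIV (\<lambda>z. U (z + v))" for v
    by (intro continuous_intros continuous_on_compose2[OF c]) auto
  have "moll s U p \<le> moll s (\<lambda>w. (1 - t) * U (w + (x - p)) + t * U (w + (y - p))) p"
  proof (rule moll_mono[OF s c])
    show "continuous_on UNIV (\<lambda>w. (1 - t) * U (w + (x - p)) + t * U (w + (y - p)))"
      by (intro continuous_intros c')
    fix z
    have "p - z = (1 - t) *\<^sub>R (p - z + (x - p)) + t *\<^sub>R (p - z + (y - p))"
      by (simp add: p_def algebra_simps)
    then show "U (p - z) \<le> (1 - t) * U (p - z + (x - p)) + t * U (p - z + (y - p))"
      using convex_onD[OF U, of t "p - z + (x - p)" "p - z + (y - p)"] t by (metis UNIV_I less_imp_le)
  qed
  also have "\<dots> = (1 - t) * moll s U x + t * moll s U y"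
    by (subst moll_add) (auto intro!: continuous_intros c' simp: moll_cmult moll_shift)
  finally show "moll s U ((1 - t) *\<^sub>R x + t *\<^sub>R y) \<le> (1 - t) * moll s U x + t * moll s U y"
    by (simp add: p_def)
qed simp

text \<open>Both derivatives fall on the kernel, and the Lipschitz bound for the Hessian comes from
  that of \<open>U\<close>.\<close>

lemma moll_C21:
  fixes U :: "real^'n \<Rightarrow> real"
  assumes s: "s > 0" and U: "convex_on UNIV U" and lip: "\<And>x y. \<bar>U x - U y\<bar> \<le> L * norm (x - y)"
    and c: "continuous_on UNIV U"
  obtains C G D where "C21 C (moll s U) G D"
proof -
  define N where "N = integral (cube s) (bump s :: real^'n \<Rightarrow> real)"
  have N: "N > 0" unfolding N_def by (rule integral_bump_pos[OF s])
  have conv: "convex_on UNIV (conv s (bump s) U)"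
  proof -
    have "conv s (bump s) U = (\<lambda>x. N * moll s U x)" using N by (simp add: moll_def N_def fun_eq_iff)
    then show ?thesis using N by (simp add: convex_on_cmul moll_convex[OF s U c])
  qed
  have out: "norm z \<ge> s" if "z \<notin> cube s" for z :: "real^'n"
    using norm_le_in_cube[of z s] that by force
  have "C21 (L * integral (cube s) (\<lambda>z. norm (bump_hess s z :: (real^'n) \<Rightarrow>\<^sub>L (real^'n))))
      (conv s (bump s) U) (conv s (bump_grad s) U) (conv s (bump_hess s) U)"
    unfolding C21_def
  proof (intro conjI allI conv)
    fix x y h k :: "real^'n"
    have "(conv s (bump s) U has_derivative
        blinfun_apply (conv s (\<lambda>z. blinfun_inner_right (bump_grad s z)) U x)) (at x)"
    proof (rule conv_has_derivative[OF bump_has_derivative _ c])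
      show "continuous_on UNIV (\<lambda>z::real^'n. blinfun_inner_right (bump_grad s z))"
        by (rule bounded_linear.continuous_on[OF bounded_linear_blinfun_inner_right]) (rule continuous_on_bump_grad)
      show "bump s z = 0" "blinfun_inner_right (bump_grad s z) = 0" if "z \<notin> cube s" for z :: "real^'n"
        using bump_support[OF _ out[OF that]] s by (auto simp: blinfun_eqI)
    qed
    \<comment> \<open>Differentiation produces a kernel with values in linear functionals;
      evaluation at \<open>h\<close> turns it into the gradient vector.\<close>
    moreover have "blinfun_apply (conv s (\<lambda>z. blinfun_inner_right (bump_grad s z)) U x) h
        = h \<bullet> conv s (bump_grad s) U x" for h
    proof -
      have i1: "(\<lambda>z. U (x - z) *\<^sub>R blinfun_inner_right (bump_grad s z)) integrable_on cube s"
        by (intro integrable_continuous conv_integrand_continuous c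
            bounded_linear.continuous_on[OF bounded_linear_blinfun_inner_right] continuous_on_bump_grad)
      have i2: "(\<lambda>z. U (x - z) *\<^sub>R bump_grad s z) integrable_on cube s"
        by (intro integrable_continuous conv_integrand_continuous c continuous_on_bump_grad)
      show ?thesis
        unfolding conv_def
        using integral_linear[OF i1 blinfun.bounded_linear_left[of h]]
          integral_linear[OF i2 bounded_linear_inner_right[of h]]
        by (simp add: o_def blinfun.scaleR_left inner_commute)
    qed
    ultimately show "(conv s (bump s) U has_derivative (\<lambda>h. h \<bullet> conv s (bump_grad s) U x)) (at x)"
      by (rule has_derivative_eq_rhs[OF _ ext])
    show "(conv s (bump_grad s) U has_derivative blinfun_apply (conv s (bump_hess s) U x)) (at x)"
    proof (rule conv_has_derivative[OF bump_grad_has_derivative continuous_on_bump_hess c])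
      show "bump_grad s z = 0" "bump_hess s z = 0" if "z \<notin> cube s" for z :: "real^'n"
        using bump_support(2,3)[OF _ out[OF that]] s by auto
    qed
    show "norm (conv s (bump_hess s) U x - conv s (bump_hess s) U y)
        \<le> L * integral (cube s) (\<lambda>z. norm (bump_hess s z :: (real^'n) \<Rightarrow>\<^sub>L (real^'n))) * norm (x - y)"
      by (rule conv_lipschitz[OF continuous_on_bump_hess lip c])
    have i: "(\<lambda>z. U (x - z) *\<^sub>R bump_hess s z) integrable_on cube s"
      by (intro integrable_continuous conv_integrand_continuous c continuous_on_bump_hess)
    have bl: "bounded_linear (\<lambda>f::(real^'n) \<Rightarrow>\<^sub>L (real^'n). blinfun_apply f h \<bullet> k)" for h k
      using bounded_linear_compose[OF bounded_linear_inner_left blinfun.bounded_linear_left] by blast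
    have e: "conv s (bump_hess s) U x h \<bullet> k = integral (cube s) (\<lambda>z. U (x - z) * (bump_hess s z h \<bullet> k))" for h k
      unfolding conv_def
      using integral_linear[OF i bl, of h k] by (simp add: o_def blinfun.scaleR_left)
    have sw: "bump_hess s z h \<bullet> k = bump_hess s z k \<bullet> h" for z
      by (simp add: bump_hess_apply inner_diff_right inner_commute mult_ac)
    show "conv s (bump_hess s) U x h \<bullet> k = h \<bullet> conv s (bump_hess s) U x k"
      unfolding inner_commute[of h] e sw ..
  qed
  from C21_cmult[OF this, of "1 / N"] N show ?thesis
    using that by (simp add: moll_def[abs_def] N_def)
qed

section \<open>Smooth approximation of viscosity subsolutions\<close>


text \<open>The segment from \<open>x\<close> to \<open>y\<close> is prolonged beyond
  \<open>y\<close> by \<open>R / 2\<close> to a point \<open>z\<close> of the large ball. Convexity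
  bounds the slope from \<open>x\<close> to \<open>y\<close> by the oscillation \<open>2 * M\<close>
  over the length \<open>R / 2\<close>.\<close>

lemma convex_on_cball_imp_lipschitz:
  fixes u :: "'a::real_normed_vector \<Rightarrow> real"
  assumes u: "convex_on (cball a R) u" and R: "R > 0" and M: "\<And>x. x \<in> cball a R \<Longrightarrow> \<bar>u x\<bar> \<le> M"
    and x: "x \<in> cball a (R/2)" and y: "y \<in> cball a (R/2)"
  shows "\<bar>u x - u y\<bar> \<le> 4 * M / R * norm (x - y)"
proof -
  have *: "u y - u x \<le> 4 * M / R * norm (x - y)" if x: "x \<in> cball a (R/2)" and y: "y \<in> cball a (R/2)" for x y
  proof (cases "x = y")
    case False
    define d where "d = norm (y - x)"
    have d: "d > 0" using False by (simp add: d_def)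
    define z where "z = y + (R / 2 / d) *\<^sub>R (y - x)"
    define t where "t = d / (d + R / 2)"
    have t: "0 \<le> t" "t \<le> 1" "t \<le> 2 * d / R" using d R by (auto simp: t_def field_simps)
    have "norm (z - y) = R / 2" using d R by (simp add: z_def d_def)
    then have z: "z \<in> cball a R"
      using y norm_triangle_ineq[of "y - a" "z - y"] by (simp add: dist_norm norm_minus_commute)
    have x': "x \<in> cball a R" using x R by simp
    have ne: "d + R / 2 \<noteq> 0" using d R by simp
    have "(d + R / 2) *\<^sub>R ((1 - t) *\<^sub>R x + t *\<^sub>R z) = (d + R / 2) *\<^sub>R y"
    proof -
      have 1: "(d + R / 2) * t = d" "(d + R / 2) * (1 - t) = R / 2" using ne by (auto simp: t_def field_simps)
      have 2: "d *\<^sub>R z = d *\<^sub>R y + (R / 2) *\<^sub>R (y - x)" using d by (simp add: z_def algebra_simps)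
      show ?thesis unfolding scaleR_add_right scaleR_scaleR 1 2 by (simp add: algebra_simps)
    qed
    then have "y = (1 - t) *\<^sub>R x + t *\<^sub>R z" using ne by simp
    then have "u y \<le> (1 - t) * u x + t * u z" using convex_onD[OF u t(1,2) x' z] by simp
    then have "u y - u x \<le> t * (u z - u x)" by (simp add: algebra_simps)
    also have "\<dots> \<le> t * (2 * M)" using M[OF z] M[OF x'] t by (intro mult_left_mono) auto
    also have "\<dots> \<le> 2 * d / R * (2 * M)" using t M[OF z] by (intro mult_right_mono) auto
    finally show ?thesis by (simp add: d_def norm_minus_commute mult_ac)
  qed simp
  show ?thesis using *[OF x y] *[OF y x] by (simp add: abs_le_iff norm_minus_commute)
qed

text \<open>The extension is the infimal convolution of \<open>u\<close> with \<open>L\<close> times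
  the norm; it is convex because \<open>V\<close> is jointly convex in both arguments. Averaging and
  mollification need a function on the whole space.\<close>

lemma convex_lipschitz_extension:
  fixes u :: "'a::real_normed_vector \<Rightarrow> real"
  assumes S: "convex S" "S \<noteq> {}" and u: "convex_on S u" and L: "L \<ge> 0"
    and lip: "\<And>x y. x \<in> S \<Longrightarrow> y \<in> S \<Longrightarrow> \<bar>u x - u y\<bar> \<le> L * norm (x - y)"
  obtains U where "convex_on UNIV U" "\<And>x y. \<bar>U x - U y\<bar> \<le> L * norm (x - y)" "\<And>x. x \<in> S \<Longrightarrow> U x = u x"
proof
  define V where "V x y = u y + L * norm (x - y)" for x y
  define U where "U x = (INF y\<in>S. V x y)" for x
  obtain a where a: "a \<in> S" using S by blast
  have lower: "u w - L * norm (x - w) \<le> V x y" if "y \<in> S" "w \<in> S" for x y w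
  proof -
    have "u w \<le> u y + L * norm (w - y)" using lip[OF that] by (simp add: abs_le_iff norm_minus_commute)
    also have "\<dots> \<le> u y + L * (norm (x - y) + norm (x - w))"
      using L norm_triangle_ineq4[of "x - y" "x - w"] by (intro add_left_mono mult_left_mono) auto
    finally show ?thesis by (simp add: V_def algebra_simps)
  qed
  then have bdd: "bdd_below (V x ` S)" for x using a by (intro bdd_belowI2)
  have le: "U x \<le> V x y" if "y \<in> S" for x y unfolding U_def by (rule cINF_lower[OF bdd that])
  have near: "\<exists>y\<in>S. V x y < U x + e" if "e > 0" for x e
    using cINF_less_iff[OF S(2) bdd, of x "U x + e"] that by (simp add: U_def)
  show "U x = u x" if "x \<in> S" for x
  proof (rule antisym)
    show "U x \<le> u x" using le[OF that, of x] by (simp add: V_def)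
    show "u x \<le> U x" unfolding U_def using lower[OF _ that, of _ x] by (intro cINF_greatest S(2)) simp
  qed
  have "U x \<le> U y + L * norm (x - y)" for x y
  proof (rule field_le_epsilon)
    fix e :: real assume "e > 0"
    then obtain w where w: "w \<in> S" "V y w < U y + e" using near by blast
    have "U x \<le> V x w" by (rule le[OF w(1)])
    also have "\<dots> \<le> u w + L * (norm (x - y) + norm (y - w))"
      unfolding V_def using L norm_triangle_ineq[of "x - y" "y - w"] by (intro add_left_mono mult_left_mono) auto
    also have "\<dots> = V y w + L * norm (x - y)" by (simp add: V_def algebra_simps)
    finally show "U x \<le> U y + L * norm (x - y) + e" using w(2) by simp
  qed
  then show "\<bar>U x - U y\<bar> \<le> L * norm (x - y)" for x y
    by (smt (verit) norm_minus_commute)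
  show "convex_on UNIV U"
  proof (rule convex_onI)
    fix t :: real and x1 x2 assume t: "0 < t" "t < 1"
    show "U ((1 - t) *\<^sub>R x1 + t *\<^sub>R x2) \<le> (1 - t) * U x1 + t * U x2"
    proof (rule field_le_epsilon)
      fix e :: real assume e: "e > 0"
      obtain y1 where y1: "y1 \<in> S" "V x1 y1 < U x1 + e" using near e by blast
      obtain y2 where y2: "y2 \<in> S" "V x2 y2 < U x2 + e" using near e by blast
      have "(1 - t) *\<^sub>R y1 + t *\<^sub>R y2 \<in> S" using convexD[OF S(1) y1(1) y2(1), of "1 - t" t] t by simp
      then have "U ((1 - t) *\<^sub>R x1 + t *\<^sub>R x2) \<le> V ((1 - t) *\<^sub>R x1 + t *\<^sub>R x2) ((1 - t) *\<^sub>R y1 + t *\<^sub>R y2)"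
        by (rule le)
      also have "\<dots> \<le> ((1 - t) * u y1 + t * u y2) + L * ((1 - t) * norm (x1 - y1) + t * norm (x2 - y2))"
      proof -
        have "(1 - t) *\<^sub>R x1 + t *\<^sub>R x2 - ((1 - t) *\<^sub>R y1 + t *\<^sub>R y2)
          = (1 - t) *\<^sub>R (x1 - y1) + t *\<^sub>R (x2 - y2)" by (simp add: algebra_simps)
        moreover have "norm ((1 - t) *\<^sub>R (x1 - y1) + t *\<^sub>R (x2 - y2))
            \<le> (1 - t) * norm (x1 - y1) + t * norm (x2 - y2)"
          using norm_triangle_ineq[of "(1 - t) *\<^sub>R (x1 - y1)" "t *\<^sub>R (x2 - y2)"] t by simp
        ultimately show ?thesis unfolding V_def
          using convex_onD[OF u _ _ y1(1) y2(1), of t] t L by (intro add_mono mult_left_mono) auto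
      qed
      also have "\<dots> = (1 - t) * V x1 y1 + t * V x2 y2" by (simp add: V_def algebra_simps)
      also have "\<dots> \<le> (1 - t) * (U x1 + e) + t * (U x2 + e)"
        using y1(2) y2(2) t by (intro add_mono mult_left_mono) auto
      also have "\<dots> = (1 - t) * U x1 + t * U x2 + e" by (simp add: algebra_simps)
      finally show "U ((1 - t) *\<^sub>R x1 + t *\<^sub>R x2) \<le> (1 - t) * U x1 + t * U x2 + e" .
    qed
  qed simp
qed

section \<open>Hessians as matrices, and iterates of the averaging operator\<close>

lemma matrix_blinfun_apply: "matrix (blinfun_apply f) *v x = blinfun_apply f x"
  for f :: "(real^'n) \<Rightarrow>\<^sub>L (real^'m)"
  by (metis matrix_vector_mul(3) blinfun.bounded_linear_right)

lemma transpose_matrix_symmetric: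
  fixes f :: "(real^'n) \<Rightarrow>\<^sub>L (real^'n)"
  assumes "\<And>h k. f h \<bullet> k = h \<bullet> f k"
  shows "transpose (matrix (blinfun_apply f)) = matrix (blinfun_apply f)"
proof -
  have "f (axis i 1) $ j = f (axis j 1) $ i" for i j
    using assms[of "axis i 1" "axis j 1"] by (simp add: inner_axis inner_axis')
  then show ?thesis by (simp add: transpose_def matrix_def vec_eq_iff)
qed

lemma funpow_walk_mono:
  "(\<And>y. \<phi> y \<le> \<psi> y) \<Longrightarrow> (walk h T ^^ k) \<phi> x \<le> ((walk h T ^^ k) \<psi> x :: real)"
  by (induction k arbitrary: x) (auto intro: walk_mono)

lemma funpow_walk_add_const:
  "(walk h T ^^ k) (\<lambda>y. \<phi> y + c) x = (walk h T ^^ k) \<phi> x + (c :: real)"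
proof (induction k arbitrary: x)
  case (Suc k)
  then have "(walk h T ^^ k) (\<lambda>y. \<phi> y + c) = (\<lambda>x. (walk h T ^^ k) \<phi> x + c)" by auto
  then show ?case by (simp add: walk_add walk_const)
qed simp

text \<open>For each frame separately, the flow is compared with \<open>U\<close> on a ball around
  every centre in \<open>cball x s\<close>, so that the growth estimate can be integrated against
  the kernel at \<open>x\<close>. The inequalities for all frames together give the determinant
  bound.\<close>

lemma viscosity_det_mollification:
  fixes u U :: "real^'n \<Rightarrow> real"
  assumes U: "convex_on UNIV U" and lip: "\<And>x y. \<bar>U x - U y\<bar> \<le> L * norm (x - y)" and L: "L \<ge> 0"
    and s: "s > 0" and r: "r > 0" and c: "c \<ge> 0"
    and W: "C21 C (moll s U) G D"
    and visc: "\<And>C \<phi> G D y z. C21 C \<phi> G D \<Longrightarrow> z \<in> cball x s \<Longrightarrow> y \<in> ball z r \<Longrightarrow>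
      (\<And>w. w \<in> ball z r \<Longrightarrow> \<phi> y - U y \<le> \<phi> w - U w) \<Longrightarrow> c \<le> det (matrix (blinfun_apply (D y)))"
  shows "c \<le> det (matrix (blinfun_apply (D x)))"
proof (rule det_ge_if_quadratic_sums_ge)
  have cont: "continuous_on UNIV U"
  proof (rule lipschitz_on_continuous_on[of L])
    show "L-lipschitz_on UNIV U" using lip L by (auto simp: lipschitz_on_def dist_norm)
  qed
  let ?n = "real CARD('n)"
  show "transpose (matrix (blinfun_apply (D x))) = matrix (blinfun_apply (D x))"
    by (rule transpose_matrix_symmetric[OF C21D(5)[OF W]])
  show "y \<bullet> (matrix (blinfun_apply (D x)) *v y) \<ge> 0" for y
    unfolding matrix_blinfun_apply by (rule C21_psd[OF W])
  fix T :: "'n \<Rightarrow> real^'n"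
  define d where "d = c * (det (cols T))\<^sup>2"
  \<comment> \<open>The root makes the bound linear: a test Hessian with determinant at least
    \<open>c\<close> satisfies \<open>\<mu> \<le> quad T D' / ?n\<close>.\<close>
  define \<mu> where "\<mu> = root CARD('n) d"
  have d0: "d \<ge> 0" using c by (simp add: d_def)
  have \<mu>0: "\<mu> \<ge> 0" and \<mu>d: "\<mu> ^ CARD('n) = d" using d0 by (simp_all add: \<mu>_def)
  define \<sigma> where "\<sigma> = (\<Sum>i\<in>UNIV. (norm (T i))\<^sup>2)"
  have \<sigma>0: "\<sigma> \<ge> 0" by (simp add: \<sigma>_def sum_nonneg)
  have quad0: "quad T (D x) \<ge> 0" unfolding quad_def by (intro sum_nonneg C21_psd[OF W])
  have visc': "?n * \<mu> \<le> quad T (D' y)"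
    if \<phi>: "C21 C' \<phi> G' D'" and z: "z \<in> cball x s" "y \<in> ball z r"
      and touch: "\<And>w. w \<in> ball z r \<Longrightarrow> \<phi> y - U y \<le> \<phi> w - U w" for C' \<phi> G' D' y z
  proof -
    have "c \<le> det (matrix (blinfun_apply (D' y)))" by (rule visc[OF \<phi> z touch])
    then have "d \<le> det (matrix (blinfun_apply (D' y))) * (det (cols T))\<^sup>2"
      unfolding d_def by (rule mult_right_mono) simp
    also have "\<dots> \<le> ((\<Sum>i\<in>UNIV. T i \<bullet> (matrix (blinfun_apply (D' y)) *v T i)) / ?n) ^ CARD('n)"
      by (rule det_le_quadratic_sum_power[OF transpose_matrix_symmetric[OF C21D(5)[OF \<phi>]]])
         (unfold matrix_blinfun_apply, rule C21_psd[OF \<phi>])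
    also have "\<dots> = (quad T (D' y) / ?n) ^ CARD('n)"
      by (simp add: matrix_blinfun_apply quad_def)
    finally have "\<mu> ^ CARD('n) \<le> (quad T (D' y) / ?n) ^ CARD('n)" by (simp add: \<mu>d)
    moreover have "quad T (D' y) / ?n \<ge> 0" unfolding quad_def by (intro divide_nonneg_nonneg sum_nonneg C21_psd[OF \<phi>]) simp
    ultimately have "\<mu> \<le> quad T (D' y) / ?n" by (meson power_mono_iff zero_less_card_finite \<mu>0)
    then show ?thesis by (simp add: field_simps)
  qed
  have main: "2 * ?n * b \<le> quad T (D x)" if b: "b \<ge> 0" "2 * ?n * b < ?n * \<mu>" for b
  proof -
    \<comment> \<open>The penalty spends at most half of the gap between \<open>2 * ?n * b\<close>
      and \<open>?n * \<mu>\<close>; the rest absorbs the error of order \<open>h\<close>. Adding 1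
      keeps the denominator positive.\<close>
    define \<kappa> where "\<kappa> = (?n * \<mu> - 2 * ?n * b) / (4 * (\<sigma> + 1))"
    have \<kappa>: "\<kappa> > 0" using b \<sigma>0 by (simp add: \<kappa>_def)
    have \<kappa>\<sigma>: "2 * ?n * b + 2 * \<kappa> * \<sigma> < ?n * \<mu>"
    proof -
      have "2 * \<kappa> * \<sigma> \<le> 2 * \<kappa> * (\<sigma> + 1)" using \<kappa> by simp
      also have "\<dots> = (?n * \<mu> - 2 * ?n * b) / 2" using \<sigma>0 by (simp add: \<kappa>_def field_simps)
      finally have "2 * ?n * b + 2 * \<kappa> * \<sigma> \<le> (?n * \<mu> + 2 * ?n * b) / 2" by (simp add: field_simps)
      also have "\<dots> < ?n * \<mu>" using b(2) by simp
      finally show ?thesis .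
    qed
    define t0 where "t0 = \<kappa> * r\<^sup>2 / (b + 1)"
    have t0: "t0 > 0" using \<kappa> r b by (simp add: t0_def)
    show ?thesis
    proof (rule quad_ge_of_walk_growth[OF W t0])
      fix t \<epsilon> :: real assume t: "0 < t" "t \<le> t0" and \<epsilon>: "\<epsilon> > 0"
      have bt: "b * t \<le> \<kappa> * r\<^sup>2"
      proof -
        have "b * t \<le> (b + 1) * t0" using t b by (intro mult_mono) auto
        then show ?thesis using b by (simp add: t0_def)
      qed
      \<comment> \<open>A second mollification, at a radius unrelated to \<open>s\<close>, supplies
        a smooth convex initial datum between \<open>U\<close> and
        \<open>U + \<epsilon>\<close>.\<close>
      define s' where "s' = \<epsilon> / (2 * L + 1)"
      have s': "s' > 0" "2 * L * s' \<le> \<epsilon>" using \<epsilon> L by (auto simp: s'_def field_simps)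
      obtain C' G' D' where g0: "C21 C' (moll s' U) G' D'"
        using moll_C21[OF s'(1) U lip cont] by blast
      define g where "g y = moll s' U y + L * s'" for y
      have g: "C21 (C' + 0) g (\<lambda>x. G' x + 0) (\<lambda>x. D' x + 0)"
        unfolding g_def using C21_add[OF g0 C21_affine[of 0 "L * s'"]] by simp
      have close: "\<bar>moll s' U y - U y\<bar> \<le> L * s'" for y by (rule moll_close[OF s'(1) lip L cont])
      have Ug: "U y \<le> g y" "g y \<le> U y + \<epsilon>" for y
        using close[of y] s'(2) by (auto simp: g_def)
      define \<Theta> where "\<Theta> = (\<Sum>i\<in>UNIV. norm (T i)) / ?n * \<sigma> + 2 * (\<Sum>i\<in>UNIV. norm (T i) ^ 3)"
      have "(\<lambda>k. 2 * ?n * b + 2 * \<kappa> * \<sigma> + (C' + 0) * sqrt (t / real k) * \<Theta>)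
          \<longlonglongrightarrow> 2 * ?n * b + 2 * \<kappa> * \<sigma> + (C' + 0) * sqrt 0 * \<Theta>"
        by (intro tendsto_intros lim_const_over_n)
      then have "\<forall>\<^sub>F k in sequentially. 2 * ?n * b + 2 * \<kappa> * \<sigma> + (C' + 0) * sqrt (t / real k) * \<Theta> < ?n * \<mu>"
        using \<kappa>\<sigma> by (intro order_tendstoD) auto
      then show "\<forall>\<^sub>F k in sequentially. moll s U x + b * t \<le> (walk (sqrt (t / real k)) T ^^ k) (moll s U) x + \<epsilon>"
        using eventually_gt_at_top[of 0]
      proof eventually_elim
        case (elim k)
        define h where "h = sqrt (t / real k)"
        have h: "h > 0" using elim t by (simp add: h_def)
        have kh: "b * real k * h\<^sup>2 = b * t" using elim t by (simp add: h_def)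
        have below: "U z + b * t \<le> (walk h T ^^ k) U z + \<epsilon>" if z: "z \<in> cball x s" for z
        proof -
          \<comment> \<open>The comparison is evaluated at the centre of its ball, where the penalty
            vanishes.\<close>
          have "U z + b * real k * h\<^sup>2 - \<kappa> * (norm (z - z))\<^sup>2 \<le> (walk h T ^^ k) g z"
          proof (rule walk_comparison[OF g Ug(1) continuous_on_subset[OF cont] r _ \<kappa> h b(1)])
            show "?n * \<mu> \<le> quad T (D' y)"
              if "C21 C' \<phi> G' D'" "y \<in> ball z r" "\<And>w. w \<in> ball z r \<Longrightarrow> \<phi> y - U y \<le> \<phi> w - U w"
              for C' \<phi> G' D' y by (rule visc'[OF that(1) z that(2,3)])
            show "b * real k * h\<^sup>2 \<le> \<kappa> * r\<^sup>2" unfolding kh by (rule bt)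
          qed (use elim r in \<open>auto simp: \<sigma>_def[symmetric] \<Theta>_def h_def\<close>)
          also have "\<dots> \<le> (walk h T ^^ k) (\<lambda>y. U y + \<epsilon>) z" by (rule funpow_walk_mono[OF Ug(2)])
          finally show ?thesis using kh by (simp add: funpow_walk_add_const)
        qed
        have "moll s (\<lambda>y. U y + b * t) x \<le> moll s (\<lambda>y. (walk h T ^^ k) U y + \<epsilon>) x"
          by (rule moll_mono[OF s])
             (auto intro!: continuous_intros cont continuous_on_funpow_walk below simp: dist_norm)
        then show ?case
          using s by (simp add: moll_add cont continuous_on_funpow_walk moll_const moll_funpow_walk h_def[symmetric])
      qed
    qed
  qed
  \<comment> \<open>Rates strictly below the critical one suffice by density; negative ones are
    covered by convexity.\<close>
  have "?n * \<mu> \<le> quad T (D x)"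
  proof (rule dense_le)
    fix y assume y: "y < ?n * \<mu>"
    show "y \<le> quad T (D x)"
    proof (cases "y \<ge> 0")
      case True then show ?thesis using main[of "y / (2 * ?n)"] y by simp
    next
      case False then show ?thesis using quad0 by simp
    qed
  qed
  then have "\<mu> \<le> quad T (D x) / ?n" by (simp add: field_simps)
  then have "\<mu> ^ CARD('n) \<le> (quad T (D x) / ?n) ^ CARD('n)" using \<mu>0 by (rule power_mono)
  then show "c * (det (cols T))\<^sup>2 \<le> ((\<Sum>i\<in>UNIV. T i \<bullet> (matrix (blinfun_apply (D x)) *v T i)) / ?n) ^ CARD('n)"
    by (simp add: \<mu>d d_def[symmetric] quad_def matrix_blinfun_apply)
qed

lemma viscosity_det_approximation:
  fixes u :: "real^'n \<Rightarrow> real"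
  assumes u: "convex_on (cball a R) u" and cont: "continuous_on (cball a R) u" and R: "R > 0"
    and c: "c \<ge> 0" and \<epsilon>: "\<epsilon> > 0"
    and visc: "\<And>C \<phi> G D y z r. C21 C \<phi> G D \<Longrightarrow> y \<in> ball z r \<Longrightarrow> ball z r \<subseteq> cball a (R/2) \<Longrightarrow>
      (\<And>w. w \<in> ball z r \<Longrightarrow> \<phi> y - u y \<le> \<phi> w - u w) \<Longrightarrow> c \<le> det (matrix (blinfun_apply (D y)))"
  obtains C W G D where "C21 C W G D" "\<And>x. x \<in> cball a (R/2) \<Longrightarrow> \<bar>W x - u x\<bar> \<le> \<epsilon>"
    "\<And>x. x \<in> cball a (R/4) \<Longrightarrow> c \<le> det (matrix (blinfun_apply (D x)))"
proof -
  obtain M where M: "\<And>x. x \<in> cball a R \<Longrightarrow> \<bar>u x\<bar> \<le> M"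
    using compact_imp_bounded[OF compact_continuous_image[OF cont compact_cball]]
    unfolding bounded_iff by (metis image_eqI real_norm_def)
  define L where "L = 4 * M / R"
  have "a \<in> cball a R" using R by simp
  from M[OF this] have L: "L \<ge> 0" using R by (simp add: L_def)
  obtain U where U: "convex_on UNIV U" "\<And>x y. \<bar>U x - U y\<bar> \<le> L * norm (x - y)"
      "\<And>x. x \<in> cball a (R/2) \<Longrightarrow> U x = u x"
  proof (rule convex_lipschitz_extension[of "cball a (R/2)" u L])
    show "convex_on (cball a (R/2)) u" using u R by (auto intro: convex_on_subset)
    show "\<bar>u x - u y\<bar> \<le> L * norm (x - y)" if "x \<in> cball a (R/2)" "y \<in> cball a (R/2)" for x y
      unfolding L_def by (rule convex_on_cball_imp_lipschitz[OF u R M that])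
  qed (use R L in auto)
  have cU: "continuous_on UNIV U"
  proof (rule lipschitz_on_continuous_on[of L])
    show "L-lipschitz_on UNIV U" using U(2) L by (auto simp: lipschitz_on_def dist_norm)
  qed
  \<comment> \<open>The radii fit because \<open>R/4 + R/16 + R/8 < R/2\<close>: all test balls lie
    where \<open>U\<close> equals \<open>u\<close>. The other bound keeps the mollification error
    below \<open>\<epsilon>\<close>.\<close>
  define s where "s = min (R / 16) (\<epsilon> / (L + 1))"
  have s: "s > 0" "s \<le> R / 16" unfolding s_def using R \<epsilon> L by (simp, intro min.cobounded1)
  have sL: "L * s \<le> \<epsilon>"
  proof -
    have "L * s \<le> (L + 1) * (\<epsilon> / (L + 1))" using L s \<epsilon> by (intro mult_mono) (auto simp: s_def)
    then show ?thesis using L by simp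
  qed
  obtain C G D where W: "C21 C (moll s U) G D" using moll_C21[OF s(1) U(1,2) cU] by blast
  show thesis
  proof (rule that[OF W])
    show "\<bar>moll s U x - u x\<bar> \<le> \<epsilon>" if "x \<in> cball a (R/2)" for x
      using moll_close[OF s(1) U(2) L cU, of x] U(3)[OF that] sL by simp
    fix x assume x: "x \<in> cball a (R/4)"
    have sub: "ball z (R/8) \<subseteq> cball a (R/2)" if "z \<in> cball x s" for z
    proof
      fix w assume "w \<in> ball z (R/8)"
      then show "w \<in> cball a (R/2)"
        using that x s dist_triangle[of a w z] dist_triangle[of a z x] by auto
    qed
    show "c \<le> det (matrix (blinfun_apply (D x)))"
    proof (rule viscosity_det_mollification[OF U(1,2) L s(1) _ c W, where r = "R/8"])
      fix C \<phi> G D y z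
      assume C: "C21 C \<phi> G D" and z: "z \<in> cball x s" and y: "y \<in> ball z (R/8)"
        and w: "\<And>w. w \<in> ball z (R/8) \<Longrightarrow> \<phi> y - U y \<le> \<phi> w - U w"
      have eq: "U w = u w" if "w \<in> ball z (R/8)" for w using U(3) sub[OF z] that by blast
      show "c \<le> det (matrix (blinfun_apply (D y)))"
        by (rule visc[OF C y sub[OF z]]) (use w eq y in metis)
    qed (use R in simp)
  qed
qed

section \<open>Doubling of variables\<close>


lemma grad_eq:
  assumes "(\<phi> has_derivative (\<lambda>h. h \<bullet> p)) (at x)" shows "grad \<phi> x = p"
  unfolding grad_def
proof (rule the_equality)
  show "GDERIV \<phi> x :> p" using assms by (simp add: gderiv_def)
  fix D assume "GDERIV \<phi> x :> D"
  then have "(\<lambda>h. h \<bullet> D) = (\<lambda>h. h \<bullet> p)"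
    using has_derivative_unique assms by (simp add: gderiv_def)
  then have "(D - p) \<bullet> D = (D - p) \<bullet> p" by metis
  then have "(D - p) \<bullet> (D - p) = 0" by (simp add: inner_diff_right)
  then show "D = p" by simp
qed

lemma C21_grad: "C21 C \<phi> G D \<Longrightarrow> grad \<phi> x = G x"
  by (rule grad_eq[OF C21D(2)])

lemma C21_hessian:
  assumes "C21 C \<phi> G D" shows "hessian \<phi> x = matrix (blinfun_apply (D x))"
proof -
  have "grad \<phi> = G" using C21_grad[OF assms] by auto
  then show ?thesis
    unfolding hessian_def jacobian_def using frechet_derivative_at[OF C21D(3)[OF assms, of x]] by simp
qed

lemma C21_C2_on:
  assumes "C21 C \<phi> G D" shows "C2_on V \<phi>"
proof -
  have g: "grad \<phi> = G" using C21_grad[OF assms] by auto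
  have "C-lipschitz_on UNIV D"
    using C21D(4)[OF assms] C21_nonneg[OF assms] by (auto simp: lipschitz_on_def dist_norm)
  then have D: "continuous_on V D" using lipschitz_on_continuous_on continuous_on_subset by blast
  have "continuous_on V (\<lambda>x. \<chi> i j. D x (axis j 1) $ i)"
    by (intro continuous_intros D)
  then have "continuous_on V (hessian \<phi>)"
    using C21_hessian[OF assms] by (simp add: matrix_def cong: continuous_on_cong)
  then show ?thesis
    unfolding C2_on_def g
    using C21D(2,3)[OF assms] by (auto intro: differentiableI)
qed

lemma C21_convex_fun_on: "C21 C \<phi> G D \<Longrightarrow> convex_fun_on V \<phi>"
  unfolding convex_fun_on_def using C21D(1) convex_on_subset by blast

lemma viscosity_subsolution_C21:
  assumes "viscosity_subsolution \<Omega> f u" "C21 C \<phi> G D" "open U" "y \<in> U" "U \<subseteq> \<Omega>"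
    "\<And>x. x \<in> U \<Longrightarrow> \<phi> y - u y \<le> \<phi> x - u x"
  shows "f y (u y) (G y) \<le> det (matrix (blinfun_apply (D y)))"
proof -
  have "f y (u y) (grad \<phi> y) \<le> det (hessian \<phi> y)"
    using assms C21_C2_on[OF assms(2)] C21_convex_fun_on[OF assms(2)]
    unfolding viscosity_subsolution_def by blast
  then show ?thesis by (simp add: C21_grad[OF assms(2)] C21_hessian[OF assms(2)])
qed

lemma viscosity_supersolution_C21:
  assumes "viscosity_supersolution \<Omega> f u" "C21 C \<phi> G D" "open U" "y \<in> U" "U \<subseteq> \<Omega>"
    "\<And>x. x \<in> U \<Longrightarrow> \<phi> x - u x \<le> \<phi> y - u y"
  shows "det (matrix (blinfun_apply (D y))) \<le> f y (u y) (G y)"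
proof -
  have "det (hessian \<phi> y) \<le> f y (u y) (grad \<phi> y)"
    using assms C21_C2_on[OF assms(2)] C21_convex_fun_on[OF assms(2)]
    unfolding viscosity_supersolution_def by blast
  then show ?thesis by (simp add: C21_grad[OF assms(2)] C21_hessian[OF assms(2)])
qed

text \<open>The point \<open>y\<close> is the convex combination of \<open>y - t *\<^sub>R h\<close>
  and \<open>x\<close> with weights \<open>1 / (1 + t)\<close> and \<open>t / (1 + t)\<close>.
  Convexity bounds the backward difference quotient of \<open>u\<close> by \<open>u x - u y\<close>,
  and contact from above bounds that of \<open>\<phi>\<close> by that of \<open>u\<close>.\<close>

lemma touching_above_subgradient:
  fixes u \<phi> :: "'a::real_inner \<Rightarrow> real"
  assumes u: "convex_on S u" and \<phi>: "(\<phi> has_derivative (\<lambda>h. h \<bullet> p)) (at y)"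
    and U: "open U" "y \<in> U" "U \<subseteq> S" and touch: "\<And>x. x \<in> U \<Longrightarrow> \<phi> y - u y \<le> \<phi> x - u x"
    and x: "x \<in> S"
  shows "p \<bullet> (x - y) \<le> u x - u y"
proof -
  define h where "h = x - y"
  have d: "((\<lambda>t. \<phi> (y - t *\<^sub>R h)) has_derivative (\<lambda>t. (- (t *\<^sub>R h)) \<bullet> p)) (at 0)"
  proof (rule has_derivative_compose[where g = \<phi>])
    show "((\<lambda>t. y - t *\<^sub>R h) has_derivative (\<lambda>t. - (t *\<^sub>R h))) (at 0)"
      by (auto intro!: derivative_eq_intros)
    show "(\<phi> has_derivative (\<lambda>h. h \<bullet> p)) (at (y - 0 *\<^sub>R h))" using \<phi> by simp
  qed
  then have "((\<lambda>t. \<phi> (y - t *\<^sub>R h)) has_real_derivative (- (p \<bullet> h))) (at 0)"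
    unfolding has_field_derivative_def by (rule has_derivative_eq_rhs) (auto simp: inner_commute)
  then have "((\<lambda>t. (\<phi> (y - t *\<^sub>R h) - \<phi> y) / t) \<longlongrightarrow> - (p \<bullet> h)) (at 0)"
    by (simp add: DERIV_def)
  then have "((\<lambda>t. - ((\<phi> (y - t *\<^sub>R h) - \<phi> y) / t)) \<longlongrightarrow> - (- (p \<bullet> h))) (at 0)"
    by (rule tendsto_minus)
  then have lim: "((\<lambda>t. - ((\<phi> (y - t *\<^sub>R h) - \<phi> y) / t)) \<longlongrightarrow> p \<bullet> h) (at_right 0)"
    using filterlim_at_split by (simp add: filterlim_at_split)
  have "((\<lambda>t. y - t *\<^sub>R h) \<longlongrightarrow> y - 0 *\<^sub>R h) (at_right 0)" by (intro tendsto_intros)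
  then have "\<forall>\<^sub>F t in at_right 0. y - t *\<^sub>R h \<in> U" using U by (intro topological_tendstoD) auto
  then have ev: "\<forall>\<^sub>F t in at_right 0. - ((\<phi> (y - t *\<^sub>R h) - \<phi> y) / t) \<le> u x - u y"
    using eventually_at_right_less[of 0]
  proof eventually_elim
    case (elim t)
    have w: "1 - t / (1 + t) = 1 / (1 + t)" using elim by (simp add: field_simps)
    have "(1 + t) *\<^sub>R ((1 - t / (1 + t)) *\<^sub>R (y - t *\<^sub>R h) + (t / (1 + t)) *\<^sub>R x) = (1 + t) *\<^sub>R y"
    proof -
      have m: "(1 + t) * (1 / (1 + t)) = 1" "(1 + t) * (t / (1 + t)) = t" using elim by simp_all
      show ?thesis unfolding w scaleR_add_right scaleR_scaleR m by (simp add: h_def algebra_simps)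
    qed
    then have eq: "(1 - t / (1 + t)) *\<^sub>R (y - t *\<^sub>R h) + (t / (1 + t)) *\<^sub>R x = y" using elim by simp
    have "u ((1 - t / (1 + t)) *\<^sub>R (y - t *\<^sub>R h) + (t / (1 + t)) *\<^sub>R x)
        \<le> (1 - t / (1 + t)) * u (y - t *\<^sub>R h) + (t / (1 + t)) * u x"
      by (rule convex_onD[OF u]) (use elim U x in auto)
    then have "u y \<le> (u (y - t *\<^sub>R h) + t * u x) / (1 + t)"
      unfolding eq unfolding w by (simp add: add_divide_distrib)
    then have "u y - u (y - t *\<^sub>R h) \<le> t * (u x - u y)" using elim by (simp add: field_simps)
    moreover have "\<phi> y - \<phi> (y - t *\<^sub>R h) \<le> u y - u (y - t *\<^sub>R h)" using touch[OF elim(1)] by simp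
    ultimately have "\<phi> y - \<phi> (y - t *\<^sub>R h) \<le> t * (u x - u y)" by simp
    then show ?case using elim by (simp add: field_simps)
  qed
  show ?thesis using tendsto_upperbound[OF lim ev] by (simp add: h_def)
qed

text \<open>The subgradient is tested at distance \<open>\<rho>\<close> from \<open>y\<close> in the
  direction of \<open>p - q\<close>. There \<open>u\<close> exceeds its supporting plane at
  \<open>a\<close> by at most \<open>K * (2 * \<rho>)\<^sup>2\<close>; division by
  \<open>\<rho>\<close> gives the bound. The slack \<open>\<epsilon>\<close> admits approximations
  \<open>w\<close> of \<open>u\<close>.\<close>

lemma subgradient_near_quadratic_contact:
  fixes u w :: "'a::real_inner \<Rightarrow> real"
  assumes \<rho>: "\<rho> > 0" and K: "K \<ge> 0"
    and up: "\<And>x. x \<in> cball a (2 * \<rho>) \<Longrightarrow> u x \<le> u a + q \<bullet> (x - a) + K * (norm (x - a))\<^sup>2"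
    and low: "\<And>x. x \<in> cball a (2 * \<rho>) \<Longrightarrow> u a + q \<bullet> (x - a) \<le> u x"
    and near: "\<And>x. x \<in> cball a (2 * \<rho>) \<Longrightarrow> \<bar>w x - u x\<bar> \<le> \<epsilon>"
    and y: "y \<in> cball a \<rho>"
    and p: "\<And>x. x \<in> cball a (2 * \<rho>) \<Longrightarrow> p \<bullet> (x - y) \<le> w x - w y"
  shows "norm (p - q) \<le> 4 * K * \<rho> + 2 * \<epsilon> / \<rho>"
proof (cases "p = q")
  case True
  have "\<epsilon> \<ge> 0" using near[of a] \<rho> by simp
  then show ?thesis using True \<rho> K by simp
next
  case False
  define e where "e = (p - q) /\<^sub>R norm (p - q)"
  have e: "norm e = 1" "(p - q) \<bullet> e = norm (p - q)"
    using False by (auto simp: e_def power2_norm_eq_inner[symmetric] power2_eq_square)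
  define z where "z = y + \<rho> *\<^sub>R e"
  have nz: "norm (z - a) \<le> 2 * \<rho>"
    using norm_triangle_ineq[of "y - a" "\<rho> *\<^sub>R e"] y e \<rho>
    by (simp add: z_def dist_norm norm_minus_commute algebra_simps)
  then have z: "z \<in> cball a (2 * \<rho>)" by (simp add: dist_norm norm_minus_commute)
  have y2: "y \<in> cball a (2 * \<rho>)" using y \<rho> by simp
  have "\<rho> * (p \<bullet> e) = p \<bullet> (z - y)" by (simp add: z_def)
  also have "\<dots> \<le> w z - w y" by (rule p[OF z])
  also have "\<dots> \<le> u z - u y + 2 * \<epsilon>" using near[OF z] near[OF y2] by (simp add: abs_le_iff)
  also have "\<dots> \<le> q \<bullet> (z - y) + K * (norm (z - a))\<^sup>2 + 2 * \<epsilon>"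
    using up[OF z] low[OF y2] by (simp add: inner_diff_right)
  also have "\<dots> \<le> \<rho> * (q \<bullet> e) + K * (2 * \<rho>)\<^sup>2 + 2 * \<epsilon>"
    using nz K by (intro add_mono mult_left_mono power_mono) (auto simp: z_def)
  finally have "\<rho> * ((p - q) \<bullet> e) \<le> 4 * K * \<rho>\<^sup>2 + 2 * \<epsilon>"
    by (simp add: inner_diff_left algebra_simps power2_eq_square)
  then show ?thesis using \<rho> e by (simp add: field_simps power2_eq_square)
qed

text \<open>The doubling-of-variables inequality without the theorem on sums. At a maximum point, \<open>u\<close> is
  convex and touched from above by a paraboloid, hence all its subgradients near \<open>x0\<close> are close to
  \<open>q\<close>; so \<open>det D\<^sup>2u \<ge> c\<close> near \<open>x0\<close> with a constant \<open>c\<close>, and \<open>u\<close> may be replaced by a smooth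
  approximation, a translate of which is a test function for \<open>v\<close>.\<close>
lemma doubling_inequality:
  fixes u v :: "real^'n \<Rightarrow> real"
  assumes \<Omega>: "open \<Omega>" "convex \<Omega>"
    and f: "continuous_on (\<Omega> \<times> {..<0} \<times> UNIV) (\<lambda>(x, z, q). f x z q)"
    and fpos: "\<And>x z q. x \<in> \<Omega> \<Longrightarrow> z < 0 \<Longrightarrow> 0 < f x z q"
    and u: "viscosity_subsolution \<Omega> f u" and v: "viscosity_supersolution \<Omega> f v"
    and K: "K > 0" and \<eta>: "\<eta> > 0" and x0: "x0 \<in> \<Omega>" and z0: "z0 \<in> \<Omega>"
    and max: "\<And>x z. x \<in> \<Omega> \<Longrightarrow> z \<in> \<Omega> \<Longrightarrow>
      u x + \<eta> / 2 * (norm x)\<^sup>2 - v z - K * (norm (x - z))\<^sup>2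
      \<le> u x0 + \<eta> / 2 * (norm x0)\<^sup>2 - v z0 - K * (norm (x0 - z0))\<^sup>2"
  defines "q \<equiv> (2 * K) *\<^sub>R (x0 - z0) - \<eta> *\<^sub>R x0"
  shows "f x0 (u x0) q \<le> f z0 (v z0) (q + \<eta> *\<^sub>R x0)"
    and "\<And>x. x \<in> \<Omega> \<Longrightarrow> q \<bullet> (x - x0) \<le> u x - u x0"
proof -
  have au: "continuous_on \<Omega> u" "convex_on \<Omega> u" "\<And>x. x \<in> \<Omega> \<Longrightarrow> u x < 0"
    and av: "continuous_on \<Omega> v" "convex_on \<Omega> v" "\<And>x. x \<in> \<Omega> \<Longrightarrow> v x < 0"
    using u v closure_subset \<Omega>(2) unfolding viscosity_subsolution_def viscosity_supersolution_def admissible_def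
    by (meson continuous_on_subset convex_on_subset)+
  have up: "u x \<le> u x0 + q \<bullet> (x - x0) + K * (norm (x - x0))\<^sup>2" if x: "x \<in> \<Omega>" for x
  proof -
    \<comment> \<open>Only the first variable moves; the second stays at \<open>z0\<close>.\<close>
    have "u x \<le> u x0 + \<eta> / 2 * (norm x0)\<^sup>2 - \<eta> / 2 * (norm x)\<^sup>2
        + K * (norm (x - z0))\<^sup>2 - K * (norm (x0 - z0))\<^sup>2"
      using max[OF x z0] by simp
    also have "\<dots> = u x0 + q \<bullet> (x - x0) + K * (norm (x - x0))\<^sup>2 - \<eta> / 2 * (norm (x - x0))\<^sup>2"
      unfolding power2_norm_eq_inner q_def by (simp add: algebra_simps inner_commute)
    also have "\<dots> \<le> u x0 + q \<bullet> (x - x0) + K * (norm (x - x0))\<^sup>2" using \<eta> by simp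
    finally show ?thesis .
  qed
  show low: "q \<bullet> (x - x0) \<le> u x - u x0" if x: "x \<in> \<Omega>" for x
  proof (rule touching_above_subgradient[OF au(2) _ \<Omega>(1) x0 subset_refl _ x,
        where \<phi> = "\<lambda>x. q \<bullet> (x - x0) + K * (norm (x - x0))\<^sup>2"])
    show "((\<lambda>x. q \<bullet> (x - x0) + K * (norm (x - x0))\<^sup>2) has_derivative (\<lambda>h. h \<bullet> q)) (at x0)"
      unfolding power2_norm_eq_inner by (auto intro!: derivative_eq_intros simp: inner_commute)
    show "q \<bullet> (x0 - x0) + K * (norm (x0 - x0))\<^sup>2 - u x0 \<le> q \<bullet> (x - x0) + K * (norm (x - x0))\<^sup>2 - u x"
      if "x \<in> \<Omega>" for x using up[OF that] by simp
  qed
  define q' where "q' = q + \<eta> *\<^sub>R x0"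
  show "f x0 (u x0) q \<le> f z0 (v z0) (q + \<eta> *\<^sub>R x0)"
  proof (rule ccontr)
    assume "\<not> f x0 (u x0) q \<le> f z0 (v z0) (q + \<eta> *\<^sub>R x0)"
    \<comment> \<open>The constant that freezes the right-hand side: by continuity \<open>f\<close>
      stays above \<open>c\<close> along \<open>u\<close> near \<open>(x0, q)\<close> and below
      \<open>c\<close> along \<open>v\<close> near \<open>(z0, q')\<close>.\<close>
    then obtain c where c: "f z0 (v z0) q' < c" "c < f x0 (u x0) q"
      unfolding q'_def using dense not_le by blast
    have c0: "c > 0" using fpos[OF z0 av(3)[OF z0], of q'] c by simp
    have cont: "continuous_on (\<Omega> \<times> UNIV) (\<lambda>(x, p). f x (w x) p)"
      if w: "continuous_on \<Omega> w" "\<And>x. x \<in> \<Omega> \<Longrightarrow> w x < 0" for w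
    proof -
      have "continuous_on (\<Omega> \<times> UNIV) (\<lambda>y. (fst y, w (fst y), snd y))"
        by (intro continuous_intros continuous_on_compose2[OF w(1)]) auto
      moreover have "(\<lambda>y. (fst y, w (fst y), snd y)) ` (\<Omega> \<times> UNIV) \<subseteq> \<Omega> \<times> {..<0} \<times> UNIV"
        using w(2) by auto
      ultimately have "continuous_on (\<Omega> \<times> UNIV) (\<lambda>y. (\<lambda>(x, z, q). f x z q) (fst y, w (fst y), snd y))"
        by (rule continuous_on_compose2[OF f])
      then show ?thesis by (simp add: case_prod_unfold)
    qed
    obtain \<delta>1 where \<delta>1: "\<delta>1 > 0"
      "\<And>x p. x \<in> \<Omega> \<Longrightarrow> norm (x - x0) < \<delta>1 \<Longrightarrow> norm (p - q) < \<delta>1 \<Longrightarrow> c < f x (u x) p"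
    proof -
      have "continuous (at (x0, q) within \<Omega> \<times> UNIV) (\<lambda>(x, p). f x (u x) p)"
        using cont[OF au(1,3)] x0 by (simp add: continuous_on_eq_continuous_within)
      then have "\<forall>\<^sub>F y in at (x0, q) within \<Omega> \<times> UNIV. c < (\<lambda>(x, p). f x (u x) p) y"
        unfolding continuous_within using c(2) by (intro order_tendstoD) auto
      then obtain d where d: "d > 0" "\<And>y. y \<in> \<Omega> \<times> UNIV \<Longrightarrow> y \<noteq> (x0, q) \<Longrightarrow> dist y (x0, q) < d
          \<Longrightarrow> c < (\<lambda>(x, p). f x (u x) p) y"
        unfolding eventually_at by blast
      have "c < f x (u x) p" if "x \<in> \<Omega>" "norm (x - x0) < d / 2" "norm (p - q) < d / 2" for x p
      proof -
        have "dist (x, p) (x0, q) \<le> dist x x0 + dist p q"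
          unfolding dist_prod_def by (simp add: sqrt_sum_squares_le_sum)
        then show ?thesis using d(2)[of "(x, p)"] that c(2) by (cases "(x, p) = (x0, q)") (auto simp: dist_norm)
      qed
      then show ?thesis using that[of "d / 2"] d(1) by auto
    qed
    obtain \<delta>2 where \<delta>2: "\<delta>2 > 0"
      "\<And>x p. x \<in> \<Omega> \<Longrightarrow> norm (x - z0) < \<delta>2 \<Longrightarrow> norm (p - q') < \<delta>2 \<Longrightarrow> f x (v x) p < c"
    proof -
      have "continuous (at (z0, q') within \<Omega> \<times> UNIV) (\<lambda>(x, p). f x (v x) p)"
        using cont[OF av(1,3)] z0 by (simp add: continuous_on_eq_continuous_within)
      then have "\<forall>\<^sub>F y in at (z0, q') within \<Omega> \<times> UNIV. (\<lambda>(x, p). f x (v x) p) y < c"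
        unfolding continuous_within using c(1) by (intro order_tendstoD) auto
      then obtain d where d: "d > 0" "\<And>y. y \<in> \<Omega> \<times> UNIV \<Longrightarrow> y \<noteq> (z0, q') \<Longrightarrow> dist y (z0, q') < d
          \<Longrightarrow> (\<lambda>(x, p). f x (v x) p) y < c"
        unfolding eventually_at by blast
      have "f x (v x) p < c" if "x \<in> \<Omega>" "norm (x - z0) < d / 2" "norm (p - q') < d / 2" for x p
      proof -
        have "dist (x, p) (z0, q') \<le> dist x z0 + dist p q'"
          unfolding dist_prod_def by (simp add: sqrt_sum_squares_le_sum)
        then show ?thesis using d(2)[of "(x, p)"] that c(1) by (cases "(x, p) = (z0, q')") (auto simp: dist_norm)
      qed
      then show ?thesis using that[of "d / 2"] d(1) by auto
    qed
    define \<delta> where "\<delta> = min \<delta>1 \<delta>2"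
    have \<delta>: "\<delta> > 0" "\<delta> \<le> \<delta>1" "\<delta> \<le> \<delta>2" using \<delta>1 \<delta>2 by (auto simp: \<delta>_def)
    obtain R0 where R0: "R0 > 0" "cball x0 R0 \<subseteq> \<Omega>" using \<Omega>(1) x0 open_contains_cball by blast
    obtain R1 where R1: "R1 > 0" "cball z0 R1 \<subseteq> \<Omega>" using \<Omega>(1) z0 open_contains_cball by blast
    \<comment> \<open>The bound by \<open>\<delta> / (16 * K)\<close> uses up less than half of the
      permitted gradient deviation; the other half is reserved for the approximation error.\<close>
    define \<rho> where "\<rho> = min (R0 / 2) (min (\<delta> / 2) (\<delta> / (16 * K)))"
    have \<rho>: "\<rho> > 0" "2 * \<rho> \<le> R0" "\<rho> < \<delta>" "4 * K * \<rho> < \<delta> / 2"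
    proof -
      show "\<rho> > 0" using R0 \<delta> K by (simp add: \<rho>_def)
      have "\<rho> \<le> R0 / 2" "\<rho> \<le> \<delta> / 2" "\<rho> \<le> \<delta> / (16 * K)" by (auto simp: \<rho>_def)
      then show "2 * \<rho> \<le> R0" "\<rho> < \<delta>" "4 * K * \<rho> < \<delta> / 2"
        using K \<delta> by (auto simp: field_simps)
    qed
    define \<rho>' where "\<rho>' = min R1 (\<delta> / 2)"
    have \<rho>': "\<rho>' > 0" "\<rho>' \<le> R1" "\<rho>' < \<delta>" using R1 \<delta> by (auto simp: \<rho>'_def)
    have sub: "cball x0 (2 * \<rho>) \<subseteq> \<Omega>" "cball x0 \<rho> \<subseteq> \<Omega>" "cball x0 (\<rho> / 2) \<subseteq> \<Omega>" "cball z0 \<rho>' \<subseteq> \<Omega>"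
      using R0 R1 \<rho> \<rho>' by (auto intro: order_trans)
    \<comment> \<open>Replacing \<open>\<eta> / 2 * (norm x)\<^sup>2\<close> by its linear part at
      \<open>x0\<close> subtracts \<open>\<eta> / 2 * (norm (x - x0))\<^sup>2\<close> up to a
      constant, so the maximum becomes strict in \<open>x\<close>. In \<open>z\<close> it is strict
      because \<open>v\<close> is convex and the penalty strictly convex.\<close>
    define \<Phi> where "\<Phi> y = u (fst y) + \<eta> * (x0 \<bullet> fst y) - v (snd y) - K * (norm (fst y - snd y))\<^sup>2" for y
    have \<Phi>_strict: "\<Phi> (x, z) < \<Phi> (x0, z0)" if xz: "x \<in> \<Omega>" "z \<in> \<Omega>" "(x, z) \<noteq> (x0, z0)" for x z
    proof (cases "x = x0")
      case False
      have "\<Phi> (x, z) = (u x + \<eta> / 2 * (norm x)\<^sup>2 - v z - K * (norm (x - z))\<^sup>2)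
          - \<eta> / 2 * (norm (x - x0))\<^sup>2 + \<eta> / 2 * (norm x0)\<^sup>2"
        unfolding power2_norm_eq_inner \<Phi>_def by (simp add: algebra_simps inner_commute)
      also have "\<dots> < (u x + \<eta> / 2 * (norm x)\<^sup>2 - v z - K * (norm (x - z))\<^sup>2) + \<eta> / 2 * (norm x0)\<^sup>2"
        using False \<eta> by simp
      also have "\<dots> \<le> \<Phi> (x0, z0)"
        using max[OF xz(1,2)] by (simp add: \<Phi>_def power2_norm_eq_inner)
      finally show ?thesis .
    next
      case True
      then have ne: "z \<noteq> z0" using xz by simp
      define m where "m = (1/2) *\<^sub>R z + (1/2) *\<^sub>R z0"
      have m: "m \<in> \<Omega>" unfolding m_def by (rule convexD[OF \<Omega>(2) xz(2) z0]) auto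
      have 1: "v m \<le> (1/2) * v z + (1/2) * v z0"
        unfolding m_def using convex_onD[OF av(2), of "1/2" z z0] xz z0 by simp
      have 2: "(norm (x0 - m))\<^sup>2 = (norm (x0 - z))\<^sup>2 / 2 + (norm (x0 - z0))\<^sup>2 / 2 - (norm (z - z0))\<^sup>2 / 4"
        unfolding power2_norm_eq_inner m_def
        by (simp add: algebra_simps inner_commute add_divide_distrib diff_divide_distrib)
      have "K * (norm (z - z0))\<^sup>2 > 0" using K ne by simp
      moreover have "- v m - K * (norm (x0 - m))\<^sup>2 \<le> - v z0 - K * (norm (x0 - z0))\<^sup>2"
        using max[OF x0 m] by simp
      ultimately have "- v z - K * (norm (x0 - z))\<^sup>2 < - v z0 - K * (norm (x0 - z0))\<^sup>2"
        using 1 unfolding 2 by (simp add: algebra_simps)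
      then show ?thesis using True by (simp add: \<Phi>_def)
    qed
    define P where "P = cball x0 (\<rho> / 2) \<times> cball z0 \<rho>'"
    define B where "B = P - ball x0 (\<rho> / 2) \<times> ball z0 \<rho>'"
    have P\<Omega>: "P \<subseteq> \<Omega> \<times> \<Omega>" unfolding P_def using sub by blast
    have cP: "compact P" unfolding P_def by (intro compact_Times compact_cball)
    have cB: "compact B" unfolding B_def by (intro compact_diff cP open_Times open_ball)
    have im: "fst ` P \<subseteq> \<Omega>" "snd ` P \<subseteq> \<Omega>" using P\<Omega> by auto
    have cu: "continuous_on P (\<lambda>y. u (fst y))"
      by (rule continuous_on_compose2[OF au(1) continuous_on_fst[OF continuous_on_id] im(1)])
    have cv: "continuous_on P (\<lambda>y. v (snd y))"
      by (rule continuous_on_compose2[OF av(1) continuous_on_snd[OF continuous_on_id] im(2)])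
    have c\<Phi>: "continuous_on P \<Phi>" unfolding \<Phi>_def by (intro continuous_intros cu cv)
    \<comment> \<open>Strictness leaves a margin on the compact set \<open>B\<close>; an
      approximation of \<open>u\<close> within less than half of it keeps the maximum over
      \<open>P\<close> off \<open>B\<close>.\<close>
    obtain \<theta> where \<theta>: "\<theta> > 0" "\<And>y. y \<in> B \<Longrightarrow> \<Phi> y \<le> \<Phi> (x0, z0) - \<theta>"
    proof (cases "B = {}")
      case True then show ?thesis using that[of 1] by simp
    next
      case False
      obtain b where b: "b \<in> B" "\<And>y. y \<in> B \<Longrightarrow> \<Phi> y \<le> \<Phi> b"
        using continuous_attains_sup[OF cB False continuous_on_subset[OF c\<Phi>]] by (auto simp: B_def)
      have "b \<noteq> (x0, z0)" "b \<in> \<Omega> \<times> \<Omega>" using b(1) \<rho> \<rho>' P\<Omega> by (auto simp: B_def)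
      then have "\<Phi> b < \<Phi> (x0, z0)" using \<Phi>_strict[of "fst b" "snd b"] by (auto simp: mem_Times_iff)
      then show ?thesis using that[of "\<Phi> (x0, z0) - \<Phi> b"] b(2) by auto
    qed
    define \<epsilon> where "\<epsilon> = min (\<theta> / 4) (\<delta> * \<rho> / 16)"
    have \<epsilon>: "\<epsilon> > 0" "2 * \<epsilon> < \<theta>" "2 * \<epsilon> / (\<rho> / 2) < \<delta> / 2"
    proof -
      show "\<epsilon> > 0" using \<theta> \<delta> \<rho> by (simp add: \<epsilon>_def)
      have "\<epsilon> \<le> \<theta> / 4" "\<epsilon> \<le> \<delta> * \<rho> / 16" by (auto simp: \<epsilon>_def)
      moreover have "\<delta> * \<rho> > 0" using \<delta> \<rho> by simp
      ultimately show "2 * \<epsilon> < \<theta>" "2 * \<epsilon> / (\<rho> / 2) < \<delta> / 2"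
        using \<theta>(1) \<rho>(1) by (auto simp: divide_less_eq)
    qed
    have up2: "u x \<le> u x0 + q \<bullet> (x - x0) + K * (norm (x - x0))\<^sup>2"
      and low2: "u x0 + q \<bullet> (x - x0) \<le> u x" if "x \<in> cball x0 (2 * \<rho>)" for x
      using up low that sub(1) by (auto simp: subset_iff) (smt (verit))
    \<comment> \<open>Approximation from radius \<open>2 * \<rho>\<close> gives closeness on the
      ball of half that radius and the determinant bound on the ball of a quarter.\<close>
    obtain C W G D where W: "C21 C W G D"
      and Wu: "\<And>x. x \<in> cball x0 \<rho> \<Longrightarrow> \<bar>W x - u x\<bar> \<le> \<epsilon>"
      and Wdet: "\<And>x. x \<in> cball x0 (\<rho> / 2) \<Longrightarrow> c \<le> det (matrix (blinfun_apply (D x)))"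
    proof (rule viscosity_det_approximation[of x0 "2 * \<rho>" u c \<epsilon>])
      show "convex_on (cball x0 (2 * \<rho>)) u" "continuous_on (cball x0 (2 * \<rho>)) u"
        using au sub(1) by (auto intro: convex_on_subset continuous_on_subset)
      show "c \<le> det (matrix (blinfun_apply (D y)))"
        if \<phi>: "C21 C \<phi> G D" and y: "y \<in> ball z r" and zr: "ball z r \<subseteq> cball x0 (2 * \<rho> / 2)"
          and touch: "\<And>w. w \<in> ball z r \<Longrightarrow> \<phi> y - u y \<le> \<phi> w - u w" for C \<phi> G D y z r
      proof -
        have zr\<Omega>: "ball z r \<subseteq> \<Omega>" and y\<rho>: "y \<in> cball x0 \<rho>" using zr sub(2) y by auto
        have "norm (G y - q) \<le> 4 * K * \<rho> + 2 * 0 / \<rho>"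
        proof (rule subgradient_near_quadratic_contact[OF \<rho>(1) _ up2 low2 _ y\<rho>])
          show "G y \<bullet> (x - y) \<le> u x - u y" if "x \<in> cball x0 (2 * \<rho>)" for x
            by (rule touching_above_subgradient[OF au(2) C21D(2)[OF \<phi>] open_ball y zr\<Omega> touch])
               (use that sub in auto)
        qed (use K in auto)
        then have "norm (G y - q) < \<delta>1" using \<rho> \<delta> by simp
        moreover have "norm (y - x0) < \<delta>1" using y\<rho> \<rho> \<delta> by (simp add: dist_norm norm_minus_commute)
        moreover have "y \<in> \<Omega>" using y zr\<Omega> by blast
        ultimately have "c < f y (u y) (G y)" using \<delta>1(2) by blast
        also have "\<dots> \<le> det (matrix (blinfun_apply (D y)))"
          by (rule viscosity_subsolution_C21[OF u \<phi> open_ball y zr\<Omega> touch])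
        finally show ?thesis by simp
      qed
      show "2 * \<rho> > 0" "c \<ge> 0" "\<epsilon> > 0" using \<rho>(1) c0 \<epsilon>(1) by auto
    next
      fix C W G D
      assume "C21 C W G D" "\<And>x. x \<in> cball x0 (2 * \<rho> / 2) \<Longrightarrow> \<bar>W x - u x\<bar> \<le> \<epsilon>"
        "\<And>x. x \<in> cball x0 (2 * \<rho> / 4) \<Longrightarrow> c \<le> det (matrix (blinfun_apply (D x)))"
      then show thesis using that[of C W G D] by simp
    qed
    define \<Psi> where "\<Psi> y = \<Phi> y + (W (fst y) - u (fst y))" for y
    have "continuous_on UNIV W"
      using C21D(2)[OF W] by (meson continuous_at_imp_continuous_on has_derivative_continuous)
    then have "continuous_on P (\<lambda>y. W (fst y))"
      by (rule continuous_on_compose2[OF _ continuous_on_fst[OF continuous_on_id] subset_UNIV])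
    then have "continuous_on P \<Psi>" unfolding \<Psi>_def by (intro continuous_on_add continuous_on_diff c\<Phi> cu)
    moreover have P0: "(x0, z0) \<in> P" using \<rho> \<rho>' by (simp add: P_def)
    ultimately obtain y where y: "y \<in> P" "\<And>y'. y' \<in> P \<Longrightarrow> \<Psi> y' \<le> \<Psi> y"
      using continuous_attains_sup[OF cP, of \<Psi>] by blast
    have close: "\<bar>\<Psi> y - \<Phi> y\<bar> \<le> \<epsilon>" if "y \<in> P" for y
      using Wu[of "fst y"] that \<rho> by (auto simp: \<Psi>_def P_def)
    have "y \<notin> B"
    proof
      assume "y \<in> B"
      then show False using \<theta>(2)[of y] close[OF y(1)] close[OF P0] y(2)[OF P0] \<epsilon>(2) by linarith
    qed
    obtain xs zs where ys: "y = (xs, zs)" by (cases y)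
    have xs: "xs \<in> ball x0 (\<rho> / 2)" and zs: "zs \<in> ball z0 \<rho>'"
      using \<open>y \<notin> B\<close> y(1) by (auto simp: B_def ys)
    \<comment> \<open>With the difference of the two points held at \<open>xs - zs\<close> the
      penalty is constant. Maximality of \<open>\<Psi>\<close> at \<open>(xs, zs)\<close> then says
      that this function touches \<open>v\<close> from below at \<open>zs\<close>, up to an additive
      constant.\<close>
    define \<phi> where "\<phi> z = W (z + (xs - zs)) + ((\<eta> *\<^sub>R x0) \<bullet> z + 0)" for z
    have \<phi>: "C21 (C + 0) \<phi> (\<lambda>z. G (z + (xs - zs)) + \<eta> *\<^sub>R x0) (\<lambda>z. D (z + (xs - zs)) + 0)"
      unfolding \<phi>_def by (intro C21_add C21_shift W C21_affine)
    define U where "U = ball z0 \<rho>' \<inter> (\<lambda>z. z + (xs - zs)) -` ball x0 (\<rho> / 2)"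
    have U: "open U" "zs \<in> U" "U \<subseteq> \<Omega>"
    proof -
      have "open ((\<lambda>z. z + (xs - zs)) -` ball x0 (\<rho> / 2))"
        by (intro open_vimage open_ball continuous_intros)
      then show "open U" unfolding U_def by (intro open_Int open_ball)
      show "zs \<in> U" using xs zs by (simp add: U_def)
      show "U \<subseteq> \<Omega>" using sub(4) by (auto simp: U_def)
    qed
    have touch: "\<phi> z - v z \<le> \<phi> zs - v zs" if z: "z \<in> U" for z
    proof -
      have "(z + (xs - zs), z) \<in> P" using z by (auto simp: U_def P_def)
      from y(2)[OF this] show ?thesis
        by (simp add: ys \<Psi>_def \<Phi>_def \<phi>_def algebra_simps)
    qed
    have "c \<le> det (matrix (blinfun_apply (D xs)))" using Wdet[of xs] xs by simp
    also have "\<dots> \<le> f zs (v zs) (G xs + \<eta> *\<^sub>R x0)"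
      using viscosity_supersolution_C21[OF v \<phi> U touch] by simp
    also have "\<dots> < c"
    proof (rule \<delta>2(2))
      show "zs \<in> \<Omega>" using U by blast
      show "norm (zs - z0) < \<delta>2" using zs \<rho>' \<delta> by (simp add: dist_norm norm_minus_commute)
      have "norm (G xs - q) \<le> 4 * K * (\<rho> / 2) + 2 * \<epsilon> / (\<rho> / 2)"
      proof (rule subgradient_near_quadratic_contact[where a = x0 and u = u and w = W])
        show "G xs \<bullet> (x - xs) \<le> W x - W xs" for x
          by (rule touching_above_subgradient[OF C21D(1)[OF W] C21D(2)[OF W] open_UNIV]) auto
      qed (use \<rho> K xs up2 low2 Wu in auto)
      also have "\<dots> < \<delta>2" using \<rho> \<delta> \<epsilon> K by (smt (verit) field_sum_of_halves mult_left_mono)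
      finally show "norm (G xs + \<eta> *\<^sub>R x0 - q') < \<delta>2" by (simp add: q'_def)
    qed
    finally show False by simp
  qed
qed

section \<open>Comparison and uniqueness\<close>


text \<open>Moving by \<open>d\<close> in the direction of \<open>q\<close> raises the supporting
  plane by \<open>d * norm q\<close>, which cannot exceed the oscillation
  \<open>2 * M\<close>.\<close>

lemma subgradient_norm_le:
  fixes u :: "'a::real_inner \<Rightarrow> real"
  assumes d: "d > 0" and M: "\<And>y. y \<in> cball x d \<Longrightarrow> \<bar>u y\<bar> \<le> M"
    and q: "\<And>y. y \<in> cball x d \<Longrightarrow> q \<bullet> (y - x) \<le> u y - u x"
  shows "norm q \<le> 2 * M / d"
proof (cases "q = 0")
  case True
  then show ?thesis using M[of x] d by simp
next
  case False
  define y where "y = x + (d / norm q) *\<^sub>R q"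
  have y: "y \<in> cball x d" using False d by (simp add: y_def dist_norm)
  have "d * norm q = q \<bullet> (y - x)"
    using False by (simp add: y_def power2_norm_eq_inner[symmetric] power2_eq_square)
  also have "\<dots> \<le> u y - u x" by (rule q[OF y])
  also have "\<dots> \<le> 2 * M" using M[OF y] M[of x] d by (simp add: abs_le_iff)
  finally show ?thesis using d by (simp add: field_simps)
qed

text \<open>As \<open>K\<close> grows, the vectors \<open>q j\<close> might be unbounded. But they
  are subgradients of \<open>u\<close> at points approaching an interior point, hence bounded by the
  oscillation of \<open>u\<close>, and a subsequence converges; in the limit both sides share the
  same point and gradient.\<close>

theorem viscosity_comparison:
  fixes u v :: "real^'n \<Rightarrow> real"
  assumes \<Omega>: "open \<Omega>" "convex \<Omega>" "bounded \<Omega>"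
    and f: "continuous_on (\<Omega> \<times> {..<0} \<times> UNIV) (\<lambda>(x, z, q). f x z q)"
    and fpos: "\<And>x z q. x \<in> \<Omega> \<Longrightarrow> z < 0 \<Longrightarrow> 0 < f x z q"
    and mono: "\<And>x q. x \<in> \<Omega> \<Longrightarrow> strict_mono_on {..<0} (\<lambda>z. f x z q)"
    and u: "viscosity_subsolution \<Omega> f u" and v: "viscosity_supersolution \<Omega> f v"
    and bdry: "\<And>x. x \<in> frontier \<Omega> \<Longrightarrow> u x \<le> v x" and x: "x \<in> \<Omega>"
  shows "u x \<le> v x"
proof (rule ccontr)
  assume "\<not> u x \<le> v x"
  define m where "m = u x - v x"
  have m: "m > 0" using \<open>\<not> u x \<le> v x\<close> by (simp add: m_def)
  have cu: "continuous_on (closure \<Omega>) u" and cv: "continuous_on (closure \<Omega>) v"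
    and u0: "\<And>x. x \<in> \<Omega> \<Longrightarrow> u x < 0" and v0: "\<And>x. x \<in> \<Omega> \<Longrightarrow> v x < 0"
    using u v by (auto simp: viscosity_subsolution_def viscosity_supersolution_def admissible_def)
  have comp: "compact (closure \<Omega>)" using \<Omega>(3) by (simp add: compact_closure)
  have cls: "\<And>x. x \<in> \<Omega> \<Longrightarrow> x \<in> closure \<Omega>" using closure_subset by blast
  have bd: "\<exists>M. \<forall>x\<in>closure \<Omega>. \<bar>w x\<bar> \<le> M" if "continuous_on (closure \<Omega>) w" for w :: "real^'n \<Rightarrow> real"
    using compact_imp_bounded[OF compact_continuous_image[OF that comp]] by (auto simp: bounded_iff)
  obtain Mu where Mu: "\<And>x. x \<in> closure \<Omega> \<Longrightarrow> \<bar>u x\<bar> \<le> Mu" using bd[OF cu] by blast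
  obtain Mv where Mv: "\<And>x. x \<in> closure \<Omega> \<Longrightarrow> \<bar>v x\<bar> \<le> Mv" using bd[OF cv] by blast
  obtain b where b: "\<And>x. x \<in> closure \<Omega> \<Longrightarrow> norm x \<le> b"
    using compact_imp_bounded[OF comp] by (auto simp: bounded_iff)
  \<comment> \<open>The two parameters are tied by \<open>\<eta> = 1 / K\<close>, so a single limit
    suffices; only the positive values \<open>K = real (Suc j)\<close> are used.\<close>
  define \<psi> where "\<psi> K y = u (fst y) + 1 / K / 2 * (norm (fst y))\<^sup>2 - v (snd y) - K * (norm (fst y - snd y))\<^sup>2"
    for K :: real and y
  have "\<exists>y. y \<in> closure \<Omega> \<times> closure \<Omega> \<and> (\<forall>y'\<in>closure \<Omega> \<times> closure \<Omega>. \<psi> K y' \<le> \<psi> K y)" for K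
  proof -
    have "continuous_on (closure \<Omega> \<times> closure \<Omega>) (\<lambda>y. u (fst y))"
      by (rule continuous_on_compose2[OF cu continuous_on_fst[OF continuous_on_id]]) auto
    moreover have "continuous_on (closure \<Omega> \<times> closure \<Omega>) (\<lambda>y. v (snd y))"
      by (rule continuous_on_compose2[OF cv continuous_on_snd[OF continuous_on_id]]) auto
    ultimately have "continuous_on (closure \<Omega> \<times> closure \<Omega>) (\<psi> K)"
      unfolding \<psi>_def by (intro continuous_on_add continuous_on_diff continuous_on_mult
        continuous_on_const continuous_on_power continuous_on_norm continuous_on_fst continuous_on_snd continuous_on_id)
    moreover have "closure \<Omega> \<times> closure \<Omega> \<noteq> {}" using cls[OF x] by blast
    ultimately show ?thesis
      using continuous_attains_sup[OF compact_Times[OF comp comp]] by blast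
  qed
  then obtain Y where Y: "\<And>K. Y K \<in> closure \<Omega> \<times> closure \<Omega>"
    "\<And>K y. y \<in> closure \<Omega> \<times> closure \<Omega> \<Longrightarrow> \<psi> K y \<le> \<psi> K (Y K)" by metis
  define X where "X j = fst (Y (real (Suc j)))" for j
  define Z where "Z j = snd (Y (real (Suc j)))" for j
  define e where "e j = 1 / real (Suc j)" for j
  have XZ: "X j \<in> closure \<Omega>" "Z j \<in> closure \<Omega>" for j
    using Y(1)[of "real (Suc j)"] by (auto simp: X_def Z_def mem_Times_iff)
  have e: "e j > 0" "e j \<le> 1" for j by (auto simp: e_def)
  have elim: "e \<longlonglongrightarrow> 0" unfolding e_def by (rule LIMSEQ_Suc[OF lim_1_over_n])
  have max: "u y + e j / 2 * (norm y)\<^sup>2 - v z - real (Suc j) * (norm (y - z))\<^sup>2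
      \<le> u (X j) + e j / 2 * (norm (X j))\<^sup>2 - v (Z j) - real (Suc j) * (norm (X j - Z j))\<^sup>2"
    if "y \<in> closure \<Omega>" "z \<in> closure \<Omega>" for j y z
    using Y(2)[of "(y, z)" "real (Suc j)"] that by (simp add: \<psi>_def X_def Z_def e_def del: of_nat_Suc)
  \<comment> \<open>Comparison with the diagonal point \<open>(x, x)\<close>, where the penalty
    vanishes.\<close>
  have ge: "m + real (Suc j) * (norm (X j - Z j))\<^sup>2 \<le> u (X j) + e j / 2 * (norm (X j))\<^sup>2 - v (Z j)" for j
  proof -
    have "0 \<le> e j / 2 * (norm x)\<^sup>2" using e(1)[of j] by simp
    then show ?thesis using max[OF cls[OF x] cls[OF x], of j] by (simp add: m_def del: of_nat_Suc)
  qed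
  \<comment> \<open>A bound for the penalty that is uniform in \<open>j\<close>; it forces
    \<open>X j\<close> and \<open>Z j\<close> together.\<close>
  define C where "C = Mu + Mv + b\<^sup>2"
  have XZn: "(norm (X j - Z j))\<^sup>2 \<le> C * e j" for j
  proof -
    have "e j / 2 * (norm (X j))\<^sup>2 \<le> 1 * b\<^sup>2"
      using e[of j] b[OF XZ(1)] by (intro mult_mono power_mono) auto
    then have "real (Suc j) * (norm (X j - Z j))\<^sup>2 \<le> C"
      using ge[of j] Mu[OF XZ(1), of j] Mv[OF XZ(2), of j] m by (simp add: C_def abs_le_iff del: of_nat_Suc)
    then show ?thesis by (simp add: e_def field_simps del: of_nat_Suc)
  qed
  have "(\<lambda>j. C * e j) \<longlonglongrightarrow> 0" using tendsto_mult_left[OF elim, of C] by simp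
  then have "(\<lambda>j. (norm (X j - Z j))\<^sup>2) \<longlonglongrightarrow> 0"
    by (rule tendsto_sandwich[where f = "\<lambda>_. 0", rotated 3]) (use XZn in \<open>simp_all del: power_eq_0_iff\<close>)
  then have "(\<lambda>j. sqrt ((norm (X j - Z j))\<^sup>2)) \<longlonglongrightarrow> sqrt 0" by (rule tendsto_real_sqrt)
  then have XZ0: "(\<lambda>j. X j - Z j) \<longlonglongrightarrow> 0" by (simp add: tendsto_norm_zero_iff)
  obtain a r where a: "a \<in> closure \<Omega>" and r: "strict_mono r" and Xr: "(X \<circ> r) \<longlonglongrightarrow> a"
    using comp XZ(1) unfolding compact_def by metis
  have "(\<lambda>j. X (r j) - (X (r j) - Z (r j))) \<longlonglongrightarrow> a - 0"
    by (intro tendsto_diff) (use Xr LIMSEQ_subseq_LIMSEQ[OF XZ0 r] in \<open>auto simp: o_def\<close>)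
  then have Zr: "(Z \<circ> r) \<longlonglongrightarrow> a" by (simp add: o_def)
  have er: "(e \<circ> r) \<longlonglongrightarrow> 0" by (rule LIMSEQ_subseq_LIMSEQ[OF elim r])
  have seqlim: "(\<lambda>j. w (s j)) \<longlonglongrightarrow> w a"
    if "continuous_on (closure \<Omega>) w" "s \<longlonglongrightarrow> a" "\<And>j. s j \<in> closure \<Omega>" for w :: "real^'n \<Rightarrow> real" and s
    by (rule continuous_on_tendsto_compose[OF that(1,2) a]) (use that(3) in auto)
  have uX: "(\<lambda>j. u ((X \<circ> r) j)) \<longlonglongrightarrow> u a" by (rule seqlim[OF cu Xr]) (simp add: XZ)
  have vZ: "(\<lambda>j. v ((Z \<circ> r) j)) \<longlonglongrightarrow> v a" by (rule seqlim[OF cv Zr]) (simp add: XZ)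
  have gap: "m \<le> u a - v a"
  proof -
    have "(\<lambda>j. u ((X \<circ> r) j) + (e \<circ> r) j / 2 * (norm ((X \<circ> r) j))\<^sup>2 - v ((Z \<circ> r) j)) \<longlonglongrightarrow> u a + 0 / 2 * (norm a)\<^sup>2 - v a"
      by (intro tendsto_intros uX vZ er Xr) auto
    moreover have "m \<le> u ((X \<circ> r) j) + (e \<circ> r) j / 2 * (norm ((X \<circ> r) j))\<^sup>2 - v ((Z \<circ> r) j)" for j
    proof -
      have "0 \<le> real (Suc (r j)) * (norm (X (r j) - Z (r j)))\<^sup>2" by simp
      then show ?thesis using ge[of "r j"] unfolding comp_def by linarith
    qed
    ultimately have "m \<le> u a + 0 / 2 * (norm a)\<^sup>2 - v a" by (intro LIMSEQ_le_const) auto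
    then show ?thesis by simp
  qed
  \<comment> \<open>A positive gap is incompatible with the order on the boundary.\<close>
  have a\<Omega>: "a \<in> \<Omega>"
  proof -
    have "a \<notin> frontier \<Omega>" using gap m bdry[of a] by auto
    then show ?thesis using a \<Omega>(1) by (simp add: frontier_def interior_open)
  qed
  \<comment> \<open>The radius is halved so that balls of radius \<open>d\<close> around points of
    \<open>ball a d\<close> still lie in \<open>\<Omega>\<close>.\<close>
  obtain d where d: "d > 0" "cball a (2 * d) \<subseteq> \<Omega>"
  proof -
    obtain d where "d > 0" "cball a d \<subseteq> \<Omega>" using a\<Omega> \<Omega>(1) open_contains_cball by blast
    then show ?thesis using that[of "d / 2"] by simp
  qed
  define q where "q j = (2 * real (Suc j)) *\<^sub>R (X j - Z j) - e j *\<^sub>R X j" for j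
  have ball: "\<forall>\<^sub>F j in sequentially. (X \<circ> r) j \<in> ball a d" "\<forall>\<^sub>F j in sequentially. (Z \<circ> r) j \<in> ball a d"
    using topological_tendstoD[OF Xr open_ball] topological_tendstoD[OF Zr open_ball] d(1) by auto
  obtain N where N: "\<And>j. j \<ge> N \<Longrightarrow> (X \<circ> r) j \<in> ball a d \<and> (Z \<circ> r) j \<in> ball a d"
    using eventually_conj[OF ball] unfolding eventually_sequentially by auto
  \<comment> \<open>Dropping finitely many indices puts every remaining term into the ball.\<close>
  define r' where "r' j = r (j + N)" for j
  have r': "X (r' j) \<in> ball a d" "Z (r' j) \<in> ball a d" for j
    using N[of "j + N"] by (auto simp: r'_def)
  have sub: "ball a d \<subseteq> \<Omega>" using d by auto
  have ineq: "f (X (r' j)) (u (X (r' j))) (q (r' j)) \<le> f (Z (r' j)) (v (Z (r' j))) (q (r' j) + e (r' j) *\<^sub>R X (r' j))"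
    and sg: "\<And>y. y \<in> \<Omega> \<Longrightarrow> q (r' j) \<bullet> (y - X (r' j)) \<le> u y - u (X (r' j))" for j
  proof -
    have "X (r' j) \<in> \<Omega>" "Z (r' j) \<in> \<Omega>" using r' sub by auto
    note D = doubling_inequality[OF \<Omega>(1,2) f fpos u v _ e(1) this max, OF _ _ _ cls cls]
    show "f (X (r' j)) (u (X (r' j))) (q (r' j)) \<le> f (Z (r' j)) (v (Z (r' j))) (q (r' j) + e (r' j) *\<^sub>R X (r' j))"
      unfolding q_def by (rule D(1)) auto
    show "q (r' j) \<bullet> (y - X (r' j)) \<le> u y - u (X (r' j))" if "y \<in> \<Omega>" for y
      unfolding q_def by (rule D(2)) (use that in auto)
  qed
  have "norm (q (r' j)) \<le> 2 * Mu / d" for j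
  proof (rule subgradient_norm_le[OF d(1)])
    fix y assume "y \<in> cball (X (r' j)) d"
    then have "y \<in> cball a (2 * d)" using r'(1)[of j] dist_triangle[of a y "X (r' j)"] by auto
    then have "y \<in> \<Omega>" using d by auto
    then show "\<bar>u y\<bar> \<le> Mu" "q (r' j) \<bullet> (y - X (r' j)) \<le> u y - u (X (r' j))" using Mu cls sg by auto
  qed
  then have "\<forall>j. (q \<circ> r') j \<in> cball 0 (2 * Mu / d)" by (simp add: dist_norm)
  moreover have "compact (cball (0 :: real^'n) (2 * Mu / d))" by (rule compact_cball)
  ultimately obtain p s where s: "strict_mono s" and qs: "((q \<circ> r') \<circ> s) \<longlonglongrightarrow> p"
    unfolding compact_def by metis
  have shift: "(\<lambda>j. g (r' (s j))) \<longlonglongrightarrow> l" if "(g \<circ> r) \<longlonglongrightarrow> l" for g :: "nat \<Rightarrow> 'b::topological_space" and l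
  proof -
    have "(\<lambda>j. (g \<circ> r) (j + N)) \<longlonglongrightarrow> l" using that by (rule LIMSEQ_ignore_initial_segment)
    from LIMSEQ_subseq_LIMSEQ[OF this s] show ?thesis by (simp add: r'_def o_def)
  qed
  have X': "(\<lambda>j. X (r' (s j))) \<longlonglongrightarrow> a" and Z': "(\<lambda>j. Z (r' (s j))) \<longlonglongrightarrow> a"
    and uX': "(\<lambda>j. u (X (r' (s j)))) \<longlonglongrightarrow> u a" and vZ': "(\<lambda>j. v (Z (r' (s j)))) \<longlonglongrightarrow> v a"
    and e': "(\<lambda>j. e (r' (s j))) \<longlonglongrightarrow> 0"
    using shift[OF Xr] shift[OF Zr] shift[of "\<lambda>j. u (X j)"] shift[of "\<lambda>j. v (Z j)"] shift[OF er] uX vZ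
    by (auto simp: o_def)
  have q': "(\<lambda>j. q (r' (s j))) \<longlonglongrightarrow> p" using qs by (simp add: o_def)
  have q'': "(\<lambda>j. q (r' (s j)) + e (r' (s j)) *\<^sub>R X (r' (s j))) \<longlonglongrightarrow> p + 0 *\<^sub>R a"
    by (intro tendsto_intros q' e' X')
  have flim: "(\<lambda>j. f (y j) (w j) (k j)) \<longlonglongrightarrow> f a w0 k0"
    if "y \<longlonglongrightarrow> a" "w \<longlonglongrightarrow> w0" "k \<longlonglongrightarrow> k0" "\<And>j. y j \<in> \<Omega>" "\<And>j. w j < 0" "w0 < 0" for y w k w0 k0
  proof -
    have "(\<lambda>j. (y j, w j, k j)) \<longlonglongrightarrow> (a, w0, k0)" using that by (intro tendsto_Pair)
    from continuous_on_tendsto_compose[OF f this] show ?thesis using that a\<Omega> by auto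
  qed
  have in\<Omega>: "X (r' j) \<in> \<Omega>" "Z (r' j) \<in> \<Omega>" for j using r' sub by auto
  have L1: "(\<lambda>j. f (X (r' (s j))) (u (X (r' (s j)))) (q (r' (s j)))) \<longlonglongrightarrow> f a (u a) p"
    by (rule flim[OF X' uX' q']) (use in\<Omega> u0 a\<Omega> in auto)
  have L2: "(\<lambda>j. f (Z (r' (s j))) (v (Z (r' (s j)))) (q (r' (s j)) + e (r' (s j)) *\<^sub>R X (r' (s j))))
      \<longlonglongrightarrow> f a (v a) (p + 0 *\<^sub>R a)"
    by (rule flim[OF Z' vZ' q'']) (use in\<Omega> v0 a\<Omega> in auto)
  have "f a (u a) p \<le> f a (v a) p" using LIMSEQ_le[OF L1 L2] ineq by auto
  \<comment> \<open>Here \<open>v a < u a < 0\<close>, so strict monotonicity contradicts the limit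
    inequality.\<close>
  moreover have "f a (v a) p < f a (u a) p"
    using strict_mono_onD[OF mono[OF a\<Omega>], of "v a" "u a" p] u0[OF a\<Omega>] v0[OF a\<Omega>] gap m by simp
  ultimately show False by simp
qed

theorem theorem1p3:
  fixes \<Omega> :: "(real^'n) set"
    and f :: "real^'n \<Rightarrow> real \<Rightarrow> real^'n \<Rightarrow> real"
    and A \<alpha> \<beta> \<gamma> \<delta>\<^sub>0 :: real
    and u v :: "real^'n \<Rightarrow> real"
  assumes "CARD('n) \<ge> 2"
    and "open \<Omega>" and "\<Omega> \<noteq> {}" and "bounded \<Omega>" and "convex \<Omega>"
    and f1: "continuous_on (\<Omega> \<times> {..<0} \<times> UNIV) (\<lambda>(x, z, q). f x z q)"
    and f2: "\<And>x q. x \<in> \<Omega> \<Longrightarrow> mono_on {..<0} (\<lambda>z. f x z q)"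
    and "A > 0" and "\<beta> \<ge> real CARD('n) + 1"
    and "\<gamma> < min (real CARD('n) + \<alpha>) (\<beta> - real CARD('n) + 1)"
    and f3: "\<And>x z q. x \<in> \<Omega> \<Longrightarrow> z < 0 \<Longrightarrow>
        0 < f x z q \<and>
        f x z q \<le> A * infdist x (frontier \<Omega>) powr (\<beta> - real CARD('n) - 1)
                    * \<bar>z\<bar> powr (- \<alpha>) * (1 + (norm q)\<^sup>2) powr (\<gamma> / 2)"
    and "0 < \<delta>\<^sub>0" and "\<delta>\<^sub>0 < 1"
    and f1': "locally_Hoelder_on \<delta>\<^sub>0 (\<Omega> \<times> {..<0} \<times> UNIV) (\<lambda>(x, z, q). f x z q)"
    and f2': "\<And>x q. x \<in> \<Omega> \<Longrightarrow> strict_mono_on {..<0} (\<lambda>z. f x z q)"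
    and "viscosity_solution \<Omega> f u" and "viscosity_solution \<Omega> f v"
  shows "\<forall>x\<in>closure \<Omega>. u x = v x"
proof
  fix x assume x: "x \<in> closure \<Omega>"
  have sol: "viscosity_subsolution \<Omega> f w" "viscosity_supersolution \<Omega> f w"
    "y \<in> frontier \<Omega> \<Longrightarrow> w y = 0" if "w = u \<or> w = v" for w y
    using that \<open>viscosity_solution \<Omega> f u\<close> \<open>viscosity_solution \<Omega> f v\<close>
    by (auto simp: viscosity_solution_def)
  have fpos: "0 < f x z q" if "x \<in> \<Omega>" "z < 0" for x z q using f3[OF that] by blast
  \<comment> \<open>Each of the two functions is both a subsolution and a supersolution with the
    same boundary values, so the comparison runs in both orders.\<close>
  have le: "w y \<le> w' y" if "w = u \<or> w = v" "w' = u \<or> w' = v" "y \<in> \<Omega>" for w w' y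
    by (rule viscosity_comparison[OF \<open>open \<Omega>\<close> \<open>convex \<Omega>\<close> \<open>bounded \<Omega>\<close> f1 fpos f2'
          sol(1)[OF that(1)] sol(2)[OF that(2)] _ that(3)])
       (use sol(3)[OF that(1)] sol(3)[OF that(2)] in auto)
  show "u x = v x"
  proof (cases "x \<in> \<Omega>")
    case True
    then show ?thesis using le[of u v x] le[of v u x] by auto
  next
    case False
    then have "x \<in> frontier \<Omega>" using x \<open>open \<Omega>\<close> by (simp add: frontier_def interior_open)
    then show ?thesis using sol(3)[of u x] sol(3)[of v x] by simp
  qed
qed

end
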